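(* Let $D\subset\mathbb{H}$ be an open domain and let $f:D\to\mathrm{Im}\,\mathbb{H}$ be a smooth function. Let $M=\{f(x)+xe:x\in D\}\subset\mathrm{Im}\,\mathbb{H}\oplus\mathbb{H}e=\mathrm{Im}\,\mathbb{O}$ be its graph. If $M$ is a coassociative submanifold of $\mathrm{Im}\,\mathbb{O}$ which has constant Jordan angles (CJA) relative to $\mathrm{Im}\,\mathbb{H}$, and if $g^N\le 2$ and $g^T\le 3$, then either $f$ is an affine linear function, or $$f(x)=\eta(x-x_0)+y_0\quad (x\in D),\qquad \eta(x)=\frac{\sqrt5}{2|x|}\,\bar x\,\varepsilon\, x,$$ for some $x_0\in\mathbb{H}$, $y_0\in\mathrm{Im}\,\mathbb{H}$ and some unit element $\varepsilon\in\mathrm{Im}\,\mathbb{H}$. In other words, $M$ is (an open piece of) an affine $4$-plane or a translate of an open subset of a Lawson-Osserman cone $\{r[(\sqrt5/2)\,qa\bar q+\bar qe]:q\in\mathbb{H},|q|=1,\ r>0\}$ with $a\in\mathrm{Im}\,\mathbb{H}$, $|a|=1$.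
   Context: Domains are connected. $\mathbb{H}$ denotes the quaternions and $\mathbb{O}=\mathbb{H}\oplus\mathbb{H}e$ the octonions, where $e$ is a unit element orthogonal to $\mathbb{H}$ and $(a+be)(c+de)=(ac-\bar d b)+(da+b\bar c)e$ for $a,b,c,d\in\mathbb{H}$; $\mathrm{Im}\,\mathbb{O}=\mathrm{Im}\,\mathbb{H}\oplus\mathbb{H}e\cong\mathbb{R}^7$ with its Euclidean inner product, and $(\mathrm{Im}\,\mathbb{H})^\perp=\mathbb{H}e$. A $3$-dimensional subspace $P\subset\mathrm{Im}\,\mathbb{O}$ is associative if $\mathbb{R}1\oplus P$ is a subalgebra of $\mathbb{O}$ isomorphic to $\mathbb{H}$. A $4$-dimensional submanifold $M\subset\mathrm{Im}\,\mathbb{O}$ is coassociative if its normal space at every point is associative. Jordan angles: for two linear subspaces $P,Q$ of the same dimension in Euclidean space, with orthogonal projections $\mathcal{P}$ onto $P$ and $\mathcal{P}_Q$ onto $Q$, $\theta\in[0,\pi/2]$ is a Jordan angle between $P$ and $Q$ if $\cos^2\theta$ is an eigenvalue of $(\mathcal{P}\circ\mathcal{P}_Q)|_P:P\to P$; its multiplicity is the dimension of the eigenspace; $\mathrm{Arg}(P,Q)$ is the set of Jordan angles. $M$ has constant Jordan angles (CJA) relative to $\mathrm{Im}\,\mathbb{H}$ if $\mathrm{Arg}(N_pM,\mathrm{Im}\,\mathbb{H})$, with multiplicities, is independent of $p\in M$ ($N_pM$ the normal space); then the same holds for $\mathrm{Arg}(T_pM,\mathbb{H}e)$. Write $\mathrm{Arg}^N=\mathrm{Arg}(N_pM,\mathrm{Im}\,\mathbb{H})$,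 $\mathrm{Arg}^T=\mathrm{Arg}(T_pM,\mathbb{H}e)$, $g^N=|\mathrm{Arg}^N|$, $g^T=|\mathrm{Arg}^T|$. *)

theory Defs
  imports "HOL-Analysis.Analysis"
begin

section \<open>Quaternions and octonions\<close>

text \<open>
  A quaternion is a pair (real part, imaginary part), and an octonion is a pair \<open>(a, b)\<close> standing
  for \<open>a + b e\<close>.  The Euclidean norm and inner product are those of the library product types.
  The quaternion product is expressed through the dot and cross product of imaginary parts; with the
  coordinate axes of \<open>real^3\<close> as \<open>i, j, k\<close> one gets \<open>i j = k\<close>.
\<close>

type_synonym quat = "real \<times> (real^3)"
type_synonym oct = "quat \<times> quat"

fun qmul :: "quat \<Rightarrow> quat \<Rightarrow> quat"  (infixl \<open>*\<^sub>H\<close> 70) where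
  "(s, u) *\<^sub>H (t, v) = (s * t - u \<bullet> v, s *\<^sub>R v + t *\<^sub>R u + cross3 u v)"

fun qcnj :: "quat \<Rightarrow> quat" where
  "qcnj (s, u) = (s, - u)"

definition one_H :: quat where
  "one_H = (1, 0)"

definition Im_H :: "quat set" where
  "Im_H = {q. fst q = 0}"

fun omul :: "oct \<Rightarrow> oct \<Rightarrow> oct"  (infixl \<open>*\<^sub>O\<close> 70) where
  "(a, b) *\<^sub>O (c, d) = (a *\<^sub>H c - qcnj d *\<^sub>H b, d *\<^sub>H a + b *\<^sub>H qcnj c)"

definition one_O :: oct where
  "one_O = (one_H, 0)"

definition Im_O :: "oct set" where
  "Im_O = {(a, b). a \<in> Im_H}"

definition Im_H_in_O :: "oct set" where
  "Im_H_in_O = {(a, 0) | a. a \<in> Im_H}"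

definition He :: "oct set" where
  "He = {(0, b) | b. True}"


section \<open>Smooth maps and submanifolds\<close>

text \<open>
  Class \<open>C\<^sup>n\<close> on an open set: all iterated directional derivatives up to order \<open>n\<close> exist and are
  differentiable or, at the last order, continuous.  Only meant for open sets and
  finite-dimensional domains.
\<close>

fun Ck_on :: "nat \<Rightarrow> ('a::real_normed_vector \<Rightarrow> 'b::real_normed_vector) \<Rightarrow> 'a set \<Rightarrow> bool" where
  "Ck_on 0 f S \<longleftrightarrow> continuous_on S f"
| "Ck_on (Suc n) f S \<longleftrightarrow>
     (\<forall>x\<in>S. f differentiable (at x)) \<and>
     (\<forall>v. Ck_on n (\<lambda>x. frechet_derivative f (at x) v) S)"

definition smooth_on :: "'a set \<Rightarrow> ('a::real_normed_vector \<Rightarrow> 'b::real_normed_vector) \<Rightarrow> bool" where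
  "smooth_on S f \<longleftrightarrow> (\<forall>n. Ck_on n f S)"

text \<open>Embedded submanifolds, by local diffeomorphisms onto open pieces of a linear subspace.\<close>

definition submanifold :: "nat \<Rightarrow> 'a::euclidean_space set \<Rightarrow> bool" where
  "submanifold k M \<longleftrightarrow>
     (\<forall>p\<in>M. \<exists>U W \<Phi> \<Psi> (K :: 'a set).
        open U \<and> p \<in> U \<and> open W \<and> homeomorphism U W \<Phi> \<Psi> \<and>
        smooth_on U \<Phi> \<and> smooth_on W \<Psi> \<and>
        subspace K \<and> dim K = k \<and> \<Phi> ` (M \<inter> U) = K \<inter> W)"

definition tangent_space :: "'a::euclidean_space set \<Rightarrow> 'a \<Rightarrow> 'a set" where
  "tangent_space M p =
     {v. \<exists>\<gamma> \<delta>. \<delta> > 0 \<and> smooth_on {-\<delta><..<\<delta>} \<gamma> \<and> \<gamma> ` {-\<delta><..<\<delta>} \<subseteq> M \<and>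
           \<gamma> 0 = p \<and> (\<gamma> has_vector_derivative v) (at (0::real))}"

text \<open>The ambient space is \<open>Im_O\<close>, not all of the octonions.\<close>

definition normal_space :: "oct set \<Rightarrow> oct \<Rightarrow> oct set" where
  "normal_space M p = Im_O \<inter> (tangent_space M p)\<^sup>\<bottom>"


section \<open>Associative subspaces and coassociative submanifolds\<close>

definition associative :: "oct set \<Rightarrow> bool" where
  "associative P \<longleftrightarrow>
     subspace P \<and> P \<subseteq> Im_O \<and> dim P = 3 \<and>
     (let A = {r *\<^sub>R one_O + p | r p. p \<in> P} in
        (\<forall>x\<in>A. \<forall>y\<in>A. x *\<^sub>O y \<in> A) \<and>
        (\<exists>\<phi> :: quat \<Rightarrow> oct. linear \<phi> \<and> bij_betw \<phi> UNIV A \<and> \<phi> one_H = one_O \<and>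
            (\<forall>a b. \<phi> (a *\<^sub>H b) = \<phi> a *\<^sub>O \<phi> b)))"

definition coassociative :: "oct set \<Rightarrow> bool" where
  "coassociative M \<longleftrightarrow>
     submanifold 4 M \<and> M \<subseteq> Im_O \<and> (\<forall>p\<in>M. associative (normal_space M p))"


section \<open>Jordan angles\<close>

definition orth_proj :: "'a::euclidean_space set \<Rightarrow> 'a \<Rightarrow> 'a" where
  "orth_proj P x = (THE y. y \<in> P \<and> x - y \<in> P\<^sup>\<bottom>)"

definition jordan_eigenspace :: "'a::euclidean_space set \<Rightarrow> 'a set \<Rightarrow> real \<Rightarrow> 'a set" where
  "jordan_eigenspace P Q \<theta> = {v \<in> P. orth_proj P (orth_proj Q v) = (cos \<theta>)\<^sup>2 *\<^sub>R v}"

definition jordan_angles :: "'a::euclidean_space set \<Rightarrow> 'a set \<Rightarrow> real set" where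
  "jordan_angles P Q = {\<theta>. 0 \<le> \<theta> \<and> \<theta> \<le> pi / 2 \<and> (\<exists>v \<in> jordan_eigenspace P Q \<theta>. v \<noteq> 0)}"

definition jordan_mult :: "'a::euclidean_space set \<Rightarrow> 'a set \<Rightarrow> real \<Rightarrow> nat" where
  "jordan_mult P Q \<theta> = dim (jordan_eigenspace P Q \<theta>)"

definition CJA :: "oct set \<Rightarrow> bool" where
  "CJA M \<longleftrightarrow>
     (\<forall>p\<in>M. \<forall>p'\<in>M.
        jordan_angles (normal_space M p) Im_H_in_O = jordan_angles (normal_space M p') Im_H_in_O \<and>
        (\<forall>\<theta> \<in> jordan_angles (normal_space M p) Im_H_in_O.
           jordan_mult (normal_space M p) Im_H_in_O \<theta> = jordan_mult (normal_space M p') Im_H_in_O \<theta>))"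

text \<open>For manifolds with constant Jordan angles the following two numbers do not depend on \<open>p\<close>.\<close>

definition g_N :: "oct set \<Rightarrow> oct \<Rightarrow> nat" where
  "g_N M p = card (jordan_angles (normal_space M p) Im_H_in_O)"

definition g_T :: "oct set \<Rightarrow> oct \<Rightarrow> nat" where
  "g_T M p = card (jordan_angles (tangent_space M p) He)"


section \<open>Graphs and Lawson-Osserman cones\<close>

definition oct_graph :: "quat set \<Rightarrow> (quat \<Rightarrow> quat) \<Rightarrow> oct set" where
  "oct_graph D f = {(f x, x) | x. x \<in> D}"

text \<open>Only meaningful for \<open>x \<noteq> 0\<close>.\<close>

definition LO_map :: "quat \<Rightarrow> quat \<Rightarrow> quat" where
  "LO_map \<epsilon> x = (sqrt 5 / (2 * norm x)) *\<^sub>R (qcnj x *\<^sub>H \<epsilon> *\<^sub>H x)"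

definition LO_cone :: "quat \<Rightarrow> oct set" where
  "LO_cone a =
     {r *\<^sub>R ((sqrt 5 / 2) *\<^sub>R (q *\<^sub>H a *\<^sub>H qcnj q), qcnj q) | q r. norm q = 1 \<and> r > 0}"

definition open_in_affine_4_plane :: "oct set \<Rightarrow> bool" where
  "open_in_affine_4_plane M \<longleftrightarrow>
     (\<exists>E. affine E \<and> aff_dim E = 4 \<and> E \<subseteq> Im_O \<and> openin (top_of_set E) M)"

definition open_in_translated_LO_cone :: "oct set \<Rightarrow> bool" where
  "open_in_translated_LO_cone M \<longleftrightarrow>
     (\<exists>a\<in>Im_H. norm a = 1 \<and>
        (\<exists>t\<in>Im_O. \<exists>U. openin (top_of_set (LO_cone a)) U \<and> M = (\<lambda>z. t + z) ` U))"

end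

theory Submission
  imports Defs
begin

text \<open>
  Let \<open>J\<close> be the differential of \<open>f\<close> at \<open>x\<close>, so that the normal space at \<open>(f x, x)\<close> is
  \<open>{(a, - J\<^sup>T a)}\<close>.  For a unit vector \<open>w\<close> orthogonal to the range of \<open>J\<^sup>T\<close>, associativity of this space
  means \<open>J v = S (Im (w\<^sup>* v))\<close> with \<open>S\<close> symmetric and \<open>tr S = det S\<close>, and the Jordan angles are
  the \<open>arctan \<bar>s\<bar>\<close> for the eigenvalues \<open>s\<close> of \<open>S\<close>.  Since at most two angles are
  distinct, \<open>S\<close> has, up to the sign of \<open>(w, S)\<close>, eigenvalues \<open>(l, - l, 0)\<close> or
  \<open>(l, l, \<mu>)\<close> with \<open>l > 0\<close> and \<open>2 l + \<mu> = l\<^sup>2 \<mu>\<close>, and these are constant by the CJA condition.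

  The operator \<open>\<Sum>b. b (\<partial>\<^sub>b f)\<close> sends \<open>f\<close> to \<open>- tr S w\<close>.  If \<open>tr S = 0\<close>, then \<open>f\<close> is harmonic and
  \<open>\<bar>J\<bar>\<^sup>2\<close> is constant, so \<open>f\<close> is affine by Bochner's argument.  Otherwise \<open>w\<close> is smooth.
  If \<open>\<mu> = l\<close>, then symmetry of the second derivative of \<open>f\<close> gives \<open>Dw = 0\<close>.  If \<open>\<mu> \<noteq> l\<close>, let \<open>n\<close> be
  a local unit eigenvector for \<open>\<mu>\<close> and \<open>\<nu> = w n\<close>.  Symmetry of the second derivative of \<open>f\<close>, then of those
  of \<open>w\<close> and \<open>\<nu>\<close>, shows that \<open>Dw\<close> and \<open>D\<nu>\<close> are determined by one function \<open>p\<close>,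
  that \<open>p = 0\<close> unless \<open>l = 2 \<mu>\<close>, and that \<open>G = p \<nu>\<close> then satisfies
  \<open>DG X = 2 \<langle>G, X\<rangle> G - \<bar>G\<bar>\<^sup>2 X\<close>.  The nonzero solutions are \<open>G x = - (x - x\<^sub>0) / \<bar>x - x\<^sub>0\<bar>\<^sup>2\<close>, which leads
  to the Lawson-Osserman map.
\<close>

text \<open>The normal form is available only point by point: \<open>w\<close>, the eigenvectors and
  their signs come without any continuity. In the regular case, the sign that makes the double
  eigenvalue positive gives the trace the same nonzero value at every point. Dividing the
  Fueter-type sum by this value exhibits \<open>w\<close> as a smooth function of the first
  derivatives of \<open>f\<close>. The unit eigenvector stays ambiguous up to sign and is made
  smooth only near each point; the argument is therefore steered towards \<open>G\<close>, which is
  the derivative of \<open>w\<close> along itself and so lives on all of \<open>D\<close>. Equality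
  of the angle sets alone could interchange the double and the simple eigenvalue between two points;
  the multiplicities in CJA rule this out. The constant is then forced: \<open>l = 2 \<mu>\<close>
  turns \<open>2 l + \<mu> = l\<^sup>2 \<mu>\<close> into 5 = 4 \<open>\<mu>\<^sup>2\<close>. The
  vertex of the cone lies over the pole of \<open>G\<close>, and \<open>f\<close> together with the
  unit \<open>\<epsilon>\<close> is read off from two first integrals.\<close>

section \<open>Calculus of smooth maps\<close>

text \<open>No differentiability is assumed: functions agreeing near a point have the same
  derivatives there, so the choice operator inside \<open>frechet_derivative\<close> selects the
  same one.\<close>

lemma frechet_derivative_cong_open:
  assumes "open S" "x \<in> S" "\<And>y. y \<in> S \<Longrightarrow> f y = g y"
  shows "frechet_derivative f (at x) = frechet_derivative g (at x)"
proof -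
  have "(f has_derivative d) (at x) \<longleftrightarrow> (g has_derivative d) (at x)" for d
    using assms has_derivative_transform_within_open[of f d x UNIV S g]
      has_derivative_transform_within_open[of g d x UNIV S f] by auto
  then show ?thesis
    unfolding frechet_derivative_def by presburger
qed

lemma Ck_on_Suc_has_derivative:
  "Ck_on (Suc n) f S \<Longrightarrow> x \<in> S \<Longrightarrow> (f has_derivative frechet_derivative f (at x)) (at x)"
  by (simp add: frechet_derivative_works[symmetric])

lemma Ck_on_cong:
  assumes "open S" "\<And>x. x \<in> S \<Longrightarrow> f x = g x" "Ck_on n f S"
  shows "Ck_on n g S"
  using assms(2,3)
proof (induction n arbitrary: f g)
  case 0
  then show ?case by (simp cong: continuous_on_cong)
next
  case (Suc n)
  have "g differentiable (at x)" if "x \<in> S" for x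
    using has_derivative_transform_within_open
      [OF Ck_on_Suc_has_derivative[OF Suc.prems(2) that] assms(1) that Suc.prems(1)]
    by (auto simp: differentiable_def)
  moreover have "Ck_on n (\<lambda>x. frechet_derivative g (at x) v) S" for v
  proof (rule Suc.IH)
    show "Ck_on n (\<lambda>x. frechet_derivative f (at x) v) S"
      using Suc.prems by simp
    show "frechet_derivative f (at x) v = frechet_derivative g (at x) v" if "x \<in> S" for x
      using frechet_derivative_cong_open[OF assms(1) that Suc.prems(1)] by simp
  qed
  ultimately show ?case by simp
qed

lemma Ck_on_SucD: "Ck_on (Suc n) f S \<Longrightarrow> Ck_on n f S"
proof (induction n arbitrary: f)
  case 0
  then show ?case
    by (auto intro!: continuous_at_imp_continuous_on differentiable_imp_continuous_within)
next
  case (Suc n)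
  have "Ck_on n (\<lambda>x. frechet_derivative f (at x) v) S" for v
    using Suc.prems by (intro Suc.IH) (simp only: Ck_on.simps(2)[of "Suc n"])
  moreover have "\<forall>x\<in>S. f differentiable at x"
    using Suc.prems by simp
  ultimately show ?case by simp
qed

lemma Ck_on_subset: "Ck_on n f S \<Longrightarrow> T \<subseteq> S \<Longrightarrow> Ck_on n f T"
  by (induction n arbitrary: f) (auto intro: continuous_on_subset)

lemma Ck_on_bounded_linear:
  assumes "open S" "bounded_linear L" "Ck_on n f S"
  shows "Ck_on n (\<lambda>x. L (f x)) S"
  using assms(3)
proof (induction n arbitrary: f)
  case 0
  then show ?case
    using assms(2) by (auto intro: bounded_linear.continuous_on)
next
  case (Suc n)
  have der: "((\<lambda>x. L (f x)) has_derivative (\<lambda>v. L (frechet_derivative f (at x) v))) (at x)"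
    if "x \<in> S" for x
    by (rule bounded_linear.has_derivative[OF assms(2) Ck_on_Suc_has_derivative[OF Suc.prems that]])
  have "Ck_on n (\<lambda>x. frechet_derivative (\<lambda>x. L (f x)) (at x) v) S" for v
    by (rule Ck_on_cong[OF assms(1) _ Suc.IH[of "\<lambda>x. frechet_derivative f (at x) v"]])
      (use frechet_derivative_at[OF der] Suc.prems in \<open>auto dest: fun_cong\<close>)
  then show ?case
    using der by (auto simp: differentiable_def)
qed

lemma Ck_on_add:
  assumes "open S" "Ck_on n f S" "Ck_on n g S"
  shows "Ck_on n (\<lambda>x. f x + g x) S"
  using assms(2,3)
proof (induction n arbitrary: f g)
  case 0
  then show ?case by (auto intro: continuous_on_add)
next
  case (Suc n)
  have der: "((\<lambda>x. f x + g x) has_derivative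
      (\<lambda>v. frechet_derivative f (at x) v + frechet_derivative g (at x) v)) (at x)"
    if "x \<in> S" for x
    using that by (intro has_derivative_add Ck_on_Suc_has_derivative[OF Suc.prems(1)]
        Ck_on_Suc_has_derivative[OF Suc.prems(2)])
  have "Ck_on n (\<lambda>x. frechet_derivative (\<lambda>x. f x + g x) (at x) v) S" for v
    by (rule Ck_on_cong[OF assms(1) _ Suc.IH[of "\<lambda>x. frechet_derivative f (at x) v"
          "\<lambda>x. frechet_derivative g (at x) v"]])
      (use frechet_derivative_at[OF der] Suc.prems in \<open>auto dest: fun_cong\<close>)
  then show ?case
    using der by (auto simp: differentiable_def)
qed

lemma Ck_on_const: "Ck_on n (\<lambda>x. c) S"
  by (induction n arbitrary: c) auto

lemma Ck_on_bounded_bilinear: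
  assumes "open S" "bounded_bilinear B" "Ck_on n f S" "Ck_on n g S"
  shows "Ck_on n (\<lambda>x. B (f x) (g x)) S"
  using assms(3,4)
proof (induction n arbitrary: f g)
  case 0
  then show ?case
    using assms(2) by (auto intro: bounded_bilinear.continuous_on)
next
  case (Suc n)
  have der: "((\<lambda>x. B (f x) (g x)) has_derivative
      (\<lambda>v. B (f x) (frechet_derivative g (at x) v) + B (frechet_derivative f (at x) v) (g x))) (at x)"
    if "x \<in> S" for x
    using that by (intro bounded_bilinear.FDERIV[OF assms(2)] Ck_on_Suc_has_derivative[OF Suc.prems(1)]
        Ck_on_Suc_has_derivative[OF Suc.prems(2)])
  have "Ck_on n (\<lambda>x. B (f x) (frechet_derivative g (at x) v) + B (frechet_derivative f (at x) v) (g x)) S"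
    for v
    using Suc.prems by (intro Ck_on_add assms(1) Suc.IH) (auto intro: Ck_on_SucD)
  then have "Ck_on n (\<lambda>x. frechet_derivative (\<lambda>x. B (f x) (g x)) (at x) v) S" for v
    by (rule Ck_on_cong[OF assms(1), rotated])
      (use frechet_derivative_at[OF der] in \<open>auto dest: fun_cong\<close>)
  then show ?case
    using der by (auto simp: differentiable_def)
qed

text \<open>With \<open>r\<close> the inverse root of \<open>h\<close>, the derivative is -1/2 times
  that of \<open>h\<close> times the cube of \<open>r\<close>, again built from products, so the
  induction closes. Needed to normalise the local eigenvector field.\<close>

lemma Ck_on_inverse_sqrt:
  fixes h :: "'a::real_normed_vector \<Rightarrow> real"
  assumes "open S" "\<And>x. x \<in> S \<Longrightarrow> h x > 0" "Ck_on n h S"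
  shows "Ck_on n (\<lambda>x. inverse (sqrt (h x))) S"
  using assms(3)
proof (induction n)
  case 0
  then show ?case
    using assms(2) by (auto intro!: continuous_intros simp: less_imp_neq[symmetric])
next
  case (Suc n)
  let ?r = "\<lambda>x. inverse (sqrt (h x))"
  have der: "(?r has_derivative
      (\<lambda>v. (- 1 / 2) * (frechet_derivative h (at x) v * (?r x * (?r x * ?r x))))) (at x)"
    if "x \<in> S" for x
  proof -
    have h: "(h has_derivative frechet_derivative h (at x)) (at x)"
      by (rule Ck_on_Suc_has_derivative[OF Suc.prems that])
    have "((\<lambda>y. inverse (sqrt y)) has_field_derivative (- 1 / 2 * (?r x * (?r x * ?r x)))) (at (h x))"
      using assms(2)[OF that]
      by (auto intro!: derivative_eq_intros simp: field_simps)
    from has_derivative_compose[OF h this[unfolded has_field_derivative_def]]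
    show ?thesis by (simp add: ac_simps)
  qed
  have r: "Ck_on n ?r S"
    using Suc by (blast intro: Ck_on_SucD)
  have "Ck_on n (\<lambda>x. (- 1 / 2) * (frechet_derivative h (at x) v * (?r x * (?r x * ?r x)))) S" for v
    using Suc.prems r
    by (intro Ck_on_bounded_bilinear[OF assms(1) bounded_bilinear_mult] Ck_on_const) auto
  then have "Ck_on n (\<lambda>x. frechet_derivative ?r (at x) v) S" for v
    by (rule Ck_on_cong[OF assms(1), rotated])
      (use frechet_derivative_at[OF der] in \<open>auto dest: fun_cong\<close>)
  then show ?case
    using der by (auto simp: differentiable_def)
qed

lemma smooth_on_subset: "smooth_on S f \<Longrightarrow> T \<subseteq> S \<Longrightarrow> smooth_on T f"
  unfolding smooth_on_def using Ck_on_subset by blast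

lemma smooth_on_cong:
  "open S \<Longrightarrow> (\<And>x. x \<in> S \<Longrightarrow> f x = g x) \<Longrightarrow> smooth_on S f \<Longrightarrow> smooth_on S g"
  unfolding smooth_on_def using Ck_on_cong by blast

lemma smooth_on_bounded_linear:
  "open S \<Longrightarrow> bounded_linear L \<Longrightarrow> smooth_on S f \<Longrightarrow> smooth_on S (\<lambda>x. L (f x))"
  unfolding smooth_on_def using Ck_on_bounded_linear by blast

lemma smooth_on_add:
  "open S \<Longrightarrow> smooth_on S f \<Longrightarrow> smooth_on S g \<Longrightarrow> smooth_on S (\<lambda>x. f x + g x)"
  unfolding smooth_on_def using Ck_on_add by blast

lemma smooth_on_const: "smooth_on S (\<lambda>x. c)"
  unfolding smooth_on_def using Ck_on_const by blast

lemma smooth_on_sum: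
  "open S \<Longrightarrow> (\<And>i. i \<in> I \<Longrightarrow> smooth_on S (f i)) \<Longrightarrow> smooth_on S (\<lambda>x. \<Sum>i\<in>I. f i x)"
  by (induction I rule: infinite_finite_induct) (auto intro: smooth_on_const smooth_on_add)

lemma smooth_on_bounded_bilinear:
  "open S \<Longrightarrow> bounded_bilinear B \<Longrightarrow> smooth_on S f \<Longrightarrow> smooth_on S g
    \<Longrightarrow> smooth_on S (\<lambda>x. B (f x) (g x))"
  unfolding smooth_on_def using Ck_on_bounded_bilinear by blast

lemma smooth_on_inverse_sqrt:
  fixes h :: "'a::real_normed_vector \<Rightarrow> real"
  shows "open S \<Longrightarrow> (\<And>x. x \<in> S \<Longrightarrow> h x > 0) \<Longrightarrow> smooth_on S h
    \<Longrightarrow> smooth_on S (\<lambda>x. inverse (sqrt (h x)))"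
  unfolding smooth_on_def using Ck_on_inverse_sqrt by blast

lemma smooth_on_frechet_derivative:
  "smooth_on S f \<Longrightarrow> smooth_on S (\<lambda>x. frechet_derivative f (at x) v)"
  unfolding smooth_on_def
proof
  fix n
  assume "\<forall>n. Ck_on n f S"
  then have "Ck_on (Suc n) f S" by blast
  then show "Ck_on n (\<lambda>x. frechet_derivative f (at x) v) S" by simp
qed

lemma smooth_on_has_derivative:
  "smooth_on S f \<Longrightarrow> x \<in> S \<Longrightarrow> (f has_derivative frechet_derivative f (at x)) (at x)"
  unfolding smooth_on_def using Ck_on_Suc_has_derivative by blast

lemma smooth_on_imp_continuous_on: "smooth_on S f \<Longrightarrow> continuous_on S f"
  unfolding smooth_on_def using Ck_on.simps(1) by blast

lemma smooth_on_bounded_linear_self: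
  assumes "open S" "bounded_linear L"
  shows "smooth_on S L"
  unfolding smooth_on_def
proof
  fix n
  have "frechet_derivative L (at x) = L" for x
    using frechet_derivative_at[OF bounded_linear_imp_has_derivative[OF assms(2)]] by simp
  then show "Ck_on n L S"
    using assms(2) bounded_linear_imp_differentiable
    by (cases n) (auto intro: bounded_linear.continuous_on continuous_on_id Ck_on_const)
qed

section \<open>Symmetry of second derivatives\<close>

lemma mixed_second_difference:
  fixes \<phi> :: "'a::real_normed_vector \<Rightarrow> real"
  assumes d1: "\<And>y. y \<in> S \<Longrightarrow> (\<phi> has_derivative d y) (at y)"
    and d2: "\<And>y. y \<in> S \<Longrightarrow> ((\<lambda>y. d y u) has_derivative e y) (at y)"
    and sub: "\<And>r r'. 0 \<le> r \<Longrightarrow> r \<le> s \<Longrightarrow> 0 \<le> r' \<Longrightarrow> r' \<le> s \<Longrightarrow> x + r *\<^sub>R u + r' *\<^sub>R v \<in> S"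
    and s: "0 < s"
  shows "\<exists>r\<in>{0..s}. \<exists>r'\<in>{0..s}. \<phi> (x + s *\<^sub>R u + s *\<^sub>R v) - \<phi> (x + s *\<^sub>R u) - \<phi> (x + s *\<^sub>R v) + \<phi> x
           = s * s * e (x + r *\<^sub>R u + r' *\<^sub>R v) v"
proof -
  let ?\<psi> = "\<lambda>r. \<phi> (x + r *\<^sub>R u + s *\<^sub>R v) - \<phi> (x + r *\<^sub>R u)"
  have lin: "linear (d y)" if "y \<in> S" for y
    using d1[OF that] has_derivative_linear by blast
  have line: "((\<lambda>r. \<phi> (x + r *\<^sub>R u + c *\<^sub>R v)) has_derivative (\<lambda>h. d (x + r *\<^sub>R u + c *\<^sub>R v) (h *\<^sub>R u))) (at r within A)"
    if "0 \<le> r" "r \<le> s" "0 \<le> c" "c \<le> s" for r c A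
  proof -
    have "((\<lambda>r. x + r *\<^sub>R u + c *\<^sub>R v) has_derivative (\<lambda>h. h *\<^sub>R u)) (at r within A)"
      by (auto intro!: derivative_eq_intros)
    from has_derivative_compose[OF this d1[OF sub[OF that]]] show ?thesis .
  qed
  \<comment> \<open>The mean value theorem is applied twice: along \<open>u\<close> to the
    difference of \<open>\<phi>\<close> on two opposite sides, then along \<open>v\<close> to the
    derivative in direction \<open>u\<close>.\<close>
  have "\<exists>r\<in>{0<..<s}. ?\<psi> s - ?\<psi> 0 = d (x + r *\<^sub>R u + s *\<^sub>R v) ((s - 0) *\<^sub>R u) - d (x + r *\<^sub>R u) ((s - 0) *\<^sub>R u)"
  proof (rule mvt_simple[OF s])
    fix r assume "0 \<le> r" "r \<le> s"
    then have r: "r \<in> {0..s}" by simp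
    show "(?\<psi> has_derivative (\<lambda>h. d (x + r *\<^sub>R u + s *\<^sub>R v) (h *\<^sub>R u) - d (x + r *\<^sub>R u) (h *\<^sub>R u))) (at r within {0..s})"
      using line[of r s "{0..s}"] line[of r 0 "{0..s}"] r s by (intro has_derivative_diff) auto
  qed
  then obtain r where r: "r \<in> {0<..<s}"
    and 1: "?\<psi> s - ?\<psi> 0 = d (x + r *\<^sub>R u + s *\<^sub>R v) (s *\<^sub>R u) - d (x + r *\<^sub>R u) (s *\<^sub>R u)"
    by auto
  have in_S: "x + r *\<^sub>R u + r' *\<^sub>R v \<in> S" if "0 \<le> r'" "r' \<le> s" for r'
    using r that by (intro sub) auto
  have "\<exists>r'\<in>{0<..<s}. d (x + r *\<^sub>R u + s *\<^sub>R v) u - d (x + r *\<^sub>R u + 0 *\<^sub>R v) u = e (x + r *\<^sub>R u + r' *\<^sub>R v) ((s - 0) *\<^sub>R v)"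
  proof (rule mvt_simple[OF s])
    fix r' assume "0 \<le> r'" "r' \<le> s"
    then have r': "r' \<in> {0..s}" by simp
    have "((\<lambda>r'. x + r *\<^sub>R u + r' *\<^sub>R v) has_derivative (\<lambda>h. h *\<^sub>R v)) (at r' within {0..s})"
      by (auto intro!: derivative_eq_intros)
    from has_derivative_compose[OF this d2[OF in_S]] r'
    show "((\<lambda>r'. d (x + r *\<^sub>R u + r' *\<^sub>R v) u) has_derivative (\<lambda>h. e (x + r *\<^sub>R u + r' *\<^sub>R v) (h *\<^sub>R v))) (at r' within {0..s})"
      by auto
  qed
  then obtain r' where r': "r' \<in> {0<..<s}"
    and 2: "d (x + r *\<^sub>R u + s *\<^sub>R v) u - d (x + r *\<^sub>R u) u = e (x + r *\<^sub>R u + r' *\<^sub>R v) (s *\<^sub>R v)"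
    by auto
  have "linear (e (x + r *\<^sub>R u + r' *\<^sub>R v))"
    using d2[OF in_S[of r']] r' has_derivative_linear by auto
  then have "e (x + r *\<^sub>R u + r' *\<^sub>R v) (s *\<^sub>R v) = s * e (x + r *\<^sub>R u + r' *\<^sub>R v) v"
    by (simp add: linear_cmul)
  moreover have "d (x + r *\<^sub>R u + s *\<^sub>R v) (s *\<^sub>R u) - d (x + r *\<^sub>R u) (s *\<^sub>R u)
      = s * (d (x + r *\<^sub>R u + s *\<^sub>R v) u - d (x + r *\<^sub>R u) u)"
    using lin[OF in_S[of s]] lin[OF in_S[of 0]] s by (simp add: linear_cmul right_diff_distrib)
  ultimately have "?\<psi> s - ?\<psi> 0 = s * s * e (x + r *\<^sub>R u + r' *\<^sub>R v) v"
    using 1 2 by simp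
  then show ?thesis
    using r r' by (intro bexI[of _ r] bexI[of _ r']) auto
qed

text \<open>Exchanging \<open>u\<close> and \<open>v\<close> leaves the second difference over a
  parallelogram unchanged, so the two mixed derivatives agree at some pair of nearby points, and
  continuity carries this to \<open>x\<close>. Testing against a vector \<open>c\<close> reduces to
  real values, where the mean value theorem is an equality.\<close>

lemma smooth_on_second_derivative_symmetric:
  fixes f :: "'a::real_normed_vector \<Rightarrow> 'b::real_inner"
  assumes "open S" "smooth_on S f" "x \<in> S"
  shows "frechet_derivative (\<lambda>y. frechet_derivative f (at y) u) (at x) v
       = frechet_derivative (\<lambda>y. frechet_derivative f (at y) v) (at x) u"
proof -
  let ?D = "\<lambda>u v y. frechet_derivative (\<lambda>y. frechet_derivative f (at y) u) (at y) v"
  have cont: "isCont (?D u v) x" for u v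
    using assms smooth_on_imp_continuous_on smooth_on_frechet_derivative continuous_on_eq_continuous_at
    by metis
  have key: "?D u v x \<bullet> c = ?D v u x \<bullet> c" for c
  proof (rule ccontr)
    define \<epsilon> where "\<epsilon> = \<bar>?D u v x \<bullet> c - ?D v u x \<bullet> c\<bar> / 2"
    assume "?D u v x \<bullet> c \<noteq> ?D v u x \<bullet> c"
    then have \<epsilon>: "\<epsilon> > 0" unfolding \<epsilon>_def by simp
    have "isCont (\<lambda>y. ?D u v y \<bullet> c) x" "isCont (\<lambda>y. ?D v u y \<bullet> c) x"
      using cont by (auto intro!: continuous_intros)
    then obtain \<delta>1 \<delta>2 where \<delta>: "\<delta>1 > 0" "\<delta>2 > 0"
      and c1: "\<And>y. dist y x < \<delta>1 \<Longrightarrow> dist (?D u v y \<bullet> c) (?D u v x \<bullet> c) < \<epsilon>"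
      and c2: "\<And>y. dist y x < \<delta>2 \<Longrightarrow> dist (?D v u y \<bullet> c) (?D v u x \<bullet> c) < \<epsilon>"
      using \<epsilon> unfolding continuous_at_eps_delta by metis
    obtain \<delta>3 where \<delta>3: "\<delta>3 > 0" "ball x \<delta>3 \<subseteq> S"
      using assms openE by blast
    define \<delta> where "\<delta> = min \<delta>1 (min \<delta>2 \<delta>3)"
    \<comment> \<open>The side length keeps the whole parallelogram within \<open>\<delta>\<close>
      of \<open>x\<close>; the summand 1 covers the case that both directions vanish.\<close>
    define s where "s = \<delta> / 2 / (norm u + norm v + 1)"
    have N: "norm u + norm v + 1 > 0" by (smt (verit) norm_ge_zero)
    have "\<delta> > 0" using \<delta> \<delta>3 by (simp add: \<delta>_def)
    then have s: "s > 0" using N by (simp add: s_def)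
    have near: "dist (x + r *\<^sub>R u + r' *\<^sub>R v) x < \<delta>" if "0 \<le> r" "r \<le> s" "0 \<le> r'" "r' \<le> s" for r r'
    proof -
      have "dist (x + r *\<^sub>R u + r' *\<^sub>R v) x \<le> r * norm u + r' * norm v"
        using that norm_triangle_ineq[of "r *\<^sub>R u" "r' *\<^sub>R v"] by (simp add: dist_norm add.assoc)
      also have "\<dots> \<le> s * norm u + s * norm v"
        using that by (intro add_mono mult_right_mono) auto
      also have "\<dots> \<le> s * (norm u + norm v + 1)"
        using s by (simp add: algebra_simps)
      also have "\<dots> = \<delta> / 2" using N unfolding s_def by (intro nonzero_eq_divide_eq[THEN iffD1]) auto
      also have "\<dots> < \<delta>" using \<open>\<delta> > 0\<close> by simp
      finally show ?thesis .
    qed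
    then have sub: "x + r *\<^sub>R u + r' *\<^sub>R v \<in> S" if "0 \<le> r" "r \<le> s" "0 \<le> r'" "r' \<le> s" for r r'
      using that \<delta>3(2) unfolding \<delta>_def by (fastforce simp: dist_commute)
    have d1: "((\<lambda>y. f y \<bullet> c) has_derivative (\<lambda>h. frechet_derivative f (at y) h \<bullet> c)) (at y)" if "y \<in> S" for y
      using smooth_on_has_derivative[OF assms(2) that] by (rule has_derivative_inner_left)
    have d2: "((\<lambda>y. frechet_derivative f (at y) u \<bullet> c) has_derivative (\<lambda>v. ?D u v y \<bullet> c)) (at y)"
      if "y \<in> S" for y u
      using smooth_on_has_derivative[OF smooth_on_frechet_derivative[OF assms(2)] that]
      by (rule has_derivative_inner_left)
    from mixed_second_difference[where S = S, OF d1 d2 sub s]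
    obtain r1 r1' where r1: "r1 \<in> {0..s}" "r1' \<in> {0..s}"
      "f (x + s *\<^sub>R u + s *\<^sub>R v) \<bullet> c - f (x + s *\<^sub>R u) \<bullet> c - f (x + s *\<^sub>R v) \<bullet> c + f x \<bullet> c
       = s * s * (?D u v (x + r1 *\<^sub>R u + r1' *\<^sub>R v) \<bullet> c)"
      by auto
    have sub': "x + r *\<^sub>R v + r' *\<^sub>R u \<in> S" if "0 \<le> r" "r \<le> s" "0 \<le> r'" "r' \<le> s" for r r'
      using sub[of r' r] that by (simp add: algebra_simps)
    from mixed_second_difference[where S = S, OF d1 d2 sub' s]
    obtain r2 r2' where r2: "r2 \<in> {0..s}" "r2' \<in> {0..s}"
      "f (x + s *\<^sub>R v + s *\<^sub>R u) \<bullet> c - f (x + s *\<^sub>R v) \<bullet> c - f (x + s *\<^sub>R u) \<bullet> c + f x \<bullet> c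
       = s * s * (?D v u (x + r2 *\<^sub>R v + r2' *\<^sub>R u) \<bullet> c)"
      by auto
    have swap: "x + s *\<^sub>R v + s *\<^sub>R u = x + s *\<^sub>R u + s *\<^sub>R v"
      "x + r2 *\<^sub>R v + r2' *\<^sub>R u = x + r2' *\<^sub>R u + r2 *\<^sub>R v"
      by (simp_all add: algebra_simps)
    have eq: "?D u v (x + r1 *\<^sub>R u + r1' *\<^sub>R v) \<bullet> c = ?D v u (x + r2' *\<^sub>R u + r2 *\<^sub>R v) \<bullet> c"
    proof -
      have "s * s * a = s * s * b" if "A - B - C + E = s * s * a" "A - C - B + E = s * s * b"
        for A B C E a b :: real
        using that by linarith
      from this[OF r1(3) r2(3)[unfolded swap]] s show ?thesis by simp
    qed
    have "dist (x + r1 *\<^sub>R u + r1' *\<^sub>R v) x < \<delta>1" "dist (x + r2' *\<^sub>R u + r2 *\<^sub>R v) x < \<delta>2"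
      using near[of r1 r1'] near[of r2' r2] r1 r2 unfolding \<delta>_def by auto
    moreover have False if "\<bar>a - A\<bar> < \<bar>A - B\<bar> / 2" "\<bar>b - B\<bar> < \<bar>A - B\<bar> / 2" "a = b" for a b A B :: real
      using that by (smt (verit) field_sum_of_halves)
    ultimately show False
      using c1 c2 eq unfolding \<epsilon>_def dist_real_def by blast
  qed
  then show ?thesis
    by (metis vector_eq_rdot)
qed

section \<open>Quaternion algebra\<close>

lemma fst_qmul [simp]: "fst (a *\<^sub>H b) = fst a * fst b - snd a \<bullet> snd b"
  by (cases a; cases b) simp

lemma snd_qmul [simp]: "snd (a *\<^sub>H b) = fst a *\<^sub>R snd b + fst b *\<^sub>R snd a + cross3 (snd a) (snd b)"
  by (cases a; cases b) simp

lemma fst_qcnj [simp]: "fst (qcnj a) = fst a"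
  by (cases a) simp

lemma snd_qcnj [simp]: "snd (qcnj a) = - snd a"
  by (cases a) simp

lemma one_H_sel [simp]: "fst one_H = 1" "snd one_H = 0"
  by (simp_all add: one_H_def)

lemma quat_eq_iff:
  "(a :: quat) = b \<longleftrightarrow> fst a = fst b \<and> snd a $ 1 = snd b $ 1 \<and> snd a $ 2 = snd b $ 2 \<and> snd a $ 3 = snd b $ 3"
  by (auto simp: prod_eq_iff vec_eq_iff forall_3)

lemma quat_inner:
  "(a :: quat) \<bullet> b = fst a * fst b + snd a $ 1 * snd b $ 1 + snd a $ 2 * snd b $ 2 + snd a $ 3 * snd b $ 3"
  by (simp add: inner_prod_def inner_vec_def sum_3)

lemmas quat_coords = quat_eq_iff quat_inner inner_vec_def sum_3 cross_components

interpretation qmul: bounded_bilinear "(*\<^sub>H)"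
proof (rule bilinear_conv_bounded_bilinear[THEN iffD1])
  show "bilinear (*\<^sub>H)"
    by (auto intro!: linearI simp: bilinear_def quat_coords algebra_simps)
qed

lemma bounded_linear_qcnj: "bounded_linear qcnj"
  by (intro linear_conv_bounded_linear[THEN iffD1] linearI) (simp_all add: quat_coords)

lemma qmul_assoc: "a *\<^sub>H b *\<^sub>H c = a *\<^sub>H (b *\<^sub>H c)"
  by (simp add: quat_coords algebra_simps)

lemma qmul_one [simp]: "one_H *\<^sub>H a = a" "a *\<^sub>H one_H = a"
  by (simp_all add: quat_coords)

lemma qcnj_qmul: "qcnj (a *\<^sub>H b) = qcnj b *\<^sub>H qcnj a"
  by (simp add: quat_coords algebra_simps)

lemma qcnj_qcnj [simp]: "qcnj (qcnj a) = a"
  by (simp add: quat_coords)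

lemma qcnj_one [simp]: "qcnj one_H = one_H"
  by (simp add: quat_coords)

lemma qcnj_mult_self: "qcnj a *\<^sub>H a = (a \<bullet> a) *\<^sub>R one_H" "a *\<^sub>H qcnj a = (a \<bullet> a) *\<^sub>R one_H"
  by (simp_all add: quat_coords algebra_simps)

lemma fst_qcnj_qmul: "fst (qcnj a *\<^sub>H b) = a \<bullet> b"
  by (simp add: inner_prod_def)

lemma fst_qmul_qcnj: "fst (a *\<^sub>H qcnj b) = a \<bullet> b"
  by (simp add: inner_prod_def)

lemma inner_qmul_left: "(a *\<^sub>H b) \<bullet> (a *\<^sub>H c) = (a \<bullet> a) * (b \<bullet> c)"
  by (simp add: quat_coords algebra_simps)

lemma inner_qmul_cnj_left: "(a *\<^sub>H b) \<bullet> c = b \<bullet> (qcnj a *\<^sub>H c)"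
  by (simp add: quat_coords algebra_simps)

lemma norm_qmul: "norm (a *\<^sub>H b) = norm a * norm b"
  by (simp add: norm_eq_sqrt_inner inner_qmul_left real_sqrt_mult)

lemma norm_qcnj [simp]: "norm (qcnj a) = norm a"
  by (simp add: norm_eq_sqrt_inner quat_inner)

lemma unit_orthogonal_to_pair:
  fixes a b :: quat
  obtains X where "X \<bullet> a = 0" "X \<bullet> b = 0" "norm X = 1"
proof -
  have "dim {a, b} \<le> card {a, b}"
    by (intro dim_le_card') simp
  also have "\<dots> \<le> 2" by (simp add: card_insert_if)
  finally have "dim {a, b} < DIM(quat)" by simp
  then obtain Z where Z: "Z \<noteq> 0" "\<And>y. y \<in> span {a, b} \<Longrightarrow> orthogonal Z y"
    using orthogonal_to_subspace_exists by blast
  then show ?thesis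
    by (intro that[of "Z /\<^sub>R norm Z"]) (auto simp: orthogonal_def span_base)
qed

section \<open>First order consequences of the normal form\<close>

text \<open>The pointwise problem at \<open>w = 1\<close> and \<open>\<nu> = i\<close>, with
  \<open>W\<close> and \<open>V\<close> in the role of the derivatives of \<open>w\<close> and
  \<open>\<nu>\<close>. The conditions \<open>W0\<close>, \<open>V1\<close> and \<open>WV\<close>
  are the differentiated norm and orthogonality relations, \<open>sym\<close> is the symmetry of the
  second derivative of \<open>g\<close>. Over a basis this is a linear system, and every solution is
  expressed by \<open>p\<close> and a vector \<open>K\<close> orthogonal to 1 and
  \<open>e\<close>.\<close>

lemma rank_one_perturbation_first_order_normalised:
  fixes W V :: "quat \<Rightarrow> quat" and l \<kappa> :: real and e :: quat
  assumes lin: "linear W" "linear V" and e: "e = (0, axis 1 1)"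
    and W0: "\<And>u. W u \<bullet> one_H = 0" and V1: "\<And>u. V u \<bullet> e = 0"
    and WV: "\<And>u. W u \<bullet> e + one_H \<bullet> V u = 0"
    and sym: "\<And>u v. l *\<^sub>R snd (qcnj (W u) *\<^sub>H v)
        + \<kappa> *\<^sub>R ((V u \<bullet> v) *\<^sub>R axis 1 1 + (e \<bullet> v) *\<^sub>R snd (qcnj (W u) *\<^sub>H e + V u))
      = l *\<^sub>R snd (qcnj (W v) *\<^sub>H u)
        + \<kappa> *\<^sub>R ((V v \<bullet> u) *\<^sub>R axis 1 1 + (e \<bullet> u) *\<^sub>R snd (qcnj (W v) *\<^sub>H e + V v))"
    and nz: "l \<noteq> 0" "\<kappa> \<noteq> 0"
    and s: "s = l / \<kappa>" and p: "p = W one_H \<bullet> e" and K: "K = W one_H - p *\<^sub>R e"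
  shows "W X = (one_H \<bullet> X) *\<^sub>R K + (e \<bullet> X) *\<^sub>R (p *\<^sub>R one_H - ((2 * s + 1) / s) *\<^sub>R (e *\<^sub>H K)) + p *\<^sub>R (e *\<^sub>H X)"
    and "V X = (one_H \<bullet> X) *\<^sub>R (s *\<^sub>R (e *\<^sub>H K) - p *\<^sub>R one_H) + (e \<bullet> X) *\<^sub>R ((2 * s + 1) *\<^sub>R K)
          + ((1 + s) * p) *\<^sub>R (X - (one_H \<bullet> X) *\<^sub>R one_H - (e \<bullet> X) *\<^sub>R e)"
proof -
  define E2 E3 :: quat where "E2 = (0, axis 2 1)" and "E3 = (0, axis 3 1)"
  have E: "fst e = 0" "snd e $ 1 = 1" "snd e $ 2 = 0" "snd e $ 3 = 0"
    "fst E2 = 0" "snd E2 $ 1 = 0" "snd E2 $ 2 = 1" "snd E2 $ 3 = 0"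
    "fst E3 = 0" "snd E3 $ 1 = 0" "snd E3 $ 2 = 0" "snd E3 $ 3 = 1"
    by (simp_all add: e E2_def E3_def axis_def)
  have fW: "fst (W u) = 0" for u
    using W0[of u] by (simp add: quat_inner)
  have sV: "snd (V u) $ 1 = 0" for u
    using V1[of u] by (simp add: quat_inner E)
  have fV: "fst (V u) = - snd (W u) $ 1" for u
    using WV[of u] by (simp add: quat_inner E)
  note S = fW sV fV E quat_coords axis_def vec_eq_iff[where 'a = real and 'b = 3] forall_3
  have X: "X = fst X *\<^sub>R one_H + snd X $ 1 *\<^sub>R e + snd X $ 2 *\<^sub>R E2 + snd X $ 3 *\<^sub>R E3"
    by (simp add: S)
  have LX: "L X = fst X *\<^sub>R L one_H + snd X $ 1 *\<^sub>R L e + snd X $ 2 *\<^sub>R L E2 + snd X $ 3 *\<^sub>R L E3"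
    if "linear L" for L :: "quat \<Rightarrow> quat"
    by (subst X) (simp add: linear_add[OF that] linear_cmul[OF that])
  \<comment> \<open>The two digits name the pair of basis vectors inserted into \<open>sym\<close>:
    0 stands for \<open>one_H\<close>, 1 for \<open>e\<close>, 2 and 3 for \<open>E2\<close> and
    \<open>E3\<close>.\<close>
  have q02: "snd (W E2) $ 2 = 0" "snd (W E2) $ 3 = snd (W one_H) $ 1"
    "l * snd (W one_H) $ 3 + \<kappa> * snd (V one_H) $ 2 = - (l + \<kappa>) * snd (W E2) $ 1"
    using sym[of one_H E2] nz by (simp_all add: S algebra_simps)
  have q03: "snd (W E3) $ 3 = 0" "snd (W E3) $ 2 = - snd (W one_H) $ 1"
    "- l * snd (W one_H) $ 2 + \<kappa> * snd (V one_H) $ 3 = - (l + \<kappa>) * snd (W E3) $ 1"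
  proof -
    have "l * snd (W E3) $ 2 = l * (- snd (W one_H) $ 1)"
      using sym[of one_H E3] by (simp add: S algebra_simps)
    then show "snd (W E3) $ 2 = - snd (W one_H) $ 1"
      using nz by (metis mult_cancel_left)
  qed (use sym[of one_H E3] nz in \<open>simp_all add: S algebra_simps\<close>)
  have q23: "snd (W E2) $ 1 = 0" "snd (W E3) $ 1 = 0" "snd (V E2) $ 3 = snd (V E3) $ 2"
    using sym[of E2 E3] nz q02 q03 by (simp_all add: S algebra_simps)
  have q12: "\<kappa> * snd (V E2) $ 2 = (l + \<kappa>) * snd (W one_H) $ 1"
    "\<kappa> * snd (V E2) $ 3 = - l * snd (W e) $ 1" "l * snd (W e) $ 3 + \<kappa> * snd (V e) $ 2 = 0"
    using sym[of e E2] q02 by (simp_all add: S algebra_simps)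
  have q13: "\<kappa> * snd (V E3) $ 3 = (l + \<kappa>) * snd (W one_H) $ 1"
    "\<kappa> * snd (V E3) $ 2 = l * snd (W e) $ 1" "- l * snd (W e) $ 2 + \<kappa> * snd (V e) $ 3 = 0"
    using sym[of e E3] q03 by (simp_all add: S algebra_simps)
  have q01: "l * snd (W e) $ 2 = (l + \<kappa>) * snd (W one_H) $ 3 - \<kappa> * snd (V one_H) $ 2"
    "- l * snd (W e) $ 3 = (l + \<kappa>) * snd (W one_H) $ 2 + \<kappa> * snd (V one_H) $ 3"
    using sym[of one_H e] by (simp_all add: S algebra_simps)
  \<comment> \<open>The pairs (\<open>e\<close>, \<open>E2\<close>) and (\<open>e\<close>,
    \<open>E3\<close>) give opposite values to the two off-diagonal entries of \<open>V\<close>,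
    whereas the pair (\<open>E2\<close>, \<open>E3\<close>) makes them equal.\<close>
  have We1: "snd (W e) $ 1 = 0"
    using q12(2) q13(2) q23(3) nz by simp
  have *: "snd (V E2) $ 2 = (1 + s) * snd (W one_H) $ 1" "snd (V E3) $ 3 = (1 + s) * snd (W one_H) $ 1"
    "snd (V E2) $ 3 = 0" "snd (V E3) $ 2 = 0"
    "snd (V one_H) $ 2 = - s * snd (W one_H) $ 3" "snd (V one_H) $ 3 = s * snd (W one_H) $ 2"
    using q12 q13 q02(3) q03(3) q23 We1 nz unfolding s by (simp_all add: field_simps)
  have c: "(2 * s + 1) / s = (2 * l + \<kappa>) / l" "2 * s + 1 = (2 * l + \<kappa>) / \<kappa>"
    using nz unfolding s by (simp_all add: divide_simps)
  have We: "l * snd (W e) $ 2 = (2 * l + \<kappa>) * snd (W one_H) $ 3"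
    "l * snd (W e) $ 3 = - (2 * l + \<kappa>) * snd (W one_H) $ 2"
    using q01 q02(3) q03(3) unfolding q23 by (simp_all add: algebra_simps)
  from We have **: "snd (W e) $ 2 = ((2 * s + 1) / s) * snd (W one_H) $ 3"
    "snd (W e) $ 3 = - ((2 * s + 1) / s) * snd (W one_H) $ 2"
    using nz unfolding c(1) by (simp_all add: field_simps)
  have "\<kappa> * snd (V e) $ 2 = (2 * l + \<kappa>) * snd (W one_H) $ 2"
    "\<kappa> * snd (V e) $ 3 = (2 * l + \<kappa>) * snd (W one_H) $ 3"
    using q12(3) q13(3) We by (simp_all add: algebra_simps)
  then have ***: "snd (V e) $ 2 = (2 * s + 1) * snd (W one_H) $ 2" "snd (V e) $ 3 = (2 * s + 1) * snd (W one_H) $ 3"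
    using nz unfolding c(2) by (simp_all add: field_simps)
  have pp: "p = snd (W one_H) $ 1"
    by (simp add: p S)
  define c where "c = (2 * s + 1) / s"
  show "W X = (one_H \<bullet> X) *\<^sub>R K + (e \<bullet> X) *\<^sub>R (p *\<^sub>R one_H - ((2 * s + 1) / s) *\<^sub>R (e *\<^sub>H K)) + p *\<^sub>R (e *\<^sub>H X)"
    unfolding LX[OF lin(1)] K pp
    using q02(1,2) q03(1,2) q23 We1 ** unfolding c_def[symmetric] by (simp add: S algebra_simps)
  show "V X = (one_H \<bullet> X) *\<^sub>R (s *\<^sub>R (e *\<^sub>H K) - p *\<^sub>R one_H) + (e \<bullet> X) *\<^sub>R ((2 * s + 1) *\<^sub>R K)
          + ((1 + s) * p) *\<^sub>R (X - (one_H \<bullet> X) *\<^sub>R one_H - (e \<bullet> X) *\<^sub>R e)"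
    unfolding LX[OF lin(2)] K pp
    using q02(1,2) q03(1,2) q23 We1 * *** by (simp add: S algebra_simps)
qed

text \<open>A rotation induces an automorphism \<open>\<phi>\<close> of the quaternions sending
  \<open>i\<close> to the imaginary unit \<open>qcnj w *\<^sub>H \<nu>\<close>; left multiplication
  by \<open>w\<close> follows. The factor \<open>w\<close> cancels in
  \<open>qcnj (\<Phi> a) *\<^sub>H \<Phi> b\<close>, so its imaginary part changes only by the
  rotation \<open>A\<close>, and every orthonormal pair can be moved to (1,
  \<open>i\<close>).\<close>

lemma adapted_isometry:
  fixes w \<nu> :: quat
  assumes w: "norm w = 1" and \<nu>: "norm \<nu> = 1" and w\<nu>: "w \<bullet> \<nu> = 0"
  obtains \<Phi> \<Psi> :: "quat \<Rightarrow> quat" and A :: "real^3^3"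
  where "linear \<Phi>" "linear \<Psi>" "\<And>y. \<Psi> (\<Phi> y) = y" "\<And>y. \<Phi> (\<Psi> y) = y"
    "\<And>a b. \<Phi> a \<bullet> \<Phi> b = a \<bullet> b" "\<Phi> one_H = w" "\<Phi> (0, axis 1 1) = \<nu>"
    "\<And>a b. snd (qcnj (\<Phi> a) *\<^sub>H \<Phi> b) = A *v snd (qcnj a *\<^sub>H b)" "inj ((*v) A)"
    "\<And>a b. \<Phi> (a *\<^sub>H b) = \<Phi> a *\<^sub>H (qcnj w *\<^sub>H \<Phi> b)"
proof -
  have ww: "w \<bullet> w = 1" using w by (simp add: norm_eq_1)
  define n where "n = snd (qcnj w *\<^sub>H \<nu>)"
  have n: "qcnj w *\<^sub>H \<nu> = (0, n)"
    using w\<nu> unfolding n_def by (simp add: prod_eq_iff inner_prod_def)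
  have "norm (qcnj w *\<^sub>H \<nu>) = 1"
    by (simp only: norm_qmul norm_qcnj w \<nu>)
  then have "norm n = 1"
    unfolding n by (simp add: norm_Pair)
  then obtain A where A: "rotation_matrix A" "A *v axis 1 1 = n"
    using rotation_matrix_exists_basis[of n 1] by auto
  have orth: "orthogonal_matrix A"
    using A(1) by (simp add: rotation_matrix_def)
  define \<phi> \<psi> :: "quat \<Rightarrow> quat" where "\<phi> q = (fst q, A *v snd q)"
    and "\<psi> q = (fst q, transpose A *v snd q)" for q
  have inv: "\<phi> (\<psi> q) = q" "\<psi> (\<phi> q) = q" for q
    using orth unfolding \<phi>_def \<psi>_def
    by (simp_all add: matrix_vector_mul_assoc del: transpose_matrix_vector)
      (simp_all add: orthogonal_matrix_def prod_eq_iff)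
  have inner: "(A *v x) \<bullet> (A *v y) = x \<bullet> y" for x y
  proof -
    have "orthogonal_transformation ((*v) A)"
      using orth by (simp add: orthogonal_transformation_matrix)
    then show ?thesis by (simp add: orthogonal_transformation_def)
  qed
  have mult: "\<phi> (a *\<^sub>H b) = \<phi> a *\<^sub>H \<phi> b" for a b
    unfolding \<phi>_def prod_eq_iff fst_qmul snd_qmul
    by (simp add: inner cross_rotation_matrix[OF A(1)] matrix_vector_right_distrib matrix_vector_mult_scaleR)
  have cnj: "qcnj (\<phi> a) = \<phi> (qcnj a)" for a
    unfolding \<phi>_def by (simp add: prod_eq_iff linear_neg matrix_vector_mul_linear)
  have lin: "linear \<phi>" "linear \<psi>"
    unfolding \<phi>_def \<psi>_def
    by (auto intro!: linearI simp: matrix_vector_right_distrib matrix_vector_mult_scaleR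
        simp del: transpose_matrix_vector)
  have wc: "qcnj w *\<^sub>H (w *\<^sub>H q) = q" "w *\<^sub>H (qcnj w *\<^sub>H q) = q" for q
    by (simp_all only: qmul_assoc[symmetric] qcnj_mult_self ww) simp_all
  show ?thesis
  proof (rule that[of "\<lambda>y. w *\<^sub>H \<phi> y" "\<lambda>z. \<psi> (qcnj w *\<^sub>H z)" A])
    show "linear (\<lambda>y. w *\<^sub>H \<phi> y)" "linear (\<lambda>z. \<psi> (qcnj w *\<^sub>H z))"
      using linear_compose[OF lin(1) bounded_linear.linear[OF qmul.bounded_linear_right[of w]]]
        linear_compose[OF bounded_linear.linear[OF qmul.bounded_linear_right[of "qcnj w"]] lin(2)]
      unfolding o_def by blast+
    show "(w *\<^sub>H \<phi> a) \<bullet> (w *\<^sub>H \<phi> b) = a \<bullet> b" for a b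
      by (simp only: inner_qmul_left ww) (simp add: \<phi>_def inner inner_prod_def)
    show "w *\<^sub>H \<phi> one_H = w" "w *\<^sub>H \<phi> (0, axis 1 1) = \<nu>"
    proof -
      have "\<phi> one_H = one_H"
        by (simp add: \<phi>_def prod_eq_iff)
      then show "w *\<^sub>H \<phi> one_H = w" by (simp only: qmul_one)
      have "\<phi> (0, axis 1 1) = qcnj w *\<^sub>H \<nu>"
        unfolding n by (simp only: \<phi>_def fst_conv snd_conv A(2))
      then show "w *\<^sub>H \<phi> (0, axis 1 1) = \<nu>" by (simp only: wc)
    qed
    show "snd (qcnj (w *\<^sub>H \<phi> a) *\<^sub>H (w *\<^sub>H \<phi> b)) = A *v snd (qcnj a *\<^sub>H b)" for a b
    proof -
      have "qcnj (w *\<^sub>H \<phi> a) *\<^sub>H (w *\<^sub>H \<phi> b) = \<phi> (qcnj a *\<^sub>H b)"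
        by (simp only: qcnj_qmul qmul_assoc wc cnj mult)
      then show ?thesis by (simp only: \<phi>_def snd_conv)
    qed
    show "inj ((*v) A)"
    proof (rule injI)
      fix x y assume "A *v x = A *v y"
      then have "transpose A *v (A *v x) = transpose A *v (A *v y)" by simp
      then show "x = y"
        using orth unfolding matrix_vector_mul_assoc orthogonal_matrix by simp
    qed
    show "w *\<^sub>H \<phi> (a *\<^sub>H b) = w *\<^sub>H \<phi> a *\<^sub>H (qcnj w *\<^sub>H (w *\<^sub>H \<phi> b))" for a b
      by (simp only: wc mult qmul_assoc)
  qed (simp_all only: wc inv)
qed

text \<open>Conjugation by the isometry reduces this to the normalised pair; multiplication by
  \<open>e\<close> turns into multiplication by \<open>\<nu>\<close> times the conjugate of
  \<open>w\<close>.\<close>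

lemma rank_one_perturbation_first_order:
  fixes W V :: "quat \<Rightarrow> quat" and l \<kappa> :: real and w \<nu> :: quat
  assumes lin: "linear W" "linear V"
    and w: "norm w = 1" and \<nu>: "norm \<nu> = 1" and w\<nu>: "w \<bullet> \<nu> = 0"
    and W0: "\<And>u. W u \<bullet> w = 0" and V1: "\<And>u. V u \<bullet> \<nu> = 0"
    and WV: "\<And>u. W u \<bullet> \<nu> + w \<bullet> V u = 0"
    and sym: "\<And>u v. l *\<^sub>R snd (qcnj (W u) *\<^sub>H v)
        + \<kappa> *\<^sub>R ((V u \<bullet> v) *\<^sub>R snd (qcnj w *\<^sub>H \<nu>) + (\<nu> \<bullet> v) *\<^sub>R snd (qcnj (W u) *\<^sub>H \<nu> + qcnj w *\<^sub>H V u))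
      = l *\<^sub>R snd (qcnj (W v) *\<^sub>H u)
        + \<kappa> *\<^sub>R ((V v \<bullet> u) *\<^sub>R snd (qcnj w *\<^sub>H \<nu>) + (\<nu> \<bullet> u) *\<^sub>R snd (qcnj (W v) *\<^sub>H \<nu> + qcnj w *\<^sub>H V v))"
    and nz: "l \<noteq> 0" "\<kappa> \<noteq> 0"
    and s: "s = l / \<kappa>" and p: "p = W w \<bullet> \<nu>" and K: "K = W w - p *\<^sub>R \<nu>"
  shows "W X = (w \<bullet> X) *\<^sub>R K + (\<nu> \<bullet> X) *\<^sub>R (p *\<^sub>R w - ((2 * s + 1) / s) *\<^sub>R (\<nu> *\<^sub>H (qcnj w *\<^sub>H K)))
          + p *\<^sub>R (\<nu> *\<^sub>H (qcnj w *\<^sub>H X))"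
    and "V X = (w \<bullet> X) *\<^sub>R (s *\<^sub>R (\<nu> *\<^sub>H (qcnj w *\<^sub>H K)) - p *\<^sub>R w) + (\<nu> \<bullet> X) *\<^sub>R ((2 * s + 1) *\<^sub>R K)
          + ((1 + s) * p) *\<^sub>R (X - (w \<bullet> X) *\<^sub>R w - (\<nu> \<bullet> X) *\<^sub>R \<nu>)"
proof -
  obtain \<Phi> \<Psi> :: "quat \<Rightarrow> quat" and A :: "real^3^3"
  where \<Phi>: "linear \<Phi>" "linear \<Psi>" "\<And>y. \<Psi> (\<Phi> y) = y" "\<And>y. \<Phi> (\<Psi> y) = y"
    and iso: "\<And>a b. \<Phi> a \<bullet> \<Phi> b = a \<bullet> b" and \<Phi>1: "\<Phi> one_H = w" and \<Phi>e: "\<Phi> (0, axis 1 1) = \<nu>"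
    and A: "\<And>a b. snd (qcnj (\<Phi> a) *\<^sub>H \<Phi> b) = A *v snd (qcnj a *\<^sub>H b)" "inj ((*v) A)"
    and mult: "\<And>a b. \<Phi> (a *\<^sub>H b) = \<Phi> a *\<^sub>H (qcnj w *\<^sub>H \<Phi> b)"
    using adapted_isometry[OF w \<nu> w\<nu>] by blast
  define e :: quat where "e = (0, axis 1 1)"
  define W' V' where "W' u = \<Psi> (W (\<Phi> u))" and "V' u = \<Psi> (V (\<Phi> u))" for u
  have W': "W (\<Phi> u) = \<Phi> (W' u)" and V': "V (\<Phi> u) = \<Phi> (V' u)" for u
    by (simp_all add: W'_def V'_def \<Phi>)
  note \<Phi>e = \<Phi>e[folded e_def]
  have lin': "linear W'" "linear V'"
    using linear_compose[OF linear_compose[OF \<Phi>(1) lin(1)] \<Phi>(2)] linear_compose[OF linear_compose[OF \<Phi>(1) lin(2)] \<Phi>(2)]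
    by (simp_all add: o_def W'_def[abs_def] V'_def[abs_def])
  have e1: "snd (qcnj one_H *\<^sub>H e) = axis 1 1" and c1: "qcnj one_H *\<^sub>H q = q" for q
    by (simp_all add: e_def)
  have s': "l *\<^sub>R snd (qcnj (W' u) *\<^sub>H v)
        + \<kappa> *\<^sub>R ((V' u \<bullet> v) *\<^sub>R axis 1 1 + (e \<bullet> v) *\<^sub>R snd (qcnj (W' u) *\<^sub>H e + V' u))
      = l *\<^sub>R snd (qcnj (W' v) *\<^sub>H u)
        + \<kappa> *\<^sub>R ((V' v \<bullet> u) *\<^sub>R axis 1 1 + (e \<bullet> u) *\<^sub>R snd (qcnj (W' v) *\<^sub>H e + V' v))" for u v
  proof -
    have "A *v (l *\<^sub>R snd (qcnj (W' u) *\<^sub>H v)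
        + \<kappa> *\<^sub>R ((V' u \<bullet> v) *\<^sub>R snd (qcnj one_H *\<^sub>H e) + (e \<bullet> v) *\<^sub>R (snd (qcnj (W' u) *\<^sub>H e) + snd (qcnj one_H *\<^sub>H V' u))))
      = A *v (l *\<^sub>R snd (qcnj (W' v) *\<^sub>H u)
        + \<kappa> *\<^sub>R ((V' v \<bullet> u) *\<^sub>R snd (qcnj one_H *\<^sub>H e) + (e \<bullet> u) *\<^sub>R (snd (qcnj (W' v) *\<^sub>H e) + snd (qcnj one_H *\<^sub>H V' v))))"
      using sym[of "\<Phi> u" "\<Phi> v"]
      unfolding matrix_vector_right_distrib matrix_vector_mult_scaleR A(1)[symmetric]
        W' V' iso \<Phi>1[symmetric] \<Phi>e[symmetric] snd_add .
    then have "l *\<^sub>R snd (qcnj (W' u) *\<^sub>H v)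
        + \<kappa> *\<^sub>R ((V' u \<bullet> v) *\<^sub>R snd (qcnj one_H *\<^sub>H e) + (e \<bullet> v) *\<^sub>R (snd (qcnj (W' u) *\<^sub>H e) + snd (qcnj one_H *\<^sub>H V' u)))
      = l *\<^sub>R snd (qcnj (W' v) *\<^sub>H u)
        + \<kappa> *\<^sub>R ((V' v \<bullet> u) *\<^sub>R snd (qcnj one_H *\<^sub>H e) + (e \<bullet> u) *\<^sub>R (snd (qcnj (W' v) *\<^sub>H e) + snd (qcnj one_H *\<^sub>H V' v)))"
      by (rule injD[OF A(2)])
    then show ?thesis
      unfolding e1 unfolding c1 snd_add .
  qed
  define K' where "K' = W' one_H - p *\<^sub>R e"
  have p': "p = W' one_H \<bullet> e"
    using p iso[of "W' one_H" e] by (simp only: \<Phi>1[symmetric] \<Phi>e[symmetric] W')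
  have K\<Phi>: "K = \<Phi> K'"
    unfolding K K'_def linear_diff[OF \<Phi>(1)] linear_cmul[OF \<Phi>(1)] W'[symmetric] \<Phi>1 \<Phi>e ..
  have W0': "W' u \<bullet> one_H = 0" and V1': "V' u \<bullet> e = 0" and WV': "W' u \<bullet> e + one_H \<bullet> V' u = 0" for u
    using W0[of "\<Phi> u"] V1[of "\<Phi> u"] WV[of "\<Phi> u"]
    by (simp_all only: W' V' \<Phi>1[symmetric] \<Phi>e[symmetric] iso)
  note main = rank_one_perturbation_first_order_normalised[OF lin' e_def W0' V1' WV' s' nz s p' K'_def, of "\<Psi> X"]
  show "W X = (w \<bullet> X) *\<^sub>R K + (\<nu> \<bullet> X) *\<^sub>R (p *\<^sub>R w - ((2 * s + 1) / s) *\<^sub>R (\<nu> *\<^sub>H (qcnj w *\<^sub>H K)))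
          + p *\<^sub>R (\<nu> *\<^sub>H (qcnj w *\<^sub>H X))"
    using arg_cong[OF main(1), of \<Phi>]
    unfolding linear_add[OF \<Phi>(1)] linear_diff[OF \<Phi>(1)] linear_cmul[OF \<Phi>(1)] mult W'[symmetric] \<Phi>(4) \<Phi>1 \<Phi>e K\<Phi>[symmetric]
    using iso[of one_H "\<Psi> X"] iso[of e "\<Psi> X"] by (simp only: \<Phi>(4) \<Phi>1 \<Phi>e)
  show "V X = (w \<bullet> X) *\<^sub>R (s *\<^sub>R (\<nu> *\<^sub>H (qcnj w *\<^sub>H K)) - p *\<^sub>R w) + (\<nu> \<bullet> X) *\<^sub>R ((2 * s + 1) *\<^sub>R K)
          + ((1 + s) * p) *\<^sub>R (X - (w \<bullet> X) *\<^sub>R w - (\<nu> \<bullet> X) *\<^sub>R \<nu>)"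
    using arg_cong[OF main(2), of \<Phi>]
    unfolding linear_add[OF \<Phi>(1)] linear_diff[OF \<Phi>(1)] linear_cmul[OF \<Phi>(1)] mult V'[symmetric] \<Phi>(4) \<Phi>1 \<Phi>e K\<Phi>[symmetric]
    using iso[of one_H "\<Psi> X"] iso[of e "\<Psi> X"] by (simp only: \<Phi>(4) \<Phi>1 \<Phi>e)
qed

section \<open>The moving frame and its structure equations\<close>

lemma frechet_derivative_eqI:
  "open S \<Longrightarrow> x \<in> S \<Longrightarrow> (\<And>y. y \<in> S \<Longrightarrow> f y = g y) \<Longrightarrow> (g has_derivative g') (at x)
    \<Longrightarrow> frechet_derivative f (at x) = g'"
  using frechet_derivative_cong_open[of S x f g] frechet_derivative_at[of g g' x] by simp

lemma has_derivative_eq_0_if_constant: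
  assumes "open S" "x \<in> S" "\<And>y. y \<in> S \<Longrightarrow> f y = c" "(f has_derivative f') (at x)"
  shows "f' v = 0"
proof -
  have "((\<lambda>_. c) has_derivative f') (at x)"
    by (rule has_derivative_transform_within_open[OF assms(4,1,2)]) (rule assms(3))
  from has_derivative_unique[OF this has_derivative_const] show ?thesis by simp
qed

text \<open>\<open>smooth_on\<close> controls derivatives only in fixed directions, so a variable
  direction is expanded in the standard basis.\<close>

lemma smooth_on_frechet_derivative_apply:
  fixes f :: "'a::euclidean_space \<Rightarrow> 'b::real_normed_vector"
  assumes "open S" "smooth_on S f" "smooth_on S h"
  shows "smooth_on S (\<lambda>x. frechet_derivative f (at x) (h x))"
proof -
  have "smooth_on S (\<lambda>x. \<Sum>b\<in>Basis. (h x \<bullet> b) *\<^sub>R frechet_derivative f (at x) b)"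
    using assms
    by (intro smooth_on_sum smooth_on_bounded_bilinear[OF _ bounded_bilinear_scaleR]
        smooth_on_bounded_linear[OF _ bounded_linear_inner_left] smooth_on_frechet_derivative)
  moreover have "(\<Sum>b\<in>Basis. (h x \<bullet> b) *\<^sub>R frechet_derivative f (at x) b) = frechet_derivative f (at x) (h x)"
    if "x \<in> S" for x
  proof -
    have "linear (frechet_derivative f (at x))"
      using smooth_on_has_derivative[OF assms(2) that] by (rule has_derivative_linear)
    then show ?thesis
      using linear_sum[of "frechet_derivative f (at x)" "\<lambda>b. (h x \<bullet> b) *\<^sub>R b" Basis]
      by (simp add: euclidean_representation linear_cmul)
  qed
  ultimately show ?thesis
    by (rule smooth_on_cong[OF assms(1), rotated])
qed

text \<open>Here \<open>\<kappa>\<close> is the simple eigenvalue minus the double one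
  \<open>l\<close>: the differential is a conformal part plus a rank-one part along
  \<open>\<nu>\<close>. The set \<open>B\<close> is kept apart from the domain because
  \<open>\<nu>\<close> is constructed only near a point. The last condition in \<open>nz\<close>
  makes \<open>2 * s + 1\<close> nonzero, a factor by which the compatibility conditions are
  divided.\<close>

locale rank_one_perturbation =
  fixes B :: "quat set" and g :: "quat \<Rightarrow> real^3" and w \<nu> :: "quat \<Rightarrow> quat" and l \<kappa> :: real
  assumes open_B: "open B"
    and smooth: "smooth_on B g" "smooth_on B w" "smooth_on B \<nu>"
    and unit: "\<And>x. x \<in> B \<Longrightarrow> norm (w x) = 1" "\<And>x. x \<in> B \<Longrightarrow> norm (\<nu> x) = 1"
    and orth: "\<And>x. x \<in> B \<Longrightarrow> w x \<bullet> \<nu> x = 0"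
    and dg: "\<And>x v. x \<in> B \<Longrightarrow> frechet_derivative g (at x) v
        = l *\<^sub>R snd (qcnj (w x) *\<^sub>H v) + \<kappa> *\<^sub>R ((\<nu> x \<bullet> v) *\<^sub>R snd (qcnj (w x) *\<^sub>H \<nu> x))"
    and nz: "l \<noteq> 0" "\<kappa> \<noteq> 0" "2 * l + \<kappa> \<noteq> 0"
begin

abbreviation W where "W x \<equiv> frechet_derivative w (at x)"
abbreviation V where "V x \<equiv> frechet_derivative \<nu> (at x)"

text \<open>
  The derivatives of \<open>w\<close> and \<open>\<nu>\<close> are determined by the component \<open>p\<close> of \<open>W w\<close> along \<open>\<nu>\<close> and the
  remainder \<open>K\<close>.  Left multiplication by \<open>m\<close> maps \<open>w\<close> to \<open>\<nu>\<close> and is a complex structure on the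
  plane orthogonal to both.
\<close>

definition s where "s = l / \<kappa>"
definition p where "p x = W x (w x) \<bullet> \<nu> x"
definition K where "K x = W x (w x) - p x *\<^sub>R \<nu> x"
definition m where "m x = \<nu> x *\<^sub>H qcnj (w x)"

lemma W: "x \<in> B \<Longrightarrow> (w has_derivative W x) (at x)"
  and V: "x \<in> B \<Longrightarrow> (\<nu> has_derivative V x) (at x)"
  by (rule smooth_on_has_derivative[OF smooth(2)] smooth_on_has_derivative[OF smooth(3)]; assumption)+

lemma inner_unit: "x \<in> B \<Longrightarrow> w x \<bullet> w x = 1" "x \<in> B \<Longrightarrow> \<nu> x \<bullet> \<nu> x = 1"
  "x \<in> B \<Longrightarrow> w x \<bullet> \<nu> x = 0" "x \<in> B \<Longrightarrow> \<nu> x \<bullet> w x = 0"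
  using unit orth by (auto simp: norm_eq_1 inner_commute)

lemma s_nz: "s \<noteq> 0" "2 * s + 1 \<noteq> 0"
proof -
  show "s \<noteq> 0" using nz by (simp add: s_def)
  have "2 * s + 1 = (2 * l + \<kappa>) / \<kappa>"
    using nz(2) unfolding s_def by (simp add: add_divide_distrib)
  then show "2 * s + 1 \<noteq> 0" using nz by simp
qed

lemma second_derivative_g:
  assumes x: "x \<in> B"
  shows "frechet_derivative (\<lambda>y. frechet_derivative g (at y) v) (at x) u
    = l *\<^sub>R snd (qcnj (W x u) *\<^sub>H v) + \<kappa> *\<^sub>R ((V x u \<bullet> v) *\<^sub>R snd (qcnj (w x) *\<^sub>H \<nu> x)
        + (\<nu> x \<bullet> v) *\<^sub>R snd (qcnj (W x u) *\<^sub>H \<nu> x + qcnj (w x) *\<^sub>H V x u))"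
proof -
  note wc = bounded_linear.has_derivative[OF bounded_linear_qcnj W[OF x]]
  have "((\<lambda>x. l *\<^sub>R snd (qcnj (w x) *\<^sub>H v) + \<kappa> *\<^sub>R ((\<nu> x \<bullet> v) *\<^sub>R snd (qcnj (w x) *\<^sub>H \<nu> x)))
    has_derivative (\<lambda>u. l *\<^sub>R snd (qcnj (w x) *\<^sub>H 0 + qcnj (W x u) *\<^sub>H v)
      + \<kappa> *\<^sub>R ((\<nu> x \<bullet> v) *\<^sub>R snd (qcnj (w x) *\<^sub>H V x u + qcnj (W x u) *\<^sub>H \<nu> x)
          + (V x u \<bullet> v) *\<^sub>R snd (qcnj (w x) *\<^sub>H \<nu> x)))) (at x)"
    by (intro has_derivative_add has_derivative_scaleR_right has_derivative_scaleR has_derivative_snd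
        qmul.FDERIV wc V[OF x] has_derivative_const has_derivative_inner_left)
  from frechet_derivative_eqI[OF open_B x dg this]
  show ?thesis by (simp add: qmul.zero_right add.commute del: snd_qmul)
qed

text \<open>Differentiating the two unit norms and the orthogonality gives the three linear
  constraints of the pointwise lemma; symmetry of the second derivative of \<open>g\<close> gives
  its last one.\<close>

lemma first_order:
  assumes x: "x \<in> B"
  shows "W x X = (w x \<bullet> X) *\<^sub>R K x + (\<nu> x \<bullet> X) *\<^sub>R (p x *\<^sub>R w x - ((2 * s + 1) / s) *\<^sub>R (m x *\<^sub>H K x))
          + p x *\<^sub>R (m x *\<^sub>H X)"
    and "V x X = (w x \<bullet> X) *\<^sub>R (s *\<^sub>R (m x *\<^sub>H K x) - p x *\<^sub>R w x) + (\<nu> x \<bullet> X) *\<^sub>R ((2 * s + 1) *\<^sub>R K x)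
          + ((1 + s) * p x) *\<^sub>R (X - (w x \<bullet> X) *\<^sub>R w x - (\<nu> x \<bullet> X) *\<^sub>R \<nu> x)"
proof -
  have W0: "W x u \<bullet> w x = 0" for u
    using has_derivative_eq_0_if_constant[OF open_B x inner_unit(1)
        has_derivative_inner[OF W[OF x] W[OF x]], of u] by (simp add: inner_commute)
  have V0: "V x u \<bullet> \<nu> x = 0" for u
    using has_derivative_eq_0_if_constant[OF open_B x inner_unit(2)
        has_derivative_inner[OF V[OF x] V[OF x]], of u] by (simp add: inner_commute)
  have WV: "W x u \<bullet> \<nu> x + w x \<bullet> V x u = 0" for u
    using has_derivative_eq_0_if_constant[OF open_B x inner_unit(3)
        has_derivative_inner[OF W[OF x] V[OF x]], of u] by simp
  note D = second_derivative_g[OF x]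
  have sym: "l *\<^sub>R snd (qcnj (W x u) *\<^sub>H v)
        + \<kappa> *\<^sub>R ((V x u \<bullet> v) *\<^sub>R snd (qcnj (w x) *\<^sub>H \<nu> x) + (\<nu> x \<bullet> v) *\<^sub>R snd (qcnj (W x u) *\<^sub>H \<nu> x + qcnj (w x) *\<^sub>H V x u))
      = l *\<^sub>R snd (qcnj (W x v) *\<^sub>H u)
        + \<kappa> *\<^sub>R ((V x v \<bullet> u) *\<^sub>R snd (qcnj (w x) *\<^sub>H \<nu> x) + (\<nu> x \<bullet> u) *\<^sub>R snd (qcnj (W x v) *\<^sub>H \<nu> x + qcnj (w x) *\<^sub>H V x v))"
    for u v
    using smooth_on_second_derivative_symmetric[OF open_B smooth(1) x] unfolding D[symmetric] .
  note rank_one_perturbation_first_order[OF has_derivative_linear[OF W[OF x]]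
      has_derivative_linear[OF V[OF x]] unit(1)[OF x] unit(2)[OF x] orth[OF x] W0 V0 WV sym nz(1,2) s_def
      p_def K_def]
  then show "W x X = (w x \<bullet> X) *\<^sub>R K x + (\<nu> x \<bullet> X) *\<^sub>R (p x *\<^sub>R w x - ((2 * s + 1) / s) *\<^sub>R (m x *\<^sub>H K x))
          + p x *\<^sub>R (m x *\<^sub>H X)"
    and "V x X = (w x \<bullet> X) *\<^sub>R (s *\<^sub>R (m x *\<^sub>H K x) - p x *\<^sub>R w x) + (\<nu> x \<bullet> X) *\<^sub>R ((2 * s + 1) *\<^sub>R K x)
          + ((1 + s) * p x) *\<^sub>R (X - (w x \<bullet> X) *\<^sub>R w x - (\<nu> x \<bullet> X) *\<^sub>R \<nu> x)"
    by (simp_all only: m_def qmul_assoc)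
qed

lemma smooth_p: "smooth_on B p" and smooth_K: "smooth_on B K"
proof -
  have Ww: "smooth_on B (\<lambda>x. W x (w x))"
    using open_B smooth by (intro smooth_on_frechet_derivative_apply)
  show p: "smooth_on B p"
    unfolding p_def[abs_def]
    using open_B smooth Ww by (intro smooth_on_bounded_bilinear[OF _ bounded_bilinear_inner])
  have "smooth_on B (\<lambda>x. W x (w x) + (-1) *\<^sub>R (p x *\<^sub>R \<nu> x))"
    using open_B smooth Ww p
    by (intro smooth_on_add smooth_on_bounded_linear[OF _ bounded_linear_scaleR_right]
        smooth_on_bounded_bilinear[OF _ bounded_bilinear_scaleR])
  then show "smooth_on B K"
    unfolding K_def[abs_def] by simp
qed

abbreviation p' where "p' x \<equiv> frechet_derivative p (at x)"
abbreviation K' where "K' x \<equiv> frechet_derivative K (at x)"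
abbreviation m' where "m' x X \<equiv> V x X *\<^sub>H qcnj (w x) + \<nu> x *\<^sub>H qcnj (W x X)"

lemma p': "x \<in> B \<Longrightarrow> (p has_derivative p' x) (at x)"
  and K': "x \<in> B \<Longrightarrow> (K has_derivative K' x) (at x)"
  by (rule smooth_on_has_derivative[OF smooth_p] smooth_on_has_derivative[OF smooth_K]; assumption)+

lemma m': "x \<in> B \<Longrightarrow> (m has_derivative m' x) (at x)"
proof -
  assume x: "x \<in> B"
  note wc = bounded_linear.has_derivative[OF bounded_linear_qcnj W[OF x]]
  show "(m has_derivative m' x) (at x)"
    unfolding m_def[abs_def]
    by (rule has_derivative_eq_rhs[OF qmul.FDERIV[OF V[OF x] wc]]) (simp add: fun_eq_iff add.commute)
qed

lemma inner_K: "x \<in> B \<Longrightarrow> K x \<bullet> w x = 0" "x \<in> B \<Longrightarrow> K x \<bullet> \<nu> x = 0"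
proof -
  assume x: "x \<in> B"
  show "K x \<bullet> \<nu> x = 0"
    using inner_unit[OF x] by (simp add: K_def p_def inner_diff_left)
  have "W x (w x) \<bullet> w x = 0"
    using has_derivative_eq_0_if_constant[OF open_B x inner_unit(1)
        has_derivative_inner[OF W[OF x] W[OF x]], of "w x"] by (simp add: inner_commute)
  then show "K x \<bullet> w x = 0"
    using inner_unit[OF x] by (simp add: K_def inner_diff_left)
qed

lemma qcnj_m: "x \<in> B \<Longrightarrow> qcnj (m x) = - m x"
proof -
  assume x: "x \<in> B"
  have "fst (m x) = 0"
    using inner_unit(4)[OF x] by (simp add: m_def inner_prod_def)
  then show ?thesis by (simp add: prod_eq_iff)
qed

text \<open>\<open>m\<close> is a unit imaginary quaternion: its square is -1, and left
  multiplication by it is a skew isometry.\<close>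

lemma m_simps:
  assumes x: "x \<in> B"
  shows "m x *\<^sub>H w x = \<nu> x" "m x *\<^sub>H \<nu> x = - w x" "m x *\<^sub>H (m x *\<^sub>H a) = - a"
    "(m x *\<^sub>H a) \<bullet> b = - (a \<bullet> (m x *\<^sub>H b))" "(m x *\<^sub>H a) \<bullet> (m x *\<^sub>H b) = a \<bullet> b" "a \<bullet> (m x *\<^sub>H a) = 0"
proof -
  have mm: "m x \<bullet> m x = 1"
    unfolding m_def inner_qmul_left using inner_unit[OF x]
    by (metis inner_unit(1) norm_eq_1 norm_qcnj mult_1_right x)
  show 1: "m x *\<^sub>H w x = \<nu> x"
    unfolding m_def qmul_assoc qcnj_mult_self using inner_unit[OF x] by simp
  show 3: "m x *\<^sub>H (m x *\<^sub>H a) = - a" for a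
  proof -
    have "qcnj (m x) *\<^sub>H m x = one_H"
      by (simp only: qcnj_mult_self mm scaleR_one)
    then have "- (m x *\<^sub>H m x) = one_H"
      unfolding qcnj_m[OF x] qmul.minus_left .
    then have "m x *\<^sub>H m x = - one_H"
      by (metis minus_minus)
    then have "(m x *\<^sub>H m x) *\<^sub>H a = - a"
      by (simp only: qmul.minus_left qmul_one)
    then show ?thesis by (simp only: qmul_assoc)
  qed
  show "m x *\<^sub>H \<nu> x = - w x"
    using 3[of "w x"] unfolding 1 .
  show 4: "(m x *\<^sub>H a) \<bullet> b = - (a \<bullet> (m x *\<^sub>H b))" for a b
    unfolding inner_qmul_cnj_left qcnj_m[OF x] qmul.minus_left inner_minus_right ..
  show "(m x *\<^sub>H a) \<bullet> (m x *\<^sub>H b) = a \<bullet> b"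
    by (simp only: inner_qmul_left mm mult_1_left)
  show "a \<bullet> (m x *\<^sub>H a) = 0"
    using 4[of a a] by (simp add: inner_commute)
qed

text \<open>Differentiating \<open>first_order\<close> once more brings in only the derivatives of
  \<open>p\<close> and \<open>K\<close> as new unknowns; symmetry in \<open>X\<close> and
  \<open>Y\<close> will constrain them.\<close>

lemma second_derivative_w:
  assumes x: "x \<in> B"
  shows "frechet_derivative (\<lambda>y. W y X) (at x) Y
    = (W x Y \<bullet> X) *\<^sub>R K x + (w x \<bullet> X) *\<^sub>R K' x Y
    + (V x Y \<bullet> X) *\<^sub>R (p x *\<^sub>R w x - ((2 * s + 1) / s) *\<^sub>R (m x *\<^sub>H K x))
    + (\<nu> x \<bullet> X) *\<^sub>R (p' x Y *\<^sub>R w x + p x *\<^sub>R W x Y - ((2 * s + 1) / s) *\<^sub>R (m' x Y *\<^sub>H K x + m x *\<^sub>H K' x Y))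
    + p' x Y *\<^sub>R (m x *\<^sub>H X) + p x *\<^sub>R (m' x Y *\<^sub>H X)"
proof -
  have "((\<lambda>x. (w x \<bullet> X) *\<^sub>R K x + (\<nu> x \<bullet> X) *\<^sub>R (p x *\<^sub>R w x - ((2 * s + 1) / s) *\<^sub>R (m x *\<^sub>H K x))
          + p x *\<^sub>R (m x *\<^sub>H X)) has_derivative (\<lambda>Y.
      ((w x \<bullet> X) *\<^sub>R K' x Y + (W x Y \<bullet> X) *\<^sub>R K x)
      + ((\<nu> x \<bullet> X) *\<^sub>R ((p x *\<^sub>R W x Y + p' x Y *\<^sub>R w x) - ((2 * s + 1) / s) *\<^sub>R (m x *\<^sub>H K' x Y + m' x Y *\<^sub>H K x))
         + (V x Y \<bullet> X) *\<^sub>R (p x *\<^sub>R w x - ((2 * s + 1) / s) *\<^sub>R (m x *\<^sub>H K x)))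
      + (p x *\<^sub>R (m x *\<^sub>H 0 + m' x Y *\<^sub>H X) + p' x Y *\<^sub>R (m x *\<^sub>H X)))) (at x)"
    by (intro has_derivative_add has_derivative_diff has_derivative_scaleR has_derivative_scaleR_right
        qmul.FDERIV W V p' K' m' x has_derivative_const has_derivative_inner_left)
  from frechet_derivative_eqI[OF open_B x first_order(1) this]
  show ?thesis by (simp add: qmul.zero_right algebra_simps)
qed

lemma second_derivative_\<nu>:
  assumes x: "x \<in> B"
  shows "frechet_derivative (\<lambda>y. V y X) (at x) Y
    = (W x Y \<bullet> X) *\<^sub>R (s *\<^sub>R (m x *\<^sub>H K x) - p x *\<^sub>R w x)
    + (w x \<bullet> X) *\<^sub>R (s *\<^sub>R (m' x Y *\<^sub>H K x + m x *\<^sub>H K' x Y) - p' x Y *\<^sub>R w x - p x *\<^sub>R W x Y)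
    + (V x Y \<bullet> X) *\<^sub>R ((2 * s + 1) *\<^sub>R K x) + (\<nu> x \<bullet> X) *\<^sub>R ((2 * s + 1) *\<^sub>R K' x Y)
    + ((1 + s) * p' x Y) *\<^sub>R (X - (w x \<bullet> X) *\<^sub>R w x - (\<nu> x \<bullet> X) *\<^sub>R \<nu> x)
    + ((1 + s) * p x) *\<^sub>R (- (W x Y \<bullet> X) *\<^sub>R w x - (w x \<bullet> X) *\<^sub>R W x Y - (V x Y \<bullet> X) *\<^sub>R \<nu> x - (\<nu> x \<bullet> X) *\<^sub>R V x Y)"
proof -
  have "((\<lambda>x. (w x \<bullet> X) *\<^sub>R (s *\<^sub>R (m x *\<^sub>H K x) - p x *\<^sub>R w x) + (\<nu> x \<bullet> X) *\<^sub>R ((2 * s + 1) *\<^sub>R K x)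
          + ((1 + s) * p x) *\<^sub>R (X - (w x \<bullet> X) *\<^sub>R w x - (\<nu> x \<bullet> X) *\<^sub>R \<nu> x)) has_derivative (\<lambda>Y.
      ((w x \<bullet> X) *\<^sub>R (s *\<^sub>R (m x *\<^sub>H K' x Y + m' x Y *\<^sub>H K x) - (p x *\<^sub>R W x Y + p' x Y *\<^sub>R w x))
        + (W x Y \<bullet> X) *\<^sub>R (s *\<^sub>R (m x *\<^sub>H K x) - p x *\<^sub>R w x))
      + ((\<nu> x \<bullet> X) *\<^sub>R ((2 * s + 1) *\<^sub>R K' x Y) + (V x Y \<bullet> X) *\<^sub>R ((2 * s + 1) *\<^sub>R K x))
      + (((1 + s) * p x) *\<^sub>R ((0 - ((w x \<bullet> X) *\<^sub>R W x Y + (W x Y \<bullet> X) *\<^sub>R w x))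
            - ((\<nu> x \<bullet> X) *\<^sub>R V x Y + (V x Y \<bullet> X) *\<^sub>R \<nu> x))
        + ((1 + s) * p' x Y) *\<^sub>R (X - (w x \<bullet> X) *\<^sub>R w x - (\<nu> x \<bullet> X) *\<^sub>R \<nu> x)))) (at x)"
    by (intro has_derivative_add has_derivative_diff has_derivative_scaleR has_derivative_scaleR_right
        has_derivative_mult_right
        qmul.FDERIV W V p' K' m' x has_derivative_const has_derivative_inner_left)
  from frechet_derivative_eqI[OF open_B x first_order(2) this]
  show ?thesis by (simp add: algebra_simps)
qed

lemma symmetric_w:
  "x \<in> B \<Longrightarrow> frechet_derivative (\<lambda>y. W y X) (at x) Y = frechet_derivative (\<lambda>y. W y Y) (at x) X"
  using smooth_on_second_derivative_symmetric[OF open_B smooth(2)] .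

lemma symmetric_\<nu>:
  "x \<in> B \<Longrightarrow> frechet_derivative (\<lambda>y. V y X) (at x) Y = frechet_derivative (\<lambda>y. V y Y) (at x) X"
  using smooth_on_second_derivative_symmetric[OF open_B smooth(3)] .

end

section \<open>Compatibility conditions for p and K\<close>

context rank_one_perturbation
begin

text \<open>On the plane orthogonal to \<open>w\<close> and \<open>\<nu>\<close> all terms with
  \<open>K\<close> drop out: one derivative is a multiple of the complex structure, the other a
  multiple of the identity.\<close>

lemma plane_derivatives:
  assumes x: "x \<in> B" and X: "X \<bullet> w x = 0" "X \<bullet> \<nu> x = 0"
  shows "W x X = p x *\<^sub>R (m x *\<^sub>H X)" "V x X = ((1 + s) * p x) *\<^sub>R X"
  using X by (simp_all add: first_order[OF x] inner_commute)

text \<open>Both identities come from the symmetry of \<open>D\<^sup>2w\<close> and \<open>D\<^sup>2\<nu>\<close> in the directions \<open>X\<close> and \<open>m X\<close>.\<close>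

lemma plane_compatibility:
  assumes x: "x \<in> B" and X: "X \<bullet> w x = 0" "X \<bullet> \<nu> x = 0" and "norm X = 1"
  shows "p x * p x * (s + 2) = 0" "p x * (K x \<bullet> X) = 0"
proof -
  note m = m_simps[OF x]
  have XX: "X \<bullet> X = 1" using \<open>norm X = 1\<close> by (simp add: norm_eq_1)
  define Y where "Y = m x *\<^sub>H X"
  have mY: "m x *\<^sub>H Y = - X"
    by (simp add: Y_def m(3))
  have YY: "Y \<bullet> Y = 1" by (simp add: Y_def m(5) XX)
  have XY: "X \<bullet> Y = 0" "Y \<bullet> X = 0" by (simp_all add: Y_def m(6) inner_commute)
  have Y: "Y \<bullet> w x = 0" "Y \<bullet> \<nu> x = 0"
    using X by (simp_all add: Y_def m)
  have wX: "w x \<bullet> X = 0" "\<nu> x \<bullet> X = 0" "w x \<bullet> Y = 0" "\<nu> x \<bullet> Y = 0"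
    using X Y by (simp_all add: inner_commute)
  note WX = plane_derivatives(1)[OF x X, folded Y_def] and WY = plane_derivatives(1)[OF x Y, unfolded mY]
  note VX = plane_derivatives(2)[OF x X] and VY = plane_derivatives(2)[OF x Y]
  have m'1: "m' x Y *\<^sub>H X = ((1 + s) * p x) *\<^sub>R (Y *\<^sub>H qcnj (w x) *\<^sub>H X) - p x *\<^sub>R \<nu> x"
  proof -
    have "\<nu> x *\<^sub>H qcnj X *\<^sub>H X = \<nu> x"
      by (simp only: qmul_assoc qcnj_mult_self XX scaleR_one qmul_one)
    then show ?thesis
      unfolding VY WY
      by (simp add: qmul.add_left qmul.diff_left qmul.scaleR_left qmul.scaleR_right qmul.minus_left qmul.minus_right
          linear_cmul[OF bounded_linear.linear[OF bounded_linear_qcnj]]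
          linear_neg[OF bounded_linear.linear[OF bounded_linear_qcnj]])
  qed
  have m'2: "m' x X *\<^sub>H Y = ((1 + s) * p x) *\<^sub>R (X *\<^sub>H qcnj (w x) *\<^sub>H Y) + p x *\<^sub>R \<nu> x"
  proof -
    have "\<nu> x *\<^sub>H qcnj Y *\<^sub>H Y = \<nu> x"
      by (simp only: qmul_assoc qcnj_mult_self YY scaleR_one qmul_one)
    then show ?thesis
      unfolding VX WX
      by (simp add: qmul.add_left qmul.scaleR_left qmul.scaleR_right
          linear_cmul[OF bounded_linear.linear[OF bounded_linear_qcnj]])
  qed
  \<comment> \<open>These identities dispose of the triple products: paired with \<open>X\<close> or
    \<open>Y\<close> they produce a factor \<open>X \<bullet> w x\<close> or
    \<open>Y \<bullet> w x\<close>, which is zero.\<close>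
  have perp: "(a *\<^sub>H qcnj (w x) *\<^sub>H b) \<bullet> b = (b \<bullet> b) * (a \<bullet> w x)"
    "(a *\<^sub>H qcnj (w x) *\<^sub>H b) \<bullet> a = (a \<bullet> a) * (b \<bullet> w x)" for a b
    by (simp_all add: quat_coords algebra_simps)
  have m'X: "(m' x Y *\<^sub>H X) \<bullet> X = 0" "(m' x Y *\<^sub>H X) \<bullet> Y = 0" "(m' x X *\<^sub>H Y) \<bullet> X = 0" "(m' x X *\<^sub>H Y) \<bullet> Y = 0"
    unfolding m'1 m'2 by (simp_all add: inner_diff_left inner_add_left perp X Y wX)
  have ew: "(- p x) *\<^sub>R K x + p' x Y *\<^sub>R Y + p x *\<^sub>R (m' x Y *\<^sub>H X)
      = p x *\<^sub>R K x + p' x X *\<^sub>R (- X) + p x *\<^sub>R (m' x X *\<^sub>H Y)"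
    using symmetric_w[OF x, of X Y]
    unfolding second_derivative_w[OF x] WX WY VX VY
    by (simp add: wX XY XX YY mY Y_def[symmetric] del: add_uminus_conv_diff)
  have e\<nu>: "(- p x) *\<^sub>R (s *\<^sub>R (m x *\<^sub>H K x) - p x *\<^sub>R w x) + ((1 + s) * p' x Y) *\<^sub>R X
        + ((1 + s) * p x) *\<^sub>R (p x *\<^sub>R w x)
      = p x *\<^sub>R (s *\<^sub>R (m x *\<^sub>H K x) - p x *\<^sub>R w x) + ((1 + s) * p' x X) *\<^sub>R Y
        + ((1 + s) * p x) *\<^sub>R (- p x *\<^sub>R w x)"
    using symmetric_\<nu>[OF x, of X Y]
    unfolding second_derivative_\<nu>[OF x] WX WY VX VY
    by (simp add: wX XY XX YY)
  have mK: "(m x *\<^sub>H K x) \<bullet> w x = 0" "(m x *\<^sub>H K x) \<bullet> X = - (K x \<bullet> Y)"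
    by (simp_all add: m inner_K[OF x] Y_def)
  have 1: "p' x Y = 2 * p x * (K x \<bullet> Y)"
    using arg_cong[OF ew, of "\<lambda>z. z \<bullet> Y"] by (simp add: inner_add_left inner_diff_left m'X XY YY)
  have mKY: "(m x *\<^sub>H K x) \<bullet> Y = K x \<bullet> X"
    by (simp add: m(5) Y_def)
  have 2: "p' x X = 2 * p x * (K x \<bullet> X)"
    using arg_cong[OF ew, of "\<lambda>z. z \<bullet> X"] by (simp add: inner_add_left inner_diff_left m'X XY XX)
  \<comment> \<open>Along \<open>w\<close> the two sides of the symmetry for \<open>\<nu>\<close>
    are opposite multiples of this product.\<close>
  show "p x * p x * (s + 2) = 0"
    using arg_cong[OF e\<nu>, of "\<lambda>z. z \<bullet> w x"]
    by (simp add: inner_add_left inner_diff_left mK X Y inner_unit[OF x] algebra_simps)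
  \<comment> \<open>Along \<open>Y\<close> the symmetry for \<open>\<nu>\<close> gives a second
    expression for \<open>p' x X\<close>; comparison with the one obtained from \<open>w\<close>
    leaves the nonzero factor \<open>2 * s + 1\<close>.\<close>
  have "- 2 * s * p x * (K x \<bullet> X) = (1 + s) * p' x X"
    using arg_cong[OF e\<nu>, of "\<lambda>z. z \<bullet> Y"]
    by (simp add: inner_add_left inner_diff_left mKY XY YY wX algebra_simps)
  then have "2 * (2 * s + 1) * (p x * (K x \<bullet> X)) = 0"
    unfolding 2 by (simp add: algebra_simps)
  then show "p x * (K x \<bullet> X) = 0"
    using s_nz(2) by simp
qed

lemma p_or_ratio:
  assumes "x \<in> B"
  shows "p x = 0 \<or> s = - 2"
proof -
  obtain X where "X \<bullet> w x = 0" "X \<bullet> \<nu> x = 0" "norm X = 1"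
    by (rule unit_orthogonal_to_pair)
  from plane_compatibility(1)[OF assms this] show ?thesis by auto
qed

text \<open>\<open>K x\<close> itself lies in the plane orthogonal to \<open>w\<close> and
  \<open>\<nu>\<close>, so its normalised direction may be inserted in
  \<open>plane_compatibility\<close>.\<close>

lemma p_K: 
  assumes x: "x \<in> B"
  shows "p x = 0 \<or> K x = 0"
proof (cases "K x = 0")
  case False
  then have "p x * (K x \<bullet> (K x /\<^sub>R norm (K x))) = 0"
    using inner_K[OF x] by (intro plane_compatibility[OF x]) auto
  then show ?thesis using False by simp
qed simp

text \<open>Where \<open>K\<close> is nonzero, \<open>p\<close> vanishes on a whole neighbourhood
  and hence together with its derivative. Symmetry of the second derivative of \<open>w\<close> in
  the directions \<open>K\<close>, \<open>w\<close> then gives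
  \<open>K' x (K x) = (K x \<bullet> K x) *\<^sub>R K x\<close>, while the directions
  \<open>K\<close>, \<open>\<nu>\<close> give the same relation with an extra factor
  \<open>2 * s + 1\<close>. Both can hold only for \<open>s = 0\<close>.\<close>

lemma K_eq_0:
  assumes x: "x \<in> B"
  shows "K x = 0"
proof (rule ccontr)
  assume K: "K x \<noteq> 0"
  note m = m_simps[OF x]
  define U where "U = {y \<in> B. K y \<noteq> 0}"
  have "open U"
    using continuous_open_preimage[OF smooth_on_imp_continuous_on[OF smooth_K] open_B, of "- {0}"]
    by (simp add: open_Compl U_def vimage_def Int_def)
  moreover have "x \<in> U" using x K by (simp add: U_def)
  moreover have "p y = 0" if "y \<in> U" for y
    using that p_K[of y] by (simp add: U_def)
  ultimately have p0: "p x = 0" "p' x v = 0" for v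
    using has_derivative_eq_0_if_constant p'[OF x] by blast+
  have X: "K x \<bullet> w x = 0" "K x \<bullet> \<nu> x = 0" "w x \<bullet> K x = 0" "\<nu> x \<bullet> K x = 0"
    using inner_K[OF x] by (simp_all add: inner_commute)
  have WX: "W x (K x) = 0" "V x (K x) = 0"
    using plane_derivatives[OF x X(1,2)] p0 by simp_all
  have m'0: "m' x (K x) = 0"
    by (simp add: WX qmul.zero_left qmul.zero_right linear_0[OF bounded_linear.linear[OF bounded_linear_qcnj]])
  have u: "w x \<bullet> w x = 1" "w x \<bullet> \<nu> x = 0" "\<nu> x \<bullet> w x = 0" "\<nu> x \<bullet> \<nu> x = 1"
    using inner_unit[OF x] by blast+
  define k where "k = K x \<bullet> K x"
  have k: "k \<noteq> 0" using K by (simp add: k_def)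
  have Ww: "W x (w x) \<bullet> K x = k" "V x (w x) \<bullet> K x = 0"
    "W x (\<nu> x) \<bullet> K x = 0" "V x (\<nu> x) \<bullet> K x = (2 * s + 1) * k"
    by (simp_all add: first_order[OF x] p0 u inner_add_left inner_diff_left m(4,6) k_def)
  have e1: "k *\<^sub>R K x = K' x (K x)"
    using symmetric_w[OF x, of "K x" "w x"]
    unfolding second_derivative_w[OF x] by (simp add: Ww X u p0 WX)
  have e2: "- ((2 * s + 1) * k) *\<^sub>R ((2 * s + 1) / s) *\<^sub>R (m x *\<^sub>H K x) = - ((2 * s + 1) / s) *\<^sub>R (m x *\<^sub>H K' x (K x))"
    using symmetric_w[OF x, of "K x" "\<nu> x"]
    unfolding second_derivative_w[OF x] m'0 by (simp add: Ww X u p0 WX qmul.zero_left)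
  have "(2 * s + 1) / s \<noteq> 0" using s_nz by simp
  moreover have "((2 * s + 1) / s) *\<^sub>R (((2 * s + 1) * k) *\<^sub>R (m x *\<^sub>H K x)) = ((2 * s + 1) / s) *\<^sub>R (k *\<^sub>R (m x *\<^sub>H K x))"
    using e2 unfolding e1[symmetric] qmul.scaleR_right by (simp add: ac_simps)
  ultimately have "((2 * s + 1) * k) *\<^sub>R (m x *\<^sub>H K x) = k *\<^sub>R (m x *\<^sub>H K x)"
    by (metis scaleR_cancel_left)
  moreover have "m x *\<^sub>H K x \<noteq> 0"
    using m(5)[of "K x" "K x"] k by (auto simp: k_def)
  ultimately have "(2 * s + 1) * k = k"
    by (metis scaleR_cancel_right)
  then show False using k s_nz by simp
qed

lemma first_order_final:
  assumes x: "x \<in> B"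
  shows "W x X = p x *\<^sub>R ((\<nu> x \<bullet> X) *\<^sub>R w x + m x *\<^sub>H X)"
    and "V x X = ((1 + s) * p x) *\<^sub>R (X - (w x \<bullet> X) *\<^sub>R w x - (\<nu> x \<bullet> X) *\<^sub>R \<nu> x) - ((w x \<bullet> X) * p x) *\<^sub>R w x"
    and "W x (w x) = p x *\<^sub>R \<nu> x"
  using first_order[OF x, of X] K_eq_0[OF x] K_def[of x]
  by (simp_all add: qmul.zero_right scaleR_add_right mult.commute)

end

section \<open>Rigidity in the regular case\<close>

lemma constant_if_derivative_zero:
  fixes f :: "'a::euclidean_space \<Rightarrow> 'b::real_normed_vector"
  assumes "open S" "connected S" "\<forall>x\<in>S. (f has_derivative (\<lambda>h. 0)) (at x)" "x \<in> S" "y \<in> S"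
  shows "f x = f y"
  using assms by (intro has_derivative_zero_unique_connected[of S f]) auto

text \<open>Connectedness enters twice: the derivative is constant, and then so is \<open>g\<close>
  minus that linear map.\<close>

lemma affine_if_second_derivative_zero:
  fixes g :: "'a::euclidean_space \<Rightarrow> 'b::euclidean_space"
  assumes D: "open D" "connected D" and g: "smooth_on D g"
    and zero: "\<forall>x\<in>D. \<forall>u v. frechet_derivative (\<lambda>y. frechet_derivative g (at y) v) (at x) u = 0"
  obtains L c where "linear L" "\<forall>x\<in>D. g x = L x + c"
proof (cases "D = {}")
  case True
  then show ?thesis using that[of "\<lambda>_. 0" 0] by (simp add: linear_0 linearI)
next
  case False
  then obtain a where a: "a \<in> D" by blast
  define L where "L = frechet_derivative g (at a)"
  have L: "bounded_linear L"
    using smooth_on_has_derivative[OF g a] unfolding L_def by (rule has_derivative_bounded_linear)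
  have dg: "frechet_derivative g (at x) v = L v" if "x \<in> D" for x v
  proof -
    have "((\<lambda>y. frechet_derivative g (at y) v) has_derivative (\<lambda>h. 0)) (at y)" if "y \<in> D" for y
    proof -
      have "frechet_derivative (\<lambda>y. frechet_derivative g (at y) v) (at y) = (\<lambda>h. 0)"
        using zero[rule_format, OF that] by (simp add: fun_eq_iff)
      then show ?thesis
        using smooth_on_has_derivative[OF smooth_on_frechet_derivative[OF g] that, of v] by simp
    qed
    then have "\<forall>y\<in>D. ((\<lambda>y. frechet_derivative g (at y) v) has_derivative (\<lambda>h. 0)) (at y)" by (rule ballI)
    from constant_if_derivative_zero[OF D this \<open>x \<in> D\<close> a] show ?thesis
      by (simp add: L_def)
  qed
  have "((\<lambda>y. g y - L y) has_derivative (\<lambda>h. 0)) (at y)" if "y \<in> D" for y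
    using has_derivative_diff[OF smooth_on_has_derivative[OF g that] bounded_linear_imp_has_derivative[OF L]]
    by (simp add: dg[OF that])
  then have d0: "\<forall>y\<in>D. ((\<lambda>y. g y - L y) has_derivative (\<lambda>h. 0)) (at y)" by (rule ballI)
  have "g x - L x = g a - L a" if "x \<in> D" for x
    using constant_if_derivative_zero[OF D d0 that a] .
  then show ?thesis
    using that[of L "g a - L a"] bounded_linear.linear[OF L] by (auto simp: algebra_simps)
qed

text \<open>The equation says that \<open>x + G x / (G x \<bullet> G x)\<close> is locally constant where \<open>G\<close> does not vanish.\<close>

lemma inversion_field_unique:
  fixes G :: "'a::euclidean_space \<Rightarrow> 'a"
  assumes D: "open D" "connected D"
    and dG: "\<forall>x\<in>D. (G has_derivative (\<lambda>X. (2 * (G x \<bullet> X)) *\<^sub>R G x - (G x \<bullet> G x) *\<^sub>R X)) (at x)"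
    and x1: "x1 \<in> D" "G x1 \<noteq> 0"
  obtains x0 where "x0 \<notin> D" "\<forall>x\<in>D. G x = - inverse ((x - x0) \<bullet> (x - x0)) *\<^sub>R (x - x0)"
proof -
  note G = dG[rule_format]
  define c where "c x = x + inverse (G x \<bullet> G x) *\<^sub>R G x" for x
  define x0 where "x0 = c x1"
  define A where "A = {x \<in> D. G x \<noteq> 0 \<and> c x = x0}"
  have cont: "continuous_on D G"
    using G has_derivative_continuous continuous_at_imp_continuous_on by blast
  \<comment> \<open>Cleared of inverses, the description of \<open>A\<close> consists of equations
    between continuous functions, so \<open>A\<close> is closed in \<open>D\<close>; openness will
    come from \<open>c\<close> being locally constant.\<close>
  have AI: "A = {x \<in> D. ((x - x0) \<bullet> (x - x0)) *\<^sub>R G x + (x - x0) = 0} \<inter>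
      {x \<in> D. (G x \<bullet> G x) * ((x - x0) \<bullet> (x - x0)) = 1}"
  proof (intro equalityI subsetI)
    fix x assume "x \<in> A"
    then have x: "x \<in> D" "G x \<noteq> 0" "x - x0 = - inverse (G x \<bullet> G x) *\<^sub>R G x"
      by (auto simp: A_def c_def)
    then show "x \<in> {x \<in> D. ((x - x0) \<bullet> (x - x0)) *\<^sub>R G x + (x - x0) = 0} \<inter>
      {x \<in> D. (G x \<bullet> G x) * ((x - x0) \<bullet> (x - x0)) = 1}"
      unfolding Int_Collect mem_Collect_eq x(3) by simp
  next
    fix x assume "x \<in> {x \<in> D. ((x - x0) \<bullet> (x - x0)) *\<^sub>R G x + (x - x0) = 0} \<inter>
      {x \<in> D. (G x \<bullet> G x) * ((x - x0) \<bullet> (x - x0)) = 1}"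
    then have x: "x \<in> D" "((x - x0) \<bullet> (x - x0)) *\<^sub>R G x + (x - x0) = 0"
      "(G x \<bullet> G x) * ((x - x0) \<bullet> (x - x0)) = 1"
      by auto
    have "inverse (G x \<bullet> G x) = (x - x0) \<bullet> (x - x0)"
      using x(3) by (metis inverse_unique)
    moreover have "x + ((x - x0) \<bullet> (x - x0)) *\<^sub>R G x = x0"
    proof -
      have "b + a = y" if "a + (b - y) = 0" for a b y :: 'a
        using that by (simp add: algebra_simps)
      then show ?thesis using x(2) .
    qed
    ultimately show "x \<in> A"
      using x unfolding A_def c_def by auto
  qed
  have "A = D"
  proof -
    have cl: "closedin (top_of_set D) A"
      unfolding AI
      by (intro closedin_Int continuous_closedin_preimage_constant continuous_intros cont)
    have "openin (top_of_set D) A"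
    proof (subst openin_open_eq[OF D(1)], intro conjI)
      show "A \<subseteq> D" by (auto simp: A_def)
      show "open A"
      proof (rule openI)
        fix x assume x: "x \<in> A"
        have "open {y \<in> D. G y \<noteq> 0}"
          using continuous_open_preimage[OF cont D(1), of "- {0}"]
          by (simp add: vimage_def Int_def open_Compl)
        then obtain e where e: "e > 0" "ball x e \<subseteq> {y \<in> D. G y \<noteq> 0}"
          using x unfolding A_def open_contains_ball by blast
        have "(c has_derivative (\<lambda>h. 0)) (at y)" if "y \<in> ball x e" for y
        proof -
          have y: "y \<in> D" "G y \<bullet> G y \<noteq> 0" using e that by auto
          let ?DG = "\<lambda>X. (2 * (G y \<bullet> X)) *\<^sub>R G y - (G y \<bullet> G y) *\<^sub>R X"
          have GDG: "G y \<bullet> ?DG X = (G y \<bullet> G y) * (G y \<bullet> X)" for X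
            by (simp add: inner_diff_right algebra_simps)
          have GG: "((\<lambda>x. G x \<bullet> G x) has_derivative (\<lambda>X. G y \<bullet> ?DG X + ?DG X \<bullet> G y)) (at y)"
            by (rule has_derivative_inner[OF G[OF y(1)] G[OF y(1)]])
          from Deriv.has_derivative_inverse[OF _ this, OF y(2)]
          have inv: "((\<lambda>x. inverse (G x \<bullet> G x)) has_derivative (\<lambda>X. - (inverse (G y \<bullet> G y)
              * (G y \<bullet> ?DG X + ?DG X \<bullet> G y) * inverse (G y \<bullet> G y)))) (at y)" .
          have "(c has_derivative (\<lambda>X. X + (inverse (G y \<bullet> G y) *\<^sub>R ?DG X
              + (- (inverse (G y \<bullet> G y) * (G y \<bullet> ?DG X + ?DG X \<bullet> G y) * inverse (G y \<bullet> G y))) *\<^sub>R G y))) (at y)"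
            unfolding c_def[abs_def]
            by (intro has_derivative_add has_derivative_ident has_derivative_scaleR G[OF y(1)] inv)
          moreover have "X + (inverse (G y \<bullet> G y) *\<^sub>R ?DG X
              + (- (inverse (G y \<bullet> G y) * (G y \<bullet> ?DG X + ?DG X \<bullet> G y) * inverse (G y \<bullet> G y))) *\<^sub>R G y) = 0" for X
            unfolding inner_commute[of "?DG X" "G y"] GDG using y(2)
            by (simp add: scaleR_diff_right)
          ultimately show ?thesis by simp
        qed
        then have d0: "\<forall>y\<in>ball x e. (c has_derivative (\<lambda>h. 0)) (at y)" by (rule ballI)
        have "c y = c x" if "y \<in> ball x e" for y
          using constant_if_derivative_zero[OF open_ball connected_ball d0 that] e(1) by simp
        then have "ball x e \<subseteq> A"
          using e x unfolding A_def by blast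
        then show "\<exists>e>0. ball x e \<subseteq> A"
          using e(1) by blast
      qed
    qed
    moreover have "x1 \<in> A" using x1 by (simp add: A_def x0_def)
    ultimately show ?thesis
      using connected_clopen[THEN iffD1, OF D(2), rule_format, OF conjI, of A] cl by auto
  qed
  show ?thesis
  proof (rule that, safe)
    fix x assume "x \<in> D"
    then have x: "((x - x0) \<bullet> (x - x0)) *\<^sub>R G x + (x - x0) = 0"
      "(G x \<bullet> G x) * ((x - x0) \<bullet> (x - x0)) = 1"
      using \<open>A = D\<close> AI by auto
    then have "(x - x0) \<bullet> (x - x0) \<noteq> 0" by auto
    moreover have "((x - x0) \<bullet> (x - x0)) *\<^sub>R G x = - (x - x0)"
      using x(1) by (simp only: eq_neg_iff_add_eq_0)
    ultimately show "G x = - inverse ((x - x0) \<bullet> (x - x0)) *\<^sub>R (x - x0)"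
    proof -
      have *: "a = - inverse k *\<^sub>R y" if "k \<noteq> 0" "k *\<^sub>R a = - y" for k and a y :: 'a
      proof -
        have "inverse k *\<^sub>R (k *\<^sub>R a) = inverse k *\<^sub>R (- y)"
          by (simp only: that(2))
        then show ?thesis using that(1) by simp
      qed
      show ?thesis by (rule *) fact+
    qed
  next
    \<comment> \<open>At the pole the second equation defining \<open>A\<close> would read 0 =
      1.\<close>
    show False if "x0 \<in> D"
    proof -
      from that have "x0 \<in> {x \<in> D. (G x \<bullet> G x) * ((x - x0) \<bullet> (x - x0)) = 1}"
        using \<open>A = D\<close> AI by blast
      then show False by simp
    qed
  qed
qed

section \<open>From the structure equations to the map\<close>

context rank_one_perturbation
begin

text \<open>\<open>W x (w x)\<close> is \<open>p x *\<^sub>R \<nu> x\<close>, and \<open>p\<close>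
  governs all of \<open>W\<close> and \<open>V\<close>. The condition is phrased through
  \<open>w\<close> alone so that it makes sense on the whole domain, across different choices of
  \<open>\<nu>\<close>.\<close>

lemma second_derivative_g_eq_0:
  assumes x: "x \<in> B" and "W x (w x) = 0"
  shows "frechet_derivative (\<lambda>y. frechet_derivative g (at y) v) (at x) u = 0"
proof -
  have "p x *\<^sub>R \<nu> x = 0"
    using first_order_final(3)[OF x] assms(2) by simp
  then have "p x = 0"
    using unit(2)[OF x] by auto
  then have "W x u = 0" "V x u = 0" for u
    using first_order_final[OF x] by simp_all
  then show ?thesis
    unfolding second_derivative_g[OF x]
    by (simp add: qmul.zero_left qmul.zero_right
        linear_0[OF bounded_linear.linear[OF bounded_linear_qcnj]] del: fst_qmul snd_qmul)
qed

lemma ratio: "x \<in> B \<Longrightarrow> W x (w x) \<noteq> 0 \<Longrightarrow> s = - 2"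
  using p_or_ratio first_order_final(3) by fastforce

text \<open>Replacing \<open>p x *\<^sub>R \<nu> x\<close> by \<open>W x (w x)\<close> removes the
  local field from the structure equation.\<close>

lemma W_eq:
  assumes x: "x \<in> B"
  shows "W x X = (W x (w x) \<bullet> X) *\<^sub>R w x + W x (w x) *\<^sub>H (qcnj (w x) *\<^sub>H X)"
  unfolding first_order_final(3)[OF x] first_order_final(1)[OF x, of X]
  by (simp add: m_def qmul.scaleR_left qmul_assoc scaleR_add_right)

lemma inner_W_w: "x \<in> B \<Longrightarrow> W x (w x) \<bullet> w x = 0"
  by (simp add: first_order_final(3) inner_unit)

text \<open>\<open>\<nu>\<close> occurs quadratically in the rank-one term, so both occurrences can
  be replaced by \<open>W x (w x)\<close>, divided by its squared length, whatever the sign of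
  \<open>p\<close>.\<close>

lemma dg_eq:
  assumes x: "x \<in> B" and G: "W x (w x) \<noteq> 0"
  shows "frechet_derivative g (at x) X = l *\<^sub>R snd (qcnj (w x) *\<^sub>H X)
    + (\<kappa> * (W x (w x) \<bullet> X) / (W x (w x) \<bullet> W x (w x))) *\<^sub>R snd (qcnj (w x) *\<^sub>H W x (w x))"
proof -
  have "p x \<noteq> 0" using G first_order_final(3)[OF x] by auto
  then show ?thesis
    unfolding dg[OF x] first_order_final(3)[OF x]
    by (simp add: qmul.scaleR_right inner_unit[OF x] del: fst_qmul snd_qmul)
qed

text \<open>For \<open>s = - 2\<close> the derivative of \<open>\<nu>\<close> becomes
  \<open>- p\<close> times the projection orthogonal to \<open>\<nu>\<close>. Symmetry of the second
  derivative of \<open>\<nu>\<close> then fixes the derivative of \<open>p\<close> as the square of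
  \<open>p\<close> times the inner product with \<open>\<nu>\<close>, and the product rule applies
  to \<open>p x *\<^sub>R \<nu> x\<close>.\<close>

lemma derivative_W_w:
  assumes x: "x \<in> B" and s: "s = - 2"
  shows "((\<lambda>x. W x (w x)) has_derivative
    (\<lambda>X. (2 * (W x (w x) \<bullet> X)) *\<^sub>R W x (w x) - (W x (w x) \<bullet> W x (w x)) *\<^sub>R X)) (at x)"
proof -
  have V_eq: "V y X = (- p y) *\<^sub>R (X - (\<nu> y \<bullet> X) *\<^sub>R \<nu> y)" if "y \<in> B" for y X
    unfolding first_order_final(2)[OF that] s by (simp add: algebra_simps)
  note u = inner_unit[OF x]
  have V\<nu>: "V x (\<nu> x) = 0" and VX: "V x X = (- p x) *\<^sub>R X" if "X \<bullet> \<nu> x = 0" for X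
    using that by (simp_all add: V_eq[OF x] u inner_commute)
  have V2: "frechet_derivative (\<lambda>y. V y X) (at x) Y
      = (- p' x Y) *\<^sub>R (X - (\<nu> x \<bullet> X) *\<^sub>R \<nu> x) + p x *\<^sub>R ((V x Y \<bullet> X) *\<^sub>R \<nu> x + (\<nu> x \<bullet> X) *\<^sub>R V x Y)" for X Y
  proof -
    have "((\<lambda>x. (- p x) *\<^sub>R (X - (\<nu> x \<bullet> X) *\<^sub>R \<nu> x)) has_derivative
        (\<lambda>Y. (- p x) *\<^sub>R (0 - ((\<nu> x \<bullet> X) *\<^sub>R V x Y + (V x Y \<bullet> X) *\<^sub>R \<nu> x))
          + (- p' x Y) *\<^sub>R (X - (\<nu> x \<bullet> X) *\<^sub>R \<nu> x))) (at x)"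
      by (intro has_derivative_diff has_derivative_scaleR has_derivative_minus
          V p' x has_derivative_const has_derivative_inner_left)
    from frechet_derivative_eqI[OF open_B x V_eq this] show ?thesis
      by (simp add: algebra_simps)
  qed
  have p\<nu>: "p' x (\<nu> x) = p x * p x"
  proof -
    obtain X where X: "X \<bullet> \<nu> x = 0" "X \<bullet> \<nu> x = 0" "norm X = 1"
      by (rule unit_orthogonal_to_pair)
    have X': "\<nu> x \<bullet> X = 0" "X \<noteq> 0" using X by (auto simp: inner_commute)
    have "(- p' x (\<nu> x)) *\<^sub>R X = (- (p x * p x)) *\<^sub>R X"
      using symmetric_\<nu>[OF x, of X "\<nu> x"] unfolding V2 V\<nu>[OF X(1)] VX[OF X(1)]
      by (simp add: X X' u)
    then show ?thesis using X'(2) by simp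
  qed
  have pY: "p' x Y = 0" if Y: "Y \<bullet> \<nu> x = 0" for Y
  proof -
    obtain X where X: "X \<bullet> \<nu> x = 0" "X \<bullet> Y = 0" "norm X = 1"
      by (rule unit_orthogonal_to_pair)
    have XX: "X \<bullet> X = 1" "\<nu> x \<bullet> X = 0" "\<nu> x \<bullet> Y = 0" "Y \<bullet> X = 0"
      using X Y by (auto simp: norm_eq_1 inner_commute)
    have "(- p' x Y) *\<^sub>R X = (- p' x X) *\<^sub>R Y"
      using symmetric_\<nu>[OF x, of X Y] unfolding V2 VX[OF X(1)] VX[OF Y]
      by (simp add: X XX)
    from arg_cong[OF this, of "\<lambda>z. z \<bullet> X"] show ?thesis
      by (simp add: XX)
  qed
  have p'_eq: "p' x X = (\<nu> x \<bullet> X) * (p x * p x)" for X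
  proof -
    have lin: "linear (p' x)" using p'[OF x] by (rule has_derivative_linear)
    have "X = (\<nu> x \<bullet> X) *\<^sub>R \<nu> x + (X - (\<nu> x \<bullet> X) *\<^sub>R \<nu> x)" by simp
    then have "p' x X = (\<nu> x \<bullet> X) * p' x (\<nu> x) + p' x (X - (\<nu> x \<bullet> X) *\<^sub>R \<nu> x)"
      by (metis linear_add[OF lin] linear_cmul[OF lin] real_scaleR_def)
    also have "p' x (X - (\<nu> x \<bullet> X) *\<^sub>R \<nu> x) = 0"
      by (rule pY) (simp add: inner_diff_left inner_diff_right u inner_commute)
    finally show ?thesis by (simp add: p\<nu>)
  qed
  have "((\<lambda>x. p x *\<^sub>R \<nu> x) has_derivative (\<lambda>X. p x *\<^sub>R V x X + p' x X *\<^sub>R \<nu> x)) (at x)"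
    by (intro has_derivative_scaleR V p' x)
  then have "((\<lambda>x. W x (w x)) has_derivative (\<lambda>X. p x *\<^sub>R V x X + p' x X *\<^sub>R \<nu> x)) (at x)"
    by (rule has_derivative_transform_within_open[OF _ open_B x]) (simp add: first_order_final(3))
  then show ?thesis
    unfolding first_order_final(3)[OF x] V_eq[OF x] p'_eq
  proof (rule has_derivative_eq_rhs)
    have "a *\<^sub>R (- a) *\<^sub>R (X - q *\<^sub>R n) + (q * (a * a)) *\<^sub>R n = (2 * (a * q)) *\<^sub>R a *\<^sub>R n - (a * a) *\<^sub>R X"
      for a q and X n :: quat
      by (simp add: prod_eq_iff vec_eq_iff algebra_simps)
    then show "(\<lambda>X. p x *\<^sub>R (- p x) *\<^sub>R (X - (\<nu> x \<bullet> X) *\<^sub>R \<nu> x) + (\<nu> x \<bullet> X * (p x * p x)) *\<^sub>R \<nu> x) =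
      (\<lambda>X. (2 * ((p x *\<^sub>R \<nu> x) \<bullet> X)) *\<^sub>R p x *\<^sub>R \<nu> x - ((p x *\<^sub>R \<nu> x) \<bullet> (p x *\<^sub>R \<nu> x)) *\<^sub>R X)"
      by (simp only: inner_scaleR_left inner_scaleR_right u mult_1_right)
  qed
qed

end

text \<open>The field \<open>G\<close> is defined on all of \<open>D\<close> although
  \<open>\<nu>\<close> is only local. If it vanishes identically, so does the second derivative of
  \<open>g\<close>; otherwise it has the form found in \<open>inversion_field_unique\<close>, and
  \<open>w\<close> and \<open>g\<close> are recovered from two constant quantities.\<close>

lemma rank_one_perturbation_rigidity:
  assumes D: "open D" "connected D" and g: "smooth_on D g" and w: "smooth_on D w"
    and local: "\<And>x. x \<in> D \<Longrightarrow> \<exists>B \<nu>. x \<in> B \<and> rank_one_perturbation B g w \<nu> l \<kappa>"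
  shows "(\<exists>L c. linear L \<and> (\<forall>x\<in>D. g x = L x + c)) \<or>
    (l = - 2 * \<kappa> \<and> (\<exists>x0 y0 \<epsilon>. fst \<epsilon> = 0 \<and> norm \<epsilon> = 1 \<and> x0 \<notin> D \<and>
       (\<forall>x\<in>D. g x = y0 + (\<kappa> / norm (x - x0)) *\<^sub>R snd (qcnj (x - x0) *\<^sub>H \<epsilon> *\<^sub>H (x - x0)))))"
proof -
  define G where "G x = frechet_derivative w (at x) (w x)" for x
  show ?thesis
  proof (cases "\<forall>x\<in>D. G x = 0")
    case True
    have "\<forall>x\<in>D. \<forall>u v. frechet_derivative (\<lambda>y. frechet_derivative g (at y) v) (at x) u = 0"
    proof (intro ballI allI)
      fix x u v assume "x \<in> D"
      obtain B \<nu> where "x \<in> B" "rank_one_perturbation B g w \<nu> l \<kappa>"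
        using local[OF \<open>x \<in> D\<close>] by blast
      then show "frechet_derivative (\<lambda>y. frechet_derivative g (at y) v) (at x) u = 0"
        using rank_one_perturbation.second_derivative_g_eq_0[of B g w \<nu> l \<kappa> x v u] True \<open>x \<in> D\<close>
        by (simp add: G_def)
    qed
    then obtain L c where "linear L" "\<forall>x\<in>D. g x = L x + c"
      by (rule affine_if_second_derivative_zero[OF D g])
    then show ?thesis by blast
  next
    case False
    then obtain x1 where x1: "x1 \<in> D" "G x1 \<noteq> 0" by blast
    obtain B1 \<nu>1 where B1: "x1 \<in> B1" "rank_one_perturbation B1 g w \<nu>1 l \<kappa>"
      using local[OF x1(1)] by blast
    \<comment> \<open>One point with \<open>G\<close> nonzero suffices, since \<open>l\<close> and
      \<open>\<kappa>\<close> do not depend on the point; the field equation then holds even where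
      \<open>G\<close> might vanish.\<close>
    have s: "l / \<kappa> = - 2"
      using rank_one_perturbation.ratio[OF B1(2,1)] x1(2)
      unfolding rank_one_perturbation.s_def[OF B1(2)] G_def by (rule mp[OF impI])
    then have l: "l = - 2 * \<kappa>"
      using rank_one_perturbation.nz(2)[OF B1(2)] by (simp add: field_simps)
    have "\<forall>x\<in>D. (G has_derivative (\<lambda>X. (2 * (G x \<bullet> X)) *\<^sub>R G x - (G x \<bullet> G x) *\<^sub>R X)) (at x)"
    proof (intro ballI)
      fix x assume "x \<in> D"
      obtain B \<nu> where B: "x \<in> B" "rank_one_perturbation B g w \<nu> l \<kappa>"
        using local[OF \<open>x \<in> D\<close>] by blast
      show "(G has_derivative (\<lambda>X. (2 * (G x \<bullet> X)) *\<^sub>R G x - (G x \<bullet> G x) *\<^sub>R X)) (at x)"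
        using rank_one_perturbation.derivative_W_w[OF B(2,1)] s
        unfolding rank_one_perturbation.s_def[OF B(2)] G_def[symmetric] by simp
    qed
    then obtain x0 where x0: "x0 \<notin> D"
      and G': "\<forall>x\<in>D. G x = - inverse ((x - x0) \<bullet> (x - x0)) *\<^sub>R (x - x0)"
      by (rule inversion_field_unique[where G = G, OF D _ x1])
    note G = G'[rule_format]
    \<comment> \<open>Two first integrals, suggested by the expected solution: there
      \<open>w x\<close> is \<open>\<epsilon> *\<^sub>H (x - x0)\<close> divided by the norm of
      \<open>x - x0\<close>, and \<open>g\<close> is a constant minus \<open>\<kappa>\<close> times
      the imaginary part of \<open>qcnj (w x) *\<^sub>H (x - x0)\<close>.\<close>
    define h where "h x = g x + \<kappa> *\<^sub>R snd (qcnj (w x) *\<^sub>H (x - x0))" for x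
    define e where "e x = inverse (norm (x - x0)) *\<^sub>R (w x *\<^sub>H qcnj (x - x0))" for x
    have main: "(h has_derivative (\<lambda>X. 0)) (at x)" "(e has_derivative (\<lambda>X. 0)) (at x)"
      "norm (w x) = 1" "w x \<bullet> (x - x0) = 0" if x: "x \<in> D" for x
    proof -
      obtain B \<nu> where B: "x \<in> B" "rank_one_perturbation B g w \<nu> l \<kappa>"
        using local[OF \<open>x \<in> D\<close>] by blast
      define y where "y = x - x0"
      define r where "r = y \<bullet> y"
      have r: "r \<noteq> 0" using x x0 by (auto simp: r_def y_def)
      note Gx = G[OF x, folded y_def r_def]
      have Gnz: "G x \<noteq> 0" unfolding Gx using r by (auto simp: r_def)
      show "norm (w x) = 1" by (rule rank_one_perturbation.unit(1)[OF B(2,1)])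
      have "G x \<bullet> w x = 0"
        unfolding G_def by (rule rank_one_perturbation.inner_W_w[OF B(2,1)])
      then have wy: "w x \<bullet> y = 0"
        unfolding Gx using r by (simp add: inner_commute)
      then show "w x \<bullet> (x - x0) = 0" by (simp add: y_def)
      let ?W = "frechet_derivative w (at x)"
      have W: "?W X = (G x \<bullet> X) *\<^sub>R w x + G x *\<^sub>H (qcnj (w x) *\<^sub>H X)" for X
        unfolding G_def by (rule rank_one_perturbation.W_eq[OF B(2,1)])
      have dw: "(w has_derivative ?W) (at x)"
        by (rule smooth_on_has_derivative[OF w x])
      have dwc: "((\<lambda>x. qcnj (w x)) has_derivative (\<lambda>X. qcnj (?W X))) (at x)"
        by (rule bounded_linear.has_derivative[OF bounded_linear_qcnj dw])
      have dy: "((\<lambda>x. x - x0) has_derivative (\<lambda>X. X)) (at x)"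
        by (rule has_derivative_eq_rhs[OF has_derivative_diff[OF has_derivative_ident has_derivative_const]]) simp
      have dyc: "((\<lambda>x. qcnj (x - x0)) has_derivative (\<lambda>X. qcnj X)) (at x)"
        by (rule bounded_linear.has_derivative[OF bounded_linear_qcnj dy])
      have GG: "G x \<bullet> G x = inverse r" "(G x \<bullet> X) = - (inverse r * (y \<bullet> X))" for X
        unfolding Gx using r by (simp_all add: r_def[symmetric])
      have dg: "frechet_derivative g (at x) X = l *\<^sub>R snd (qcnj (w x) *\<^sub>H X)
          + (\<kappa> * inverse r * (y \<bullet> X)) *\<^sub>R snd (qcnj (w x) *\<^sub>H y)" for X
      proof -
        have q: "qcnj (w x) *\<^sub>H G x = - inverse r *\<^sub>R (qcnj (w x) *\<^sub>H y)"
          unfolding Gx by (simp only: qmul.scaleR_right)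
        show ?thesis
          using rank_one_perturbation.dg_eq[OF B(2,1), folded G_def, OF Gnz, of X] r
          unfolding GG(1) unfolding GG(2) q snd_scaleR by (simp del: snd_qmul)
      qed
      have hd: "(h has_derivative (\<lambda>X. frechet_derivative g (at x) X
          + \<kappa> *\<^sub>R snd (qcnj (w x) *\<^sub>H X + qcnj (?W X) *\<^sub>H y))) (at x)"
        unfolding h_def[abs_def] y_def
        by (intro has_derivative_add smooth_on_has_derivative[OF g x] has_derivative_scaleR_right
            has_derivative_snd qmul.FDERIV dwc dy)
      have "frechet_derivative g (at x) X + \<kappa> *\<^sub>R snd (qcnj (w x) *\<^sub>H X + qcnj (?W X) *\<^sub>H y) = 0" for X
      proof -
        have "qcnj (?W X) *\<^sub>H y = - (inverse r * (y \<bullet> X)) *\<^sub>R (qcnj (w x) *\<^sub>H y)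
            - inverse r *\<^sub>R (qcnj X *\<^sub>H (w x *\<^sub>H (qcnj y *\<^sub>H y)))"
          unfolding W GG unfolding Gx
          by (simp add: qmul.add_left qmul.diff_left qmul.minus_left qmul.minus_right qmul.scaleR_left qmul.scaleR_right qcnj_qmul qmul_assoc
              linear_add[OF bounded_linear.linear[OF bounded_linear_qcnj]]
              linear_diff[OF bounded_linear.linear[OF bounded_linear_qcnj]]
              linear_neg[OF bounded_linear.linear[OF bounded_linear_qcnj]]
              linear_cmul[OF bounded_linear.linear[OF bounded_linear_qcnj]])
        also have "\<dots> = - (inverse r * (y \<bullet> X)) *\<^sub>R (qcnj (w x) *\<^sub>H y) - qcnj X *\<^sub>H w x"
          using r by (simp add: qcnj_mult_self r_def qmul.scaleR_right)
        finally have 1: "snd (qcnj (?W X) *\<^sub>H y)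
            = - (inverse r * (y \<bullet> X)) *\<^sub>R snd (qcnj (w x) *\<^sub>H y) - snd (qcnj X *\<^sub>H w x)"
          by (simp only: snd_diff snd_scaleR)
        have 2: "snd (qcnj X *\<^sub>H w x) = - snd (qcnj (w x) *\<^sub>H X)"
          by (simp add: vec_eq_iff forall_3 cross_components)
        \<comment> \<open>The derivative of \<open>h\<close> cancels precisely because
          \<open>l = - 2 * \<kappa>\<close>.\<close>
        have "(- 2 * \<kappa>) *\<^sub>R a + (\<kappa> * i * q) *\<^sub>R b + \<kappa> *\<^sub>R (a + (- (i * q) *\<^sub>R b - - a)) = 0"
          for a b :: "real^3" and i q
          by (simp add: vec_eq_iff algebra_simps)
        then show ?thesis
          unfolding snd_add 1 2 dg l .
      qed
      then show "(h has_derivative (\<lambda>X. 0)) (at x)"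
        using hd by simp
      have ynz: "y \<noteq> 0" using r by (auto simp: r_def)
      have rn: "r = norm y * norm y" by (simp add: r_def power2_norm_eq_inner[symmetric] power2_eq_square)
      have dn: "((\<lambda>x. norm (x - x0)) has_derivative (\<lambda>X. (y \<bullet> X) / norm y)) (at x)"
      proof -
        have "x - x0 \<noteq> 0" using ynz by (simp add: y_def)
        from has_derivative_compose[OF dy has_derivative_norm[OF this]]
        show ?thesis
          by (rule has_derivative_eq_rhs) (simp add: y_def sgn_div_norm fun_eq_iff inner_commute divide_inverse)
      qed
      have nny: "norm (x - x0) \<noteq> 0" using ynz by (simp add: y_def)
      from Deriv.has_derivative_inverse[OF _ dn, OF nny]
      have di: "((\<lambda>x. inverse (norm (x - x0))) has_derivative
          (\<lambda>X. - (inverse (norm y) * ((y \<bullet> X) / norm y) * inverse (norm y)))) (at x)"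
        by (simp only: y_def)
      have ed: "(e has_derivative (\<lambda>X. inverse (norm y) *\<^sub>R (w x *\<^sub>H qcnj X + ?W X *\<^sub>H qcnj y)
          + - (inverse (norm y) * ((y \<bullet> X) / norm y) * inverse (norm y)) *\<^sub>R (w x *\<^sub>H qcnj y))) (at x)"
        unfolding e_def[abs_def] y_def
        by (rule has_derivative_scaleR[OF di[unfolded y_def] qmul.FDERIV[OF dw dyc]])
      have k1: "w x *\<^sub>H qcnj X + ?W X *\<^sub>H qcnj y = (inverse r * (y \<bullet> X)) *\<^sub>R (w x *\<^sub>H qcnj y)" for X
      proof -
        \<comment> \<open>Orthogonality of \<open>w\<close> and \<open>y\<close> makes
          \<open>w x *\<^sub>H qcnj y\<close> imaginary, so conjugation changes its sign;
          \<open>b\<close> is the reflection formula for multiplying by \<open>qcnj y\<close> on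
          both sides.\<close>
        have a: "y *\<^sub>H qcnj (w x) = - (w x *\<^sub>H qcnj y)"
          using wy by (simp add: quat_coords algebra_simps)
        have b: "qcnj y *\<^sub>H (X *\<^sub>H qcnj y) = (2 * (y \<bullet> X)) *\<^sub>R qcnj y - r *\<^sub>R qcnj X"
          by (simp add: r_def quat_coords algebra_simps)
        have "?W X *\<^sub>H qcnj y = - (inverse r * (y \<bullet> X)) *\<^sub>R (w x *\<^sub>H qcnj y)
            - inverse r *\<^sub>R (y *\<^sub>H qcnj (w x) *\<^sub>H (X *\<^sub>H qcnj y))"
          unfolding W GG unfolding Gx
          by (simp add: qmul.add_left qmul.diff_left qmul.minus_left qmul.scaleR_left qmul_assoc)
        also have "y *\<^sub>H qcnj (w x) *\<^sub>H (X *\<^sub>H qcnj y) = - (w x *\<^sub>H (qcnj y *\<^sub>H (X *\<^sub>H qcnj y)))"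
          unfolding a by (simp only: qmul.minus_left qmul_assoc)
        also have "\<dots> = - ((2 * (y \<bullet> X)) *\<^sub>R (w x *\<^sub>H qcnj y) - r *\<^sub>R (w x *\<^sub>H qcnj X))"
          unfolding b by (simp only: qmul.diff_right qmul.scaleR_right)
        finally have *: "?W X *\<^sub>H qcnj y = - (inverse r * (y \<bullet> X)) *\<^sub>R (w x *\<^sub>H qcnj y)
            - inverse r *\<^sub>R (- ((2 * (y \<bullet> X)) *\<^sub>R (w x *\<^sub>H qcnj y) - r *\<^sub>R (w x *\<^sub>H qcnj X)))" .
        have "a + (- (inverse r * q) *\<^sub>R b - inverse r *\<^sub>R (- ((2 * q) *\<^sub>R b - r *\<^sub>R a))) = (inverse r * q) *\<^sub>R b"
          for a b :: quat and q
          using r by (simp add: prod_eq_iff vec_eq_iff field_simps)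
        then show ?thesis unfolding * .
      qed
      have k2: "inverse (norm y) *\<^sub>R ((inverse r * (y \<bullet> X)) *\<^sub>R a)
          + - (inverse (norm y) * ((y \<bullet> X) / norm y) * inverse (norm y)) *\<^sub>R a = 0" for X and a :: quat
        unfolding rn by (simp add: divide_inverse ac_simps)
      show "(e has_derivative (\<lambda>X. 0)) (at x)"
        using ed unfolding k1 k2 .
    qed
    have c: "h x = h x1" "e x = e x1" if x: "x \<in> D" for x
    proof -
      have "\<forall>x\<in>D. (h has_derivative (\<lambda>X. 0)) (at x)" "\<forall>x\<in>D. (e has_derivative (\<lambda>X. 0)) (at x)"
        by (intro ballI main(1), assumption) (intro ballI main(2), assumption)
      from constant_if_derivative_zero[OF D this(1) x x1(1)] constant_if_derivative_zero[OF D this(2) x x1(1)]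
      show "h x = h x1" "e x = e x1" .
    qed
    define \<epsilon> where "\<epsilon> = e x1"
    have "fst \<epsilon> = 0"
      using main(4)[OF x1(1)] by (simp add: \<epsilon>_def e_def fst_qmul_qcnj del: fst_qmul)
    moreover have "norm \<epsilon> = 1"
    proof -
      have "norm (x1 - x0) \<noteq> 0" using x1 x0 by auto
      then show ?thesis
        by (simp add: \<epsilon>_def e_def norm_qmul main(3)[OF x1(1)] del: fst_qmul snd_qmul)
    qed
    moreover have "g x = h x1 + (\<kappa> / norm (x - x0)) *\<^sub>R snd (qcnj (x - x0) *\<^sub>H \<epsilon> *\<^sub>H (x - x0))" if x: "x \<in> D" for x
    proof -
      define y where "y = x - x0"
      have y: "norm y \<noteq> 0" using x x0 by (auto simp: y_def)
      have "\<epsilon> *\<^sub>H y = inverse (norm y) *\<^sub>R (w x *\<^sub>H (qcnj y *\<^sub>H y))"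
        unfolding \<epsilon>_def c(2)[OF x, symmetric] by (simp only: e_def y_def qmul.scaleR_left qmul_assoc)
      also have "\<dots> = norm y *\<^sub>R w x"
        using y by (simp add: qcnj_mult_self qmul.scaleR_right power2_norm_eq_inner[symmetric] power2_eq_square)
      finally have "qcnj y *\<^sub>H \<epsilon> *\<^sub>H y = norm y *\<^sub>R (qcnj y *\<^sub>H w x)"
        by (simp only: qmul_assoc qmul.scaleR_right)
      moreover have "snd (qcnj y *\<^sub>H w x) = - snd (qcnj (w x) *\<^sub>H y)"
        by (simp add: vec_eq_iff forall_3 cross_components)
      ultimately have "(\<kappa> / norm y) *\<^sub>R snd (qcnj y *\<^sub>H \<epsilon> *\<^sub>H y) = - \<kappa> *\<^sub>R snd (qcnj (w x) *\<^sub>H y)"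
        using y by (simp del: snd_qmul)
      then show ?thesis
        unfolding y_def[symmetric] c(1)[OF x, symmetric] by (simp add: h_def y_def del: snd_qmul)
    qed
    ultimately show ?thesis
      using l x0 by blast
  qed
qed

section \<open>The singular and the conformal case\<close>

lemma sum_Basis_quat:
  fixes F :: "quat \<Rightarrow> 'a::comm_monoid_add"
  shows "(\<Sum>b\<in>Basis. F b) = F one_H + F (0, axis 1 1) + F (0, axis 2 1) + F (0, axis 3 1)"
proof -
  have "(Basis :: (real^3) set) = {axis 1 1, axis 2 1, axis 3 1}"
    by (auto simp: Basis_vec_def UNIV_3)
  then have B: "(Basis :: quat set) = {one_H, (0, axis 1 1), (0, axis 2 1), (0, axis 3 1)}"
    by (auto simp: Basis_prod_def one_H_def)
  have "axis 1 1 \<noteq> (axis 2 1 :: real^3)" "axis 1 1 \<noteq> (axis 3 1 :: real^3)" "axis 2 1 \<noteq> (axis 3 1 :: real^3)"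
    by (simp_all add: axis_eq_axis)
  then show ?thesis
    unfolding B by (simp add: one_H_def add.assoc)
qed

text \<open>The operator \<open>\<Sum>b. b (\<partial>\<^sub>b g)\<close> followed by its conjugate is the Laplacian.\<close>

lemma laplacian_eq_0_pointwise:
  fixes H :: "quat \<Rightarrow> quat \<Rightarrow> real^3"
  assumes sym: "\<And>u v. H u v = H v u"
    and zero: "\<And>v. (\<Sum>b\<in>Basis. b *\<^sub>H (0, H b v)) = 0"
  shows "(\<Sum>b\<in>Basis. H b b) = 0"
proof -
  define e1 e2 e3 :: quat where "e1 = (0, axis 1 1)" and "e2 = (0, axis 2 1)" and "e3 = (0, axis 3 1)"
  have E: "fst e1 = 0" "snd e1 $ 1 = 1" "snd e1 $ 2 = 0" "snd e1 $ 3 = 0"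
    "fst e2 = 0" "snd e2 $ 1 = 0" "snd e2 $ 2 = 1" "snd e2 $ 3 = 0"
    "fst e3 = 0" "snd e3 $ 1 = 0" "snd e3 $ 2 = 0" "snd e3 $ 3 = 1"
    by (simp_all add: e1_def e2_def e3_def axis_def)
  note S = E quat_coords vec_eq_iff[where 'a = real and 'b = 3] forall_3
  note z = zero[unfolded sum_Basis_quat, folded e1_def e2_def e3_def]
  note zs = z[of one_H] z[of e1] z[of e2] z[of e3]
  have s: "H e1 one_H = H one_H e1" "H e2 one_H = H one_H e2" "H e3 one_H = H one_H e3"
    "H e2 e1 = H e1 e2" "H e3 e1 = H e1 e3" "H e3 e2 = H e2 e3"
    by (rule sym)+
  show ?thesis
    using zs unfolding sum_Basis_quat e1_def[symmetric] e2_def[symmetric] e3_def[symmetric]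
    by (simp add: S s)
qed

text \<open>Differentiating the constant energy twice along each basis vector and summing gives the
  squared norm of the second derivative plus the pairing of the first derivatives with their
  Laplacians. The Laplacian commutes with partial derivatives, so this pairing vanishes for the
  harmonic \<open>g\<close>.\<close>

lemma fueter_regular_constant_energy:
  fixes g :: "quat \<Rightarrow> real^3"
  assumes D: "open D" and g: "smooth_on D g"
    and fueter: "\<And>x. x \<in> D \<Longrightarrow> (\<Sum>b\<in>Basis. b *\<^sub>H (0, frechet_derivative g (at x) b)) = 0"
    and energy: "\<And>x. x \<in> D \<Longrightarrow>
      (\<Sum>b\<in>Basis. frechet_derivative g (at x) b \<bullet> frechet_derivative g (at x) b) = E"
    and x: "x \<in> D"
  shows "frechet_derivative (\<lambda>y. frechet_derivative g (at y) v) (at x) u = 0"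
proof -
  define d where "d v f = (\<lambda>x. frechet_derivative f (at x) v)" for v :: quat and f :: "quat \<Rightarrow> real^3"
  have sm: "smooth_on D (d v f)" if "smooth_on D f" for v f
    unfolding d_def using that by (rule smooth_on_frechet_derivative)
  have der: "(f has_derivative (\<lambda>v. d v f y)) (at y)" if "smooth_on D f" "y \<in> D" for f y
    unfolding d_def using smooth_on_has_derivative[OF that] by simp
  have sym: "d u (d v f) y = d v (d u f) y" if "smooth_on D f" "y \<in> D" for u v f y
    unfolding d_def using smooth_on_second_derivative_symmetric[OF D that, of v u] .
  have lap: "(\<Sum>b\<in>Basis. d b (d b g) y) = 0" if y: "y \<in> D" for y
  proof (rule laplacian_eq_0_pointwise[where H = "\<lambda>u v. d u (d v g) y"])
    show "d u (d v g) y = d v (d u g) y" for u v by (rule sym[OF g y])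
    show "(\<Sum>b\<in>Basis. b *\<^sub>H (0, d b (d v g) y)) = 0" for v
    proof -
      have "((\<lambda>y. \<Sum>b\<in>Basis. b *\<^sub>H (0, d b g y)) has_derivative
          (\<lambda>v. \<Sum>b\<in>Basis. b *\<^sub>H (0, d v (d b g) y))) (at y)"
        by (intro has_derivative_sum bounded_linear.has_derivative[OF qmul.bounded_linear_right]
            has_derivative_Pair has_derivative_const der sm g y)
      from has_derivative_eq_0_if_constant[OF D y _ this, of 0 v] fueter
      have "(\<Sum>b\<in>Basis. b *\<^sub>H (0, d v (d b g) y)) = 0"
        by (simp add: d_def)
      then show ?thesis by (simp only: sym[OF g y, of _ v])
    qed
  qed
  have e1: "(\<Sum>b\<in>Basis. d b g y \<bullet> d v (d b g) y) = 0" if y: "y \<in> D" for v y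
  proof -
    have "((\<lambda>y. \<Sum>b\<in>Basis. d b g y \<bullet> d b g y) has_derivative
        (\<lambda>v. \<Sum>b\<in>Basis. d b g y \<bullet> d v (d b g) y + d v (d b g) y \<bullet> d b g y)) (at y)"
      by (intro has_derivative_sum has_derivative_inner der sm g y)
    from has_derivative_eq_0_if_constant[OF D y _ this, of E v] energy
    have "(\<Sum>b\<in>Basis. d b g y \<bullet> d v (d b g) y + d v (d b g) y \<bullet> d b g y) = 0"
      by (simp add: d_def)
    then have "2 * (\<Sum>b\<in>Basis. d b g y \<bullet> d v (d b g) y) = 0"
      unfolding inner_commute[of "d v (d _ g) y"] by (simp add: sum_distrib_left)
    then show ?thesis by simp
  qed
  have e2: "(\<Sum>b\<in>Basis. d b g x \<bullet> d v (d v (d b g)) x + d v (d b g) x \<bullet> d v (d b g) x) = 0" for v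
  proof -
    have "((\<lambda>y. \<Sum>b\<in>Basis. d b g y \<bullet> d v (d b g) y) has_derivative
        (\<lambda>u. \<Sum>b\<in>Basis. d b g x \<bullet> d u (d v (d b g)) x + d u (d b g) x \<bullet> d v (d b g) x)) (at x)"
      by (intro has_derivative_sum has_derivative_inner der sm g x)
    from has_derivative_eq_0_if_constant[OF D x e1 this, of v]
    show ?thesis .
  qed
  have third: "(\<Sum>v\<in>Basis. d v (d v (d b g)) x) = 0" for b
  proof -
    have "d v (d v (d b g)) x = d b (d v (d v g)) x" for v
    proof -
      have "d v (d v (d b g)) x = d v (d b (d v g)) x"
      proof -
        have "frechet_derivative (d v (d b g)) (at x) = frechet_derivative (d b (d v g)) (at x)"
          by (rule frechet_derivative_cong_open[OF D x sym[OF g]])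
        then show ?thesis unfolding d_def[of _ "d v (d b g)"] d_def[of _ "d b (d v g)"] by simp
      qed
      also have "\<dots> = d b (d v (d v g)) x"
        by (rule sym[OF sm[OF g] x])
      finally show ?thesis .
    qed
    moreover have "((\<lambda>y. \<Sum>v\<in>Basis. d v (d v g) y) has_derivative (\<lambda>b. \<Sum>v\<in>Basis. d b (d v (d v g)) x)) (at x)"
      by (intro has_derivative_sum der sm g x)
    from has_derivative_eq_0_if_constant[OF D x lap this, of b]
    have "(\<Sum>v\<in>Basis. d b (d v (d v g)) x) = 0" .
    ultimately show ?thesis by simp
  qed
  have "(\<Sum>v\<in>Basis. \<Sum>b\<in>Basis. d b g x \<bullet> d v (d v (d b g)) x) = (\<Sum>b\<in>Basis. d b g x \<bullet> (\<Sum>v\<in>Basis. d v (d v (d b g)) x))"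
    unfolding inner_sum_right by (rule sum.swap)
  also have "\<dots> = 0" by (simp add: third)
  finally have "(\<Sum>v\<in>Basis. \<Sum>b\<in>Basis. d v (d b g) x \<bullet> d v (d b g) x) = 0"
    using e2 by (simp add: sum.distrib add_eq_0_iff sum_negf)
  then have z: "d v (d b g) x = 0" if "v \<in> Basis" "b \<in> Basis" for v b
    using that by (simp add: sum_nonneg_eq_0_iff sum_nonneg)
  have lin: "linear (\<lambda>v. d v f x)" if "smooth_on D f" for f
    using der[OF that x] by (rule has_derivative_linear)
  have db0: "d u (d b g) x = 0" if b: "b \<in> Basis" for b u
  proof -
    have "(\<lambda>v. d v (d b g) x) = (\<lambda>v. 0)"
      by (rule linear_eq_stdbasis[OF lin[OF sm[OF g]] linear_zero z[OF _ b]])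
    then show ?thesis by (rule fun_cong)
  qed
  have "d b (d u g) x = 0" if "b \<in> Basis" for b u
    unfolding sym[OF g x, of b] by (rule db0[OF that])
  then have "(\<lambda>v. d v (d u g) x) = (\<lambda>v. 0)" for u
    by (rule linear_eq_stdbasis[OF lin[OF sm[OF g]] linear_zero])
  then have "d u (d v g) x = 0" by (rule fun_cong)
  then show ?thesis by (simp add: d_def)
qed

text \<open>The linear system of the rank-one case without its rank-one term, at
  \<open>w = 1\<close>: the six pairs of distinct basis vectors now leave no free parameter.\<close>

lemma conformal_first_order_normalised:
  fixes W :: "quat \<Rightarrow> quat"
  assumes "linear W" and W0: "\<And>u. W u \<bullet> one_H = 0"
    and sym: "\<And>u v. snd (qcnj (W u) *\<^sub>H v) = snd (qcnj (W v) *\<^sub>H u)"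
  shows "W X = 0"
proof -
  define e1 e2 e3 :: quat where "e1 = (0, axis 1 1)" and "e2 = (0, axis 2 1)" and "e3 = (0, axis 3 1)"
  have E: "fst e1 = 0" "snd e1 $ 1 = 1" "snd e1 $ 2 = 0" "snd e1 $ 3 = 0"
    "fst e2 = 0" "snd e2 $ 1 = 0" "snd e2 $ 2 = 1" "snd e2 $ 3 = 0"
    "fst e3 = 0" "snd e3 $ 1 = 0" "snd e3 $ 2 = 0" "snd e3 $ 3 = 1"
    by (simp_all add: e1_def e2_def e3_def axis_def)
  note S = E quat_coords vec_eq_iff[where 'a = real and 'b = 3] forall_3
  have fW: "fst (W u) = 0" for u
    using W0[of u] by (simp add: quat_inner)
  note q = sym[of one_H e1] sym[of one_H e2] sym[of one_H e3] sym[of e1 e2] sym[of e1 e3] sym[of e2 e3]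
  have W: "W one_H = 0" "W e1 = 0" "W e2 = 0" "W e3 = 0"
    using q by (simp_all add: S fW)
  have X: "X = fst X *\<^sub>R one_H + snd X $ 1 *\<^sub>R e1 + snd X $ 2 *\<^sub>R e2 + snd X $ 3 *\<^sub>R e3"
    by (simp add: S)
  have "W X = fst X *\<^sub>R W one_H + snd X $ 1 *\<^sub>R W e1 + snd X $ 2 *\<^sub>R W e2 + snd X $ 3 *\<^sub>R W e3"
    by (subst X) (simp add: linear_add[OF assms(1)] linear_cmul[OF assms(1)])
  then show ?thesis unfolding W by simp
qed

lemma conformal_second_derivative_eq_0:
  fixes g :: "quat \<Rightarrow> real^3"
  assumes D: "open D" and g: "smooth_on D g" and w: "smooth_on D w" "\<And>x. x \<in> D \<Longrightarrow> norm (w x) = 1"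
    and dg: "\<And>x v. x \<in> D \<Longrightarrow> frechet_derivative g (at x) v = l *\<^sub>R snd (qcnj (w x) *\<^sub>H v)"
    and l: "l \<noteq> 0" and x: "x \<in> D"
  shows "frechet_derivative (\<lambda>y. frechet_derivative g (at y) v) (at x) u = 0"
proof -
  let ?W = "frechet_derivative w (at x)"
  have dw: "(w has_derivative ?W) (at x)"
    by (rule smooth_on_has_derivative[OF w(1) x])
  have g2: "frechet_derivative (\<lambda>y. frechet_derivative g (at y) v) (at x) u = l *\<^sub>R snd (qcnj (?W u) *\<^sub>H v)" for u v
  proof -
    have "((\<lambda>x. l *\<^sub>R snd (qcnj (w x) *\<^sub>H v)) has_derivative
        (\<lambda>u. l *\<^sub>R snd (qcnj (w x) *\<^sub>H 0 + qcnj (?W u) *\<^sub>H v))) (at x)"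
      by (intro has_derivative_scaleR_right has_derivative_snd qmul.FDERIV has_derivative_const
          bounded_linear.has_derivative[OF bounded_linear_qcnj dw])
    from frechet_derivative_eqI[OF D x dg this] show ?thesis
      by (simp add: qmul.zero_right del: snd_qmul)
  qed
  have W0: "?W u \<bullet> w x = 0" for u
  proof -
    have "w y \<bullet> w y = 1" if "y \<in> D" for y
      using w(2)[OF that] by (simp add: norm_eq_1)
    from has_derivative_eq_0_if_constant[OF D x this has_derivative_inner[OF dw dw], of u]
    show ?thesis by (simp add: inner_commute)
  qed
  \<comment> \<open>An auxiliary unit vector completing the frame that
    \<open>adapted_isometry\<close> expects; any choice serves.\<close>
  obtain \<nu> where \<nu>: "\<nu> \<bullet> w x = 0" "\<nu> \<bullet> w x = 0" "norm \<nu> = 1"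
    by (rule unit_orthogonal_to_pair)
  then have w\<nu>: "w x \<bullet> \<nu> = 0" by (simp add: inner_commute)
  obtain \<Phi> \<Psi> :: "quat \<Rightarrow> quat" and A :: "real^3^3"
  where \<Phi>: "linear \<Phi>" "linear \<Psi>" "\<And>y. \<Psi> (\<Phi> y) = y" "\<And>y. \<Phi> (\<Psi> y) = y"
    and iso: "\<And>a b. \<Phi> a \<bullet> \<Phi> b = a \<bullet> b" and \<Phi>1: "\<Phi> one_H = w x"
    and "\<Phi> (0, axis 1 1) = \<nu>"
    and A: "\<And>a b. snd (qcnj (\<Phi> a) *\<^sub>H \<Phi> b) = A *v snd (qcnj a *\<^sub>H b)" "inj ((*v) A)"
    and "\<And>a b. \<Phi> (a *\<^sub>H b) = \<Phi> a *\<^sub>H (qcnj (w x) *\<^sub>H \<Phi> b)"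
    using adapted_isometry[OF w(2)[OF x] \<nu>(3) w\<nu>] by blast
  define W' where "W' u = \<Psi> (?W (\<Phi> u))" for u
  have W': "?W (\<Phi> u) = \<Phi> (W' u)" for u
    by (simp add: W'_def \<Phi>)
  have "W' (\<Psi> u) = 0" for u
  proof (rule conformal_first_order_normalised[where W = W'])
    show "linear W'"
      using linear_compose[OF linear_compose[OF \<Phi>(1) has_derivative_linear[OF dw]] \<Phi>(2)]
      by (simp add: o_def W'_def[abs_def])
    show "W' u \<bullet> one_H = 0" for u
      using W0[of "\<Phi> u"] unfolding W' \<Phi>1[symmetric] iso .
    show "snd (qcnj (W' u) *\<^sub>H v) = snd (qcnj (W' v) *\<^sub>H u)" for u v
    proof (rule injD[OF A(2)])
      have "l *\<^sub>R (A *v snd (qcnj (W' u) *\<^sub>H v)) = l *\<^sub>R (A *v snd (qcnj (W' v) *\<^sub>H u))"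
        using smooth_on_second_derivative_symmetric[OF D g x, of "\<Phi> v" "\<Phi> u"] unfolding g2 W' A(1) .
      then show "A *v snd (qcnj (W' u) *\<^sub>H v) = A *v snd (qcnj (W' v) *\<^sub>H u)"
        using l by (metis scaleR_cancel_left)
    qed
  qed
  then have "?W u = 0"
    using W'[of "\<Psi> u"] by (simp add: \<Phi> linear_0[OF \<Phi>(1)])
  then show ?thesis
    unfolding g2 by (simp add: qmul.zero_left linear_0[OF bounded_linear.linear[OF bounded_linear_qcnj]] del: snd_qmul)
qed

section \<open>Eigenvectors and Jordan angles\<close>

text \<open>A maximum point of the quadratic form on the unit sphere of \<open>V\<close> is an
  eigenvector, because the first variation vanishes in the directions of \<open>V\<close> orthogonal
  to it. The invariant subspace allows a second application on an orthogonal complement.\<close>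

lemma selfadjoint_eigenvector:
  fixes S :: "'a::euclidean_space \<Rightarrow> 'a"
  assumes S: "linear S" and adj: "\<And>x y. S x \<bullet> y = x \<bullet> S y"
    and V: "subspace V" "\<And>x. x \<in> V \<Longrightarrow> S x \<in> V" and nz: "z \<in> V" "z \<noteq> 0"
  obtains v c where "v \<in> V" "norm v = 1" "S v = c *\<^sub>R v"
proof -
  have cont: "continuous_on (V \<inter> sphere 0 1) (\<lambda>v. v \<bullet> S v)"
    using linear_continuous_on[OF S[unfolded linear_conv_bounded_linear]]
    by (intro continuous_intros)
  have "compact (V \<inter> sphere 0 1)"
    using closed_subspace[OF V(1)] by (intro closed_Int_compact) auto
  moreover have "z /\<^sub>R norm z \<in> V \<inter> sphere 0 1"
    using nz V(1) by (simp add: subspace_scale)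
  ultimately obtain v where v: "v \<in> V \<inter> sphere 0 1"
    and max: "\<And>u. u \<in> V \<inter> sphere 0 1 \<Longrightarrow> u \<bullet> S u \<le> v \<bullet> S v"
    using continuous_attains_sup[OF _ _ cont] by blast
  define c where "c = v \<bullet> S v"
  have vv: "v \<bullet> v = 1" "v \<in> V" using v by (simp_all add: norm_eq_1)
  have le: "u \<bullet> S u \<le> c * (u \<bullet> u)" if u: "u \<in> V" for u
  proof (cases "u = 0")
    case False
    have "(u /\<^sub>R norm u) \<bullet> S (u /\<^sub>R norm u) \<le> c"
      unfolding c_def using u False V(1) by (intro max) (simp add: subspace_scale)
    then have "(u \<bullet> S u) / (u \<bullet> u) \<le> c"
      by (simp add: linear_cmul[OF S] dot_square_norm power2_eq_square divide_inverse mult.assoc mult.commute mult.left_commute)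
    then show ?thesis using False by (simp add: divide_le_eq)
  qed (simp add: linear_0[OF S])
  have orth: "u \<bullet> S v = 0" if u: "u \<in> V" "u \<bullet> v = 0" for u
  proof (rule ccontr)
    define \<beta> where "\<beta> = u \<bullet> S v"
    assume "u \<bullet> S v \<noteq> 0"
    then have \<beta>: "\<beta> \<noteq> 0" by (simp add: \<beta>_def)
    define \<gamma> where "\<gamma> = c * (u \<bullet> u) - u \<bullet> S u"
    have ineq: "2 * s * \<beta> \<le> s * s * \<gamma>" for s
    proof -
      have "(v + s *\<^sub>R u) \<bullet> S (v + s *\<^sub>R u) \<le> c * ((v + s *\<^sub>R u) \<bullet> (v + s *\<^sub>R u))"
        using u vv V(1) by (intro le) (simp add: subspace_add subspace_scale)
      moreover have "v \<bullet> S u = u \<bullet> S v" using adj[of v u] by (simp add: inner_commute)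
      ultimately show ?thesis
        using u(2) vv(1)
        by (simp add: linear_add[OF S] linear_cmul[OF S] inner_add_left inner_add_right c_def[symmetric]
            \<beta>_def[symmetric] \<gamma>_def inner_commute[of v u] algebra_simps)
    qed
    \<comment> \<open>Small enough for the linear term to outweigh the quadratic one; the summand 1
      keeps the denominator positive when \<open>\<gamma>\<close> is 0.\<close>
    define s where "s = \<beta> / (\<bar>\<gamma>\<bar> + 1)"
    have "2 * s * \<beta> \<le> s * s * \<gamma>" by (rule ineq)
    also have "\<dots> \<le> s * s * (\<bar>\<gamma>\<bar> + 1)" by (intro mult_left_mono) auto
    also have "\<dots> = s * \<beta>" by (simp add: s_def)
    finally have "s * \<beta> \<le> 0" by (simp add: mult.commute)
    moreover have "s * \<beta> > 0"
      using \<beta> by (simp add: s_def zero_less_divide_iff flip: power2_eq_square)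
    ultimately show False by simp
  qed
  \<comment> \<open>The component of \<open>S v\<close> orthogonal to \<open>v\<close>: an
    admissible direction, whose pairing with \<open>S v\<close> is its own squared norm.\<close>
  define u where "u = S v - c *\<^sub>R v"
  have u: "u \<in> V" "u \<bullet> v = 0"
    using V vv by (auto simp: u_def subspace_diff subspace_scale inner_diff_left inner_diff_right c_def inner_commute)
  have "u \<bullet> u = u \<bullet> S v - c * (u \<bullet> v)"
    by (simp add: u_def inner_diff_right inner_diff_left)
  then have "u = 0" using orth[OF u] u(2) by simp
  then show ?thesis
    using v by (intro that[of v c]) (auto simp: u_def)
qed

definition orthonormal3 :: "real^3 \<Rightarrow> real^3 \<Rightarrow> real^3 \<Rightarrow> bool" where
  "orthonormal3 a b c \<longleftrightarrow> a \<bullet> a = 1 \<and> b \<bullet> b = 1 \<and> c \<bullet> c = 1 \<and> a \<bullet> b = 0 \<and> a \<bullet> c = 0 \<and> b \<bullet> c = 0"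

lemma orthonormal3D:
  assumes "orthonormal3 a b c"
  shows "a \<bullet> a = 1" "b \<bullet> b = 1" "c \<bullet> c = 1" "a \<bullet> b = 0" "a \<bullet> c = 0" "b \<bullet> c = 0"
    "b \<bullet> a = 0" "c \<bullet> a = 0" "c \<bullet> b = 0"
  using assms by (simp_all add: orthonormal3_def inner_commute)

lemma orthonormal3_expand:
  assumes "orthonormal3 a b c"
  shows "x = (x \<bullet> a) *\<^sub>R a + (x \<bullet> b) *\<^sub>R b + (x \<bullet> c) *\<^sub>R c"
proof -
  note o = orthonormal3D[OF assms]
  have "pairwise orthogonal {a, b, c}"
    using o by (auto simp: pairwise_def orthogonal_def)
  moreover have "0 \<notin> {a, b, c}" using o by auto
  ultimately have "independent {a, b, c}"
    by (rule pairwise_orthogonal_independent)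
  moreover have "card {a, b, c} = 3"
  proof -
    have "a \<noteq> b" "a \<noteq> c" "b \<noteq> c" using o by auto
    then show ?thesis by simp
  qed
  ultimately have span: "span {a, b, c} = UNIV"
    using card_ge_dim_independent[of "{a, b, c}" UNIV] by auto
  define z where "z = x - ((x \<bullet> a) *\<^sub>R a + (x \<bullet> b) *\<^sub>R b + (x \<bullet> c) *\<^sub>R c)"
  have "orthogonal z y" if "y \<in> {a, b, c}" for y
    using that o by (auto simp: z_def orthogonal_def inner_diff_left inner_add_left)
  then have "orthogonal z z"
    using orthogonal_to_span[of z "{a, b, c}" z] span by simp
  then show ?thesis by (simp add: z_def orthogonal_self)
qed

text \<open>The second eigenvector is found in the invariant complement of the first, and the third
  direction is then forced. It is written as a cross product so that the associativity relation can
  be evaluated on the eigenbasis.\<close>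

lemma selfadjoint_orthonormal3:
  fixes S :: "real^3 \<Rightarrow> real^3"
  assumes S: "linear S" and adj: "\<And>x y. S x \<bullet> y = x \<bullet> S y"
  obtains a b r s t where "orthonormal3 a b (cross3 a b)" "S a = r *\<^sub>R a" "S b = s *\<^sub>R b"
    "S (cross3 a b) = t *\<^sub>R cross3 a b"
proof -
  obtain a r where a: "norm a = 1" "S a = r *\<^sub>R a"
    using selfadjoint_eigenvector[OF S adj subspace_UNIV, of "axis 1 1"] by (auto simp: axis_eq_0_iff)
  let ?V = "{x. a \<bullet> x = 0}"
  have V: "subspace ?V" by (rule subspace_hyperplane)
  have inv: "S x \<in> ?V" if "x \<in> ?V" for x
    using that adj[of a x] a(2) by simp
  obtain z where z: "z \<noteq> 0" "orthogonal a z"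
    using orthogonal_to_vector_exists[of a] by auto
  obtain b s where b: "b \<in> ?V" "norm b = 1" "S b = s *\<^sub>R b"
    using selfadjoint_eigenvector[OF S adj V inv, of z] z by (auto simp: orthogonal_def)
  let ?c = "cross3 a b"
  have ab: "a \<bullet> b = 0" using b by simp
  have "norm ?c = 1"
  proof -
    have "(norm ?c)\<^sup>2 = 1"
      using norm_cross_dot[of a b] ab a b by simp
    then show ?thesis by (simp add: power2_eq_1_iff) (metis norm_ge_zero not_one_le_zero neg_0_le_iff_le)
  qed
  then have o: "orthonormal3 a b ?c"
    using a b ab by (simp add: orthonormal3_def norm_eq_1 dot_cross_self)
  have "S ?c \<bullet> a = 0" "S ?c \<bullet> b = 0"
    using adj[of ?c a] adj[of ?c b] a(2) b(3) orthonormal3D[OF o] by simp_all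
  then have "S ?c = (S ?c \<bullet> ?c) *\<^sub>R ?c"
    using orthonormal3_expand[OF o, of "S ?c"] by simp
  then show ?thesis using that[OF o a(2) b(3)] by blast
qed

section \<open>Jordan angles of the graph of a linear map\<close>

lemma orthogonal_comp_iff: "x \<in> P\<^sup>\<bottom> \<longleftrightarrow> (\<forall>y\<in>P. y \<bullet> x = 0)"
  by (auto simp: orthogonal_comp_def orthogonal_def)

text \<open>Existence and uniqueness of the orthogonal decomposition make the definite description
  in \<open>orth_proj\<close> usable.\<close>

lemma orth_proj_eq_iff:
  fixes P :: "'a::euclidean_space set"
  assumes P: "subspace P" and y: "y \<in> P"
  shows "orth_proj P x = y \<longleftrightarrow> x - y \<in> P\<^sup>\<bottom>"
proof -
  have uniq: "a = b" if "a \<in> P" "x - a \<in> P\<^sup>\<bottom>" "b \<in> P" "x - b \<in> P\<^sup>\<bottom>" for a b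
  proof -
    have "a - b \<in> P" using P that by (simp add: subspace_diff)
    then have "(a - b) \<bullet> (x - b) = 0" "(a - b) \<bullet> (x - a) = 0"
      using that by (simp_all add: orthogonal_comp_iff)
    then have "(a - b) \<bullet> (a - b) = 0" by (simp add: inner_diff_right)
    then show ?thesis by simp
  qed
  obtain a b where ab: "a \<in> span P" "\<And>w. w \<in> span P \<Longrightarrow> orthogonal b w" "x = a + b"
    using orthogonal_subspace_decomp_exists[of P x] by blast
  then have a: "a \<in> P" "x - a \<in> P\<^sup>\<bottom>"
    using P by (auto simp: span_eq_iff[THEN iffD2] orthogonal_comp_iff orthogonal_def inner_commute)
  have "orth_proj P x = a"
    unfolding orth_proj_def
  proof (rule the_equality)
    show "a \<in> P \<and> x - a \<in> P\<^sup>\<bottom>" using a by blast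
    show "b = a" if "b \<in> P \<and> x - b \<in> P\<^sup>\<bottom>" for b
      using uniq[of b a] a that by blast
  qed
  then show ?thesis using a y uniq[of a y] by auto
qed

text \<open>The equation says that the tangent of \<open>\<theta>\<close> is the absolute value of
  \<open>\<sigma>\<close>; cleared of denominators it also makes sense, and fails, at
  \<open>pi / 2\<close>.\<close>

lemma arctan_abs_iff:
  assumes "0 \<le> \<theta>" "\<theta> \<le> pi / 2"
  shows "1 - (cos \<theta>)\<^sup>2 = (cos \<theta>)\<^sup>2 * \<sigma>\<^sup>2 \<longleftrightarrow> \<theta> = arctan \<bar>\<sigma>\<bar>"
proof -
  have pos: "1 + \<sigma>\<^sup>2 > 0"
    by (rule add_pos_nonneg) auto
  have "1 - a = a * b \<longleftrightarrow> a = 1 / (1 + b)" if "1 + b > 0" for a b :: real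
    using that by (auto simp: field_simps)
  from this[OF pos] have "1 - (cos \<theta>)\<^sup>2 = (cos \<theta>)\<^sup>2 * \<sigma>\<^sup>2 \<longleftrightarrow> (cos \<theta>)\<^sup>2 = 1 / (1 + \<sigma>\<^sup>2)" .
  also have "1 / (1 + \<sigma>\<^sup>2) = (cos (arctan \<bar>\<sigma>\<bar>))\<^sup>2"
    using pos by (simp add: cos_arctan power_divide)
  also have "(cos \<theta>)\<^sup>2 = (cos (arctan \<bar>\<sigma>\<bar>))\<^sup>2 \<longleftrightarrow> \<theta> = arctan \<bar>\<sigma>\<bar>"
  proof
    have r: "0 \<le> arctan \<bar>\<sigma>\<bar>" "arctan \<bar>\<sigma>\<bar> \<le> pi / 2" "- (pi / 2) \<le> arctan \<bar>\<sigma>\<bar>" "- (pi / 2) \<le> \<theta>"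
      "\<theta> \<le> pi" "arctan \<bar>\<sigma>\<bar> \<le> pi"
      using arctan_ubound[of "\<bar>\<sigma>\<bar>"] zero_le_arctan_iff[of "\<bar>\<sigma>\<bar>"] pi_gt_zero assms by linarith+
    assume "(cos \<theta>)\<^sup>2 = (cos (arctan \<bar>\<sigma>\<bar>))\<^sup>2"
    then have "cos \<theta> = cos (arctan \<bar>\<sigma>\<bar>)"
      by (rule power2_eq_imp_eq) (rule cos_ge_zero; (rule r assms))+
    then show "\<theta> = arctan \<bar>\<sigma>\<bar>"
      by (rule cos_inj_pi[OF assms(1) r(5) r(1) r(6)])
  qed simp
  finally show ?thesis .
qed

text \<open>For \<open>A\<close> the adjoint of \<open>J\<close> this parametrises the normal space
  of the graph of \<open>J\<close>: orthogonality of a pair \<open>(a, b)\<close> to all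
  \<open>(J v, v)\<close> means \<open>b = - A a\<close>.\<close>

definition normal_graph :: "(real^3 \<Rightarrow> quat) \<Rightarrow> real^3 \<Rightarrow> oct" where
  "normal_graph A a = ((0, a), - A a)"

text \<open>\<open>gram\<close> diagonalises the quadratic form of \<open>A\<close>. The angles see
  \<open>s1\<close>, \<open>s2\<close>, \<open>s3\<close> only up to sign; the signs are kept for
  the relation between trace and determinant.\<close>

locale diagonal_normal_graph =
  fixes A :: "real^3 \<Rightarrow> quat" and e1 e2 e3 :: "real^3" and s1 s2 s3 :: real
  assumes linear_A: "linear A" and frame: "orthonormal3 e1 e2 e3"
    and gram: "\<And>a c. A a \<bullet> A c = s1\<^sup>2 * (a \<bullet> e1) * (c \<bullet> e1) + s2\<^sup>2 * (a \<bullet> e2) * (c \<bullet> e2) + s3\<^sup>2 * (a \<bullet> e3) * (c \<bullet> e3)"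
begin

lemma linear_normal_graph: "linear (normal_graph A)"
  by (rule linearI) (simp_all add: normal_graph_def linear_add[OF linear_A] linear_cmul[OF linear_A])

lemma inner_normal_graph: "normal_graph A a \<bullet> normal_graph A c = a \<bullet> c + A a \<bullet> A c"
  by (simp add: normal_graph_def inner_prod_def[of "(_, _)" "(_, _)"])

text \<open>Projection to Im H keeps the component \<open>a\<close> of a normal vector. Testing the
  eigenvalue equation against every normal vector compares \<open>a \<bullet> c\<close> with
  \<open>A a \<bullet> A c\<close>, and this decouples in the frame.\<close>

lemma eigenspace: "jordan_eigenspace (range (normal_graph A)) Im_H_in_O \<theta> =
    normal_graph A ` {a. (1 - (cos \<theta>)\<^sup>2) * (a \<bullet> e1) = (cos \<theta>)\<^sup>2 * s1\<^sup>2 * (a \<bullet> e1) \<and>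
      (1 - (cos \<theta>)\<^sup>2) * (a \<bullet> e2) = (cos \<theta>)\<^sup>2 * s2\<^sup>2 * (a \<bullet> e2) \<and>
      (1 - (cos \<theta>)\<^sup>2) * (a \<bullet> e3) = (cos \<theta>)\<^sup>2 * s3\<^sup>2 * (a \<bullet> e3)}"
proof -
  define k where "k = (cos \<theta>)\<^sup>2"
  note o = orthonormal3D[OF frame]
  have subN: "subspace (range (normal_graph A))"
    using linear_normal_graph by (simp add: linear_subspace_image)
  have subQ: "subspace Im_H_in_O"
    by (auto simp: subspace_def Im_H_in_O_def Im_H_def zero_prod_def)
  have 1: "orth_proj Im_H_in_O (normal_graph A a) = ((0, a), 0)" for a
    by (subst orth_proj_eq_iff[OF subQ])
      (auto simp: Im_H_in_O_def Im_H_def orthogonal_comp_iff normal_graph_def inner_prod_def)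
  have 2: "orth_proj (range (normal_graph A)) ((0, a), 0) = k *\<^sub>R normal_graph A a \<longleftrightarrow>
      (\<forall>c. (1 - k) * (a \<bullet> c) = k * (A a \<bullet> A c))" for a
  proof -
    have "k *\<^sub>R normal_graph A a \<in> range (normal_graph A)"
      using subN by (intro subspace_scale) auto
    then have "orth_proj (range (normal_graph A)) ((0, a), 0) = k *\<^sub>R normal_graph A a \<longleftrightarrow>
        (\<forall>c. normal_graph A c \<bullet> (((0, a), 0) - k *\<^sub>R normal_graph A a) = 0)"
      by (subst orth_proj_eq_iff[OF subN]) (auto simp: orthogonal_comp_iff)
    moreover have "normal_graph A c \<bullet> ((0, a), 0) = a \<bullet> c" for c
      by (simp add: normal_graph_def inner_prod_def inner_commute)
    ultimately show ?thesis
      by (simp add: inner_diff_right inner_normal_graph algebra_simps inner_commute)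
  qed
  have 3: "(\<forall>c. (1 - k) * (a \<bullet> c) = k * (A a \<bullet> A c)) \<longleftrightarrow>
     (1 - k) * (a \<bullet> e1) = k * s1\<^sup>2 * (a \<bullet> e1) \<and> (1 - k) * (a \<bullet> e2) = k * s2\<^sup>2 * (a \<bullet> e2) \<and>
     (1 - k) * (a \<bullet> e3) = k * s3\<^sup>2 * (a \<bullet> e3)" (is "?l \<longleftrightarrow> ?r") for a
  proof
    assume ?l
    from this[rule_format, of e1] this[rule_format, of e2] this[rule_format, of e3] show ?r
      by (simp add: gram o)
  next
    assume r: ?r
    show ?l
    proof
      fix c
      have "a \<bullet> c = (a \<bullet> e1) * (c \<bullet> e1) + (a \<bullet> e2) * (c \<bullet> e2) + (a \<bullet> e3) * (c \<bullet> e3)"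
        by (subst orthonormal3_expand[OF frame, of c]) (simp add: inner_add_right)
      then have "(1 - k) * (a \<bullet> c) = ((1 - k) * (a \<bullet> e1)) * (c \<bullet> e1) + ((1 - k) * (a \<bullet> e2)) * (c \<bullet> e2)
          + ((1 - k) * (a \<bullet> e3)) * (c \<bullet> e3)"
        by (simp add: algebra_simps)
      also have "\<dots> = (k * s1\<^sup>2 * (a \<bullet> e1)) * (c \<bullet> e1) + (k * s2\<^sup>2 * (a \<bullet> e2)) * (c \<bullet> e2)
          + (k * s3\<^sup>2 * (a \<bullet> e3)) * (c \<bullet> e3)"
        using r by (simp only:)
      also have "\<dots> = k * (A a \<bullet> A c)"
        by (simp add: gram algebra_simps)
      finally show "(1 - k) * (a \<bullet> c) = k * (A a \<bullet> A c)" .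
    qed
  qed
  show ?thesis
    unfolding jordan_eigenspace_def k_def[symmetric]
    using 1 2 3 by auto
qed

lemma angles: "jordan_angles (range (normal_graph A)) Im_H_in_O = {arctan \<bar>s1\<bar>, arctan \<bar>s2\<bar>, arctan \<bar>s3\<bar>}"
proof -
  note o = orthonormal3D[OF frame]
  have nz: "normal_graph A a = 0 \<longleftrightarrow> a = 0" for a
    by (auto simp: normal_graph_def zero_prod_def linear_0[OF linear_A])
  have range: "0 \<le> arctan \<bar>s\<bar>" "arctan \<bar>s\<bar> \<le> pi / 2" for s
    using arctan_ubound[of "\<bar>s\<bar>"] by (simp_all add: zero_le_arctan_iff)
  have self: "1 - (cos (arctan \<bar>s\<bar>))\<^sup>2 = (cos (arctan \<bar>s\<bar>))\<^sup>2 * s\<^sup>2" for s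
    using arctan_abs_iff[OF range, of s s] by simp
  show ?thesis
  proof (intro equalityI subsetI)
    fix \<theta> assume "\<theta> \<in> jordan_angles (range (normal_graph A)) Im_H_in_O"
    then obtain a where \<theta>: "0 \<le> \<theta>" "\<theta> \<le> pi / 2" and a: "a \<noteq> 0"
      "(1 - (cos \<theta>)\<^sup>2) * (a \<bullet> e1) = (cos \<theta>)\<^sup>2 * s1\<^sup>2 * (a \<bullet> e1)"
      "(1 - (cos \<theta>)\<^sup>2) * (a \<bullet> e2) = (cos \<theta>)\<^sup>2 * s2\<^sup>2 * (a \<bullet> e2)"
      "(1 - (cos \<theta>)\<^sup>2) * (a \<bullet> e3) = (cos \<theta>)\<^sup>2 * s3\<^sup>2 * (a \<bullet> e3)"
      unfolding jordan_angles_def eigenspace by (auto simp: nz)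
    have "a \<bullet> e1 \<noteq> 0 \<or> a \<bullet> e2 \<noteq> 0 \<or> a \<bullet> e3 \<noteq> 0"
      using orthonormal3_expand[OF frame, of a] a(1) by auto
    then show "\<theta> \<in> {arctan \<bar>s1\<bar>, arctan \<bar>s2\<bar>, arctan \<bar>s3\<bar>}"
      using a(2-) arctan_abs_iff[OF \<theta>] by (auto simp only: mult_cancel_right insert_iff)
  next
    fix \<theta> assume "\<theta> \<in> {arctan \<bar>s1\<bar>, arctan \<bar>s2\<bar>, arctan \<bar>s3\<bar>}"
    then obtain e where e: "e \<noteq> 0" "normal_graph A e \<in> jordan_eigenspace (range (normal_graph A)) Im_H_in_O \<theta>"
    proof (elim insertE emptyE)
      assume "\<theta> = arctan \<bar>s1\<bar>" then show thesis
        using that[of e1] o self[of s1] unfolding eigenspace by fastforce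
    next
      assume "\<theta> = arctan \<bar>s2\<bar>" then show thesis
        using that[of e2] o self[of s2] unfolding eigenspace by fastforce
    next
      assume "\<theta> = arctan \<bar>s3\<bar>" then show thesis
        using that[of e3] o self[of s3] unfolding eigenspace by fastforce
    qed
    moreover have "0 \<le> \<theta>" "\<theta> \<le> pi / 2"
      using \<open>\<theta> \<in> _\<close> range by auto
    ultimately show "\<theta> \<in> jordan_angles (range (normal_graph A)) Im_H_in_O"
      unfolding jordan_angles_def using nz by blast
  qed
qed

text \<open>Together with \<open>mult_le_1\<close> this separates the double eigenvalue from the
  simple one by multiplicity.\<close>

lemma mult_ge_2:
  assumes "\<bar>s1\<bar> = \<bar>s2\<bar>"
  shows "jordan_mult (range (normal_graph A)) Im_H_in_O (arctan \<bar>s1\<bar>) \<ge> 2"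
proof -
  note o = orthonormal3D[OF frame]
  let ?E = "jordan_eigenspace (range (normal_graph A)) Im_H_in_O (arctan \<bar>s1\<bar>)"
  have self: "1 - (cos (arctan \<bar>s1\<bar>))\<^sup>2 = (cos (arctan \<bar>s1\<bar>))\<^sup>2 * s1\<^sup>2"
    using arctan_abs_iff[of "arctan \<bar>s1\<bar>" s1] arctan_ubound[of "\<bar>s1\<bar>"] by (simp add: zero_le_arctan_iff)
  have ss: "s2\<^sup>2 = s1\<^sup>2" using assms by (metis power2_abs)
  have ng: "normal_graph A e1 \<bullet> normal_graph A e2 = 0" "normal_graph A e2 \<bullet> normal_graph A e1 = 0"
    by (simp_all add: inner_normal_graph gram o)
  have nz: "normal_graph A e1 \<noteq> 0" "normal_graph A e2 \<noteq> 0"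
    using o by (auto simp: normal_graph_def zero_prod_def)
  then have ne: "normal_graph A e1 \<noteq> normal_graph A e2"
    using ng by auto
  have "independent {normal_graph A e1, normal_graph A e2}"
    using ng nz by (intro pairwise_orthogonal_independent) (auto simp: pairwise_def orthogonal_def)
  moreover have "{normal_graph A e1, normal_graph A e2} \<subseteq> ?E"
    unfolding eigenspace using o self ss by auto
  ultimately have "card {normal_graph A e1, normal_graph A e2} \<le> dim ?E"
    using independent_card_le_dim by blast
  then show ?thesis using ne by (simp add: jordan_mult_def)
qed

lemma mult_le_1:
  assumes "\<bar>s1\<bar> = \<bar>s2\<bar>" "\<bar>s3\<bar> \<noteq> \<bar>s1\<bar>"
  shows "jordan_mult (range (normal_graph A)) Im_H_in_O (arctan \<bar>s3\<bar>) \<le> 1"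
proof -
  let ?E = "jordan_eigenspace (range (normal_graph A)) Im_H_in_O (arctan \<bar>s3\<bar>)"
  have "1 - (cos (arctan \<bar>s3\<bar>))\<^sup>2 \<noteq> (cos (arctan \<bar>s3\<bar>))\<^sup>2 * s\<^sup>2" if "\<bar>s\<bar> \<noteq> \<bar>s3\<bar>" for s
    using arctan_abs_iff[of "arctan \<bar>s3\<bar>" s] arctan_ubound[of "\<bar>s3\<bar>"] that
    by (simp add: zero_le_arctan_iff arctan_eq_iff)
  from this[of s1] this[of s2] have n: "1 - (cos (arctan \<bar>s3\<bar>))\<^sup>2 \<noteq> (cos (arctan \<bar>s3\<bar>))\<^sup>2 * s1\<^sup>2"
      "1 - (cos (arctan \<bar>s3\<bar>))\<^sup>2 \<noteq> (cos (arctan \<bar>s3\<bar>))\<^sup>2 * s2\<^sup>2"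
    using assms by auto
  have "?E \<subseteq> span {normal_graph A e3}"
  proof
    fix v assume "v \<in> ?E"
    then obtain a where v: "v = normal_graph A a" and a: "a \<bullet> e1 = 0" "a \<bullet> e2 = 0"
      unfolding eigenspace using n by auto
    then have "a = (a \<bullet> e3) *\<^sub>R e3"
      using orthonormal3_expand[OF frame, of a] by simp
    then have "v = (a \<bullet> e3) *\<^sub>R normal_graph A e3"
      unfolding v by (metis linear_cmul[OF linear_normal_graph])
    then show "v \<in> span {normal_graph A e3}"
      by (auto simp: span_singleton)
  qed
  then have "dim ?E \<le> card {normal_graph A e3}"
    by (intro dim_le_card) auto
  then show ?thesis by (simp add: jordan_mult_def)
qed

end

section \<open>Associative normal spaces of a graph\<close>

text \<open>The octonion product of two normal vectors is a real number plus a normal vector;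
  comparing components gives \<open>closed\<close>. The range of \<open>A\<close> has dimension at
  most three, so some unit \<open>w\<close> is orthogonal to it. After multiplication of
  \<open>closed\<close> by the conjugate of \<open>w\<close>, the real part is the symmetry of
  \<open>S\<close> and the imaginary part is the cross product relation.\<close>

lemma associative_normal_graph:
  assumes A: "linear A" and assoc: "associative (range (normal_graph A))"
  obtains w S where "norm w = 1" "linear S" "\<And>a b. S a \<bullet> b = a \<bullet> S b" "\<And>a. A a = w *\<^sub>H (0, S a)"
    "\<And>a b. S (cross3 (S a) (S b)) = S (cross3 a b) + cross3 (S a) b + cross3 a (S b)"
proof -
  have closed: "A (cross3 a b - snd (qcnj (A b) *\<^sub>H A a)) = A b *\<^sub>H (0, a) - A a *\<^sub>H (0, b)" for a b
  proof -
    let ?A = "{r *\<^sub>R one_O + p | r p. p \<in> range (normal_graph A)}"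
    have "\<forall>x\<in>?A. \<forall>y\<in>?A. x *\<^sub>O y \<in> ?A"
      using assoc unfolding associative_def Let_def by (elim conjE)
    moreover have "normal_graph A c \<in> ?A" for c
      by (intro CollectI exI[of _ 0] exI[of _ "normal_graph A c"]) simp
    ultimately have "normal_graph A a *\<^sub>O normal_graph A b \<in> ?A"
      by blast
    then obtain r c where "normal_graph A a *\<^sub>O normal_graph A b = r *\<^sub>R one_O + normal_graph A c"
      by blast
    then have "(0, a) *\<^sub>H (0, b) - qcnj (- A b) *\<^sub>H (- A a) = r *\<^sub>R one_H + (0, c)"
      and 2: "(- A b) *\<^sub>H (0, a) + (- A a) *\<^sub>H qcnj (0, b) = - A c"
      by (simp_all only: normal_graph_def omul.simps one_O_def scaleR_Pair add_Pair prod.inject scaleR_zero_right add_0)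
    then have "snd ((0, a) *\<^sub>H (0, b) - qcnj (- A b) *\<^sub>H (- A a)) = snd (r *\<^sub>R one_H + (0, c))"
      by (simp only:)
    then have c: "c = cross3 a b - snd (qcnj (A b) *\<^sub>H A a)"
      by (simp add: linear_neg[OF bounded_linear.linear[OF bounded_linear_qcnj]] qmul.minus_left qmul.minus_right
          del: snd_qmul fst_qmul)
    have "A c = A b *\<^sub>H (0, a) - A a *\<^sub>H (0, b)"
    proof -
      have "qcnj (0, b) = - (0, b)" by simp
      with 2 have "- (A b *\<^sub>H (0, a)) + A a *\<^sub>H (0, b) = - A c"
        by (simp only: qmul.minus_left qmul.minus_right minus_minus)
      moreover have "r = p - q" if "- p + q = - r" for p q r :: quat
      proof -
        have "r = - (- p + q)" unfolding that by simp
        then show ?thesis by simp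
      qed
      ultimately show ?thesis by blast
    qed
    then show ?thesis unfolding c .
  qed
  have "dim (range A) \<le> dim (UNIV :: (real^3) set)"
    by (rule dim_image_le[OF A])
  also have "\<dots> < DIM(quat)" by simp
  finally obtain z where z: "z \<noteq> 0" "\<And>y. y \<in> span (range A) \<Longrightarrow> orthogonal z y"
    using orthogonal_to_subspace_exists by blast
  define w where "w = z /\<^sub>R norm z"
  have w: "norm w = 1" using z(1) by (simp add: w_def)
  then have ww: "w \<bullet> w = 1" by (simp add: norm_eq_1)
  have wA: "w \<bullet> A a = 0" for a
    using z(2)[of "A a"] by (simp add: w_def orthogonal_def span_base)
  define S where "S a = snd (qcnj w *\<^sub>H A a)" for a
  have wS: "qcnj w *\<^sub>H A a = (0, S a)" for a
    by (simp add: prod_eq_iff S_def fst_qcnj_qmul wA del: fst_qmul snd_qmul)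
  have AS: "A a = w *\<^sub>H (0, S a)" for a
    unfolding wS[symmetric] qmul_assoc[symmetric] qcnj_mult_self ww by simp
  have linS: "linear S"
    unfolding S_def
    by (intro linearI) (simp_all only: linear_add[OF A] linear_cmul[OF A] qmul.add_right qmul.scaleR_right snd_add snd_scaleR)
  have key: "(0, S (cross3 a b - snd (qcnj (A b) *\<^sub>H A a))) = (0, S b) *\<^sub>H (0, a) - (0, S a) *\<^sub>H (0, b)" for a b
    using arg_cong[OF closed[of a b], of "\<lambda>q. qcnj w *\<^sub>H q"]
    unfolding wS qmul.diff_right qmul_assoc[symmetric] .
  have sym: "S a \<bullet> b = a \<bullet> S b" for a b
    using arg_cong[OF key[of a b], of fst] by (simp add: inner_commute)
  have "qcnj (A b) *\<^sub>H A a = qcnj (0, S b) *\<^sub>H (0, S a)" for a b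
    unfolding AS qcnj_qmul by (metis qmul_assoc qcnj_mult_self(1) ww scaleR_one qmul_one(1))
  then have s: "snd (qcnj (A b) *\<^sub>H A a) = cross3 (S a) (S b)" for a b
    by (simp add: cross_skew[of "S a"])
  have "S (cross3 (S a) (S b)) = S (cross3 a b) + cross3 (S a) b + cross3 a (S b)" for a b
    using arg_cong[OF key[of a b], of snd] unfolding s
    by (simp add: linear_diff[OF linS] cross_skew[of "S b" a] algebra_simps)
  then show ?thesis
    using that[OF w linS sym AS] by blast
qed

lemma orthonormal3_permute:
  assumes "orthonormal3 a b c"
  shows "orthonormal3 a c b" "orthonormal3 b c a"
  using orthonormal3D[OF assms] by (simp_all add: orthonormal3_def)

text \<open>On an eigenbasis \<open>a\<close>, \<open>b\<close>, \<open>cross3 a b\<close> the cross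
  product relation says that the eigenvalues have equal sum and product. At most two angles for
  three eigenvalues means that two absolute values coincide, and the frame is permuted to put these
  first.\<close>

lemma associative_normal_form:
  assumes A: "linear A" and assoc: "associative (range (normal_graph A))"
    and card: "card (jordan_angles (range (normal_graph A)) Im_H_in_O) \<le> 2"
  obtains w e1 e2 e3 s1 s2 s3 where "norm w = 1" "diagonal_normal_graph A e1 e2 e3 s1 s2 s3"
    "\<And>a. A a = w *\<^sub>H (0, (s1 * (a \<bullet> e1)) *\<^sub>R e1 + (s2 * (a \<bullet> e2)) *\<^sub>R e2 + (s3 * (a \<bullet> e3)) *\<^sub>R e3)"
    "\<bar>s1\<bar> = \<bar>s2\<bar>" "s1 + s2 + s3 = s1 * s2 * s3"
proof -
  obtain w S where w: "norm w = 1" and S: "linear S" "\<And>a b. S a \<bullet> b = a \<bullet> S b"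
    and AS: "\<And>a. A a = w *\<^sub>H (0, S a)"
    and eq: "\<And>a b. S (cross3 (S a) (S b)) = S (cross3 a b) + cross3 (S a) b + cross3 a (S b)"
    using associative_normal_graph[OF A assoc] by blast
  obtain a b r s t where o: "orthonormal3 a b (cross3 a b)" and ev: "S a = r *\<^sub>R a" "S b = s *\<^sub>R b"
    "S (cross3 a b) = t *\<^sub>R cross3 a b"
    using selfadjoint_orthonormal3[OF S] by blast
  define c where "c = cross3 a b"
  note o = o[folded c_def] and ev = ev[folded c_def]
  have "(r * s * t) *\<^sub>R c = (r + s + t) *\<^sub>R c"
    using eq[of a b] unfolding ev by (simp add: c_def[symmetric] cross_mult_left cross_mult_right linear_cmul[OF S(1)] ev algebra_simps)
  moreover have "c \<noteq> 0" using orthonormal3D(3)[OF o] by auto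
  ultimately have rst: "r + s + t = r * s * t" by simp
  have gen: "diagonal_normal_graph A e1 e2 e3 s1 s2 s3 \<and>
      (\<forall>x. A x = w *\<^sub>H (0, (s1 * (x \<bullet> e1)) *\<^sub>R e1 + (s2 * (x \<bullet> e2)) *\<^sub>R e2 + (s3 * (x \<bullet> e3)) *\<^sub>R e3))"
    if o: "orthonormal3 e1 e2 e3" and ev: "S e1 = s1 *\<^sub>R e1" "S e2 = s2 *\<^sub>R e2" "S e3 = s3 *\<^sub>R e3" for e1 e2 e3 s1 s2 s3
  proof -
    have Sx: "S x = (s1 * (x \<bullet> e1)) *\<^sub>R e1 + (s2 * (x \<bullet> e2)) *\<^sub>R e2 + (s3 * (x \<bullet> e3)) *\<^sub>R e3" for x
      by (subst orthonormal3_expand[OF o, of x])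
        (simp add: linear_add[OF S(1)] linear_cmul[OF S(1)] ev mult.commute)
    have "A x \<bullet> A y = S x \<bullet> S y" for x y
      unfolding AS inner_qmul_left using w by (simp add: norm_eq_1)
    then have "A x \<bullet> A y = s1\<^sup>2 * (x \<bullet> e1) * (y \<bullet> e1) + s2\<^sup>2 * (x \<bullet> e2) * (y \<bullet> e2) + s3\<^sup>2 * (x \<bullet> e3) * (y \<bullet> e3)" for x y
      unfolding Sx using orthonormal3D[OF o]
      by (simp add: inner_add_left inner_add_right power2_eq_square)
    then show ?thesis
      using A o AS Sx by (auto intro!: diagonal_normal_graph.intro)
  qed
  interpret diagonal_normal_graph A a b c r s t
    using gen[OF o ev] by blast
  have "card {arctan \<bar>r\<bar>, arctan \<bar>s\<bar>, arctan \<bar>t\<bar>} \<le> 2"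
    using card unfolding angles .
  then consider "\<bar>r\<bar> = \<bar>s\<bar>" | "\<bar>r\<bar> = \<bar>t\<bar>" | "\<bar>s\<bar> = \<bar>t\<bar>"
    by (auto simp: card_insert_if arctan_eq_iff split: if_splits)
  then show ?thesis
  proof cases
    case 1
    then show ?thesis
      using that[OF w _ _ 1] gen[OF o ev] rst by blast
  next
    case 2
    have "r + t + s = r * t * s" using rst by (simp add: algebra_simps)
    then show ?thesis
      using that[OF w _ _ 2] gen[OF orthonormal3_permute(1)[OF o] ev(1,3,2)] by blast
  next
    case 3
    have "s + t + r = s * t * r" using rst by (simp add: algebra_simps)
    then show ?thesis
      using that[OF w _ _ 3] gen[OF orthonormal3_permute(2)[OF o] ev(2,3,1)] by blast
  qed
qed

section \<open>Tangent and normal spaces of a graph\<close>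

lemma smooth_on_Pair:
  assumes "open S" "smooth_on S f" "smooth_on S g"
  shows "smooth_on S (\<lambda>x. (f x, g x))"
proof -
  have "smooth_on S (\<lambda>x. (f x, 0) + (0, g x))"
    by (intro smooth_on_add assms(1) smooth_on_bounded_linear[OF assms(1) _ assms(2), of "\<lambda>a. (a, 0)"]
        smooth_on_bounded_linear[OF assms(1) _ assms(3), of "\<lambda>a. (0, a)"]
        bounded_linear_Pair bounded_linear_ident bounded_linear_zero)
  then show ?thesis by simp
qed

text \<open>\<open>tangent_space\<close> asks for smooth curves; those needed on a graph lie over
  straight segments, so composition with an affine line is enough.\<close>

lemma Ck_on_line:
  fixes f :: "'a::real_normed_vector \<Rightarrow> 'b::real_normed_vector"
  assumes "open T" "\<And>t. t \<in> T \<Longrightarrow> x + t *\<^sub>R v \<in> D" "Ck_on n f D"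
  shows "Ck_on n (\<lambda>t. f (x + t *\<^sub>R v)) T"
  using assms(3)
proof (induction n arbitrary: f)
  case 0
  have "continuous_on T (\<lambda>t. x + t *\<^sub>R v)" by (intro continuous_intros)
  then show ?case
    using 0 assms(2) by (auto intro: continuous_on_compose2[of D f])
next
  case (Suc n)
  have der: "((\<lambda>t. f (x + t *\<^sub>R v)) has_derivative (\<lambda>h. h *\<^sub>R frechet_derivative f (at (x + t *\<^sub>R v)) v)) (at t)"
    if "t \<in> T" for t
  proof -
    note f' = Ck_on_Suc_has_derivative[OF Suc.prems assms(2)[OF that]]
    have "((\<lambda>t. x + t *\<^sub>R v) has_derivative (\<lambda>h. h *\<^sub>R v)) (at t)"
      by (auto intro!: derivative_eq_intros)
    from has_derivative_compose[OF this f'] show ?thesis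
      by (simp add: linear_cmul[OF has_derivative_linear[OF f']])
  qed
  have "Ck_on n (\<lambda>t. h *\<^sub>R frechet_derivative f (at (x + t *\<^sub>R v)) v) T" for h :: real
    using Suc.prems by (intro Ck_on_bounded_linear[OF assms(1) bounded_linear_scaleR_right] Suc.IH) simp
  then have "Ck_on n (\<lambda>t. frechet_derivative (\<lambda>t. f (x + t *\<^sub>R v)) (at t) h) T" for h
    by (rule Ck_on_cong[OF assms(1), rotated]) (use frechet_derivative_at[OF der] in \<open>auto dest: fun_cong\<close>)
  then show ?case
    using der by (auto simp: differentiable_def)
qed

text \<open>A curve in the graph is determined by its second component, and the chain rule relates
  the two velocities. Conversely, the segment \<open>x + t *\<^sub>R v\<close> is lifted to the
  graph.\<close>

lemma tangent_space_graph:
  assumes D: "open D" and f: "smooth_on D f" and x: "x \<in> D"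
  shows "tangent_space (oct_graph D f) (f x, x) = range (\<lambda>v. (frechet_derivative f (at x) v, v))"
proof (intro equalityI subsetI)
  note f' = smooth_on_has_derivative[OF f x]
  fix z assume "z \<in> tangent_space (oct_graph D f) (f x, x)"
  then obtain \<gamma> \<delta> where \<delta>: "\<delta> > 0" and \<gamma>: "\<gamma> ` {-\<delta><..<\<delta>} \<subseteq> oct_graph D f" "\<gamma> 0 = (f x, x)"
    "(\<gamma> has_vector_derivative z) (at (0::real))"
    unfolding tangent_space_def by blast
  have d: "(\<gamma> has_derivative (\<lambda>h. h *\<^sub>R z)) (at 0)"
    using \<gamma>(3) by (simp add: has_vector_derivative_def)
  have d2: "((\<lambda>t. snd (\<gamma> t)) has_derivative (\<lambda>h. h *\<^sub>R snd z)) (at 0)"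
    using has_derivative_snd[OF d] by simp
  have "snd (\<gamma> 0) = x" using \<gamma>(2) by simp
  with f' have "(f has_derivative frechet_derivative f (at x)) (at (snd (\<gamma> 0)))" by simp
  from has_derivative_compose[OF d2 this]
  have "((\<lambda>t. f (snd (\<gamma> t))) has_derivative (\<lambda>h. frechet_derivative f (at x) (h *\<^sub>R snd z))) (at 0)" .
  then have "((\<lambda>t. fst (\<gamma> t)) has_derivative (\<lambda>h. frechet_derivative f (at x) (h *\<^sub>R snd z))) (at 0)"
  proof (rule has_derivative_transform_within_open)
    show "f (snd (\<gamma> t)) = fst (\<gamma> t)" if "t \<in> {-\<delta><..<\<delta>}" for t
    proof -
      have "\<gamma> t \<in> oct_graph D f" using \<gamma>(1) that by blast
      then show ?thesis unfolding oct_graph_def by force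
    qed
  qed (use \<delta> in auto)
  moreover have "((\<lambda>t. fst (\<gamma> t)) has_derivative (\<lambda>h. h *\<^sub>R fst z)) (at 0)"
    using has_derivative_fst[OF d] by simp
  ultimately have "(\<lambda>h. frechet_derivative f (at x) (h *\<^sub>R snd z)) = (\<lambda>h. h *\<^sub>R fst z)"
    by (rule has_derivative_unique)
  from fun_cong[OF this, of 1] have "fst z = frechet_derivative f (at x) (snd z)" by simp
  then show "z \<in> range (\<lambda>v. (frechet_derivative f (at x) v, v))"
    by (intro image_eqI[of _ _ "snd z"]) (auto simp: prod_eq_iff)
next
  note f' = smooth_on_has_derivative[OF f x]
  fix z assume "z \<in> range (\<lambda>v. (frechet_derivative f (at x) v, v))"
  then obtain v where z: "z = (frechet_derivative f (at x) v, v)" by blast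
  obtain e where e: "e > 0" "ball x e \<subseteq> D" using D x openE by blast
  define \<delta> where "\<delta> = e / (norm v + 1)"
  have nv: "norm v + 1 > 0" by (rule add_nonneg_pos) auto
  then have \<delta>: "\<delta> > 0" using e by (simp add: \<delta>_def)
  have in_D: "x + t *\<^sub>R v \<in> D" if "t \<in> {-\<delta><..<\<delta>}" for t
  proof -
    have "norm (t *\<^sub>R v) \<le> \<bar>t\<bar> * (norm v + 1)" by (simp add: mult_left_mono)
    also have "\<dots> < \<delta> * (norm v + 1)" using that nv by (intro mult_strict_right_mono) auto
    also have "\<dots> = e" using nv by (simp add: \<delta>_def)
    finally show ?thesis using e(2) by (auto simp: dist_norm)
  qed
  define \<gamma> where "\<gamma> t = (f (x + t *\<^sub>R v), x + t *\<^sub>R v)" for t :: real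
  have "smooth_on {-\<delta><..<\<delta>} (\<lambda>t. f (x + t *\<^sub>R v))"
    using f in_D unfolding smooth_on_def by (auto intro!: Ck_on_line[where D = D])
  moreover have "smooth_on {-\<delta><..<\<delta>} (\<lambda>t. x + t *\<^sub>R v)"
    by (intro smooth_on_add smooth_on_const smooth_on_bounded_linear_self bounded_linear_scaleR_left) auto
  ultimately have "smooth_on {-\<delta><..<\<delta>} \<gamma>"
    unfolding \<gamma>_def[abs_def] by (intro smooth_on_Pair) auto
  moreover have "(\<gamma> has_vector_derivative z) (at 0)"
  proof -
    have l: "((\<lambda>t. x + t *\<^sub>R v) has_derivative (\<lambda>h. h *\<^sub>R v)) (at 0)"
      by (auto intro!: derivative_eq_intros)
    have "(f has_derivative frechet_derivative f (at x)) (at (x + 0 *\<^sub>R v))"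
      using f' by simp
    from has_derivative_Pair[OF has_derivative_compose[OF l this] l]
    show ?thesis
      by (simp add: has_vector_derivative_def \<gamma>_def[abs_def] z linear_cmul[OF has_derivative_linear[OF f']])
  qed
  moreover have "\<gamma> ` {-\<delta><..<\<delta>} \<subseteq> oct_graph D f"
  proof (rule image_subsetI)
    show "\<gamma> t \<in> oct_graph D f" if "t \<in> {-\<delta><..<\<delta>}" for t
      unfolding oct_graph_def \<gamma>_def using in_D[OF that] by blast
  qed
  ultimately show "z \<in> tangent_space (oct_graph D f) (f x, x)"
    unfolding tangent_space_def using \<delta> by (auto simp: \<gamma>_def intro!: exI[of _ \<gamma>] exI[of _ \<delta>])
qed

text \<open>The derivative of the imaginary valued \<open>f\<close> has no real part, and
  orthogonality to all tangent vectors determines the second component of a normal vector from the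
  first.\<close>

lemma normal_space_graph:
  assumes D: "open D" and f: "smooth_on D f" and x: "x \<in> D" and Im: "f ` D \<subseteq> Im_H"
  shows "normal_space (oct_graph D f) (f x, x)
    = range (normal_graph (adjoint (frechet_derivative (\<lambda>y. snd (f y)) (at x))))"
proof -
  note f' = smooth_on_has_derivative[OF f x]
  let ?J = "frechet_derivative (\<lambda>y. snd (f y)) (at x)"
  have J: "?J v = snd (frechet_derivative f (at x) v)" for v
    using frechet_derivative_at[OF has_derivative_snd[OF f']] by (metis (no_types))
  have F: "fst (frechet_derivative f (at x) v) = 0" for v
    using has_derivative_eq_0_if_constant[OF D x _ has_derivative_fst[OF f'], of 0 v] Im
    by (auto simp: Im_H_def)
  have lin: "linear ?J"
    using has_derivative_linear[OF has_derivative_snd[OF f']] unfolding J[symmetric] by simp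
  have adj: "adjoint ?J a \<bullet> v = a \<bullet> ?J v" for a v
    using adjoint_works[OF lin, of v a] by (simp add: inner_commute)
  have T: "z \<in> (tangent_space (oct_graph D f) (f x, x))\<^sup>\<bottom> \<longleftrightarrow> (\<forall>v. snd (fst z) \<bullet> ?J v + snd z \<bullet> v = 0)" for z
  proof -
    have "(frechet_derivative f (at x) v, v) \<bullet> z = snd (fst z) \<bullet> ?J v + snd z \<bullet> v" for v
      unfolding inner_prod_def[of "(frechet_derivative f (at x) v, v)" z]
        inner_prod_def[of "fst (frechet_derivative f (at x) v, v)" "fst z"]
      by (simp add: F J inner_commute)
    then show ?thesis
      unfolding tangent_space_graph[OF D f x] orthogonal_comp_iff Ball_image_comp o_def ball_UNIV by simp
  qed
  have "z \<in> normal_space (oct_graph D f) (f x, x) \<longleftrightarrow> z \<in> range (normal_graph (adjoint ?J))" for z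
  proof
    assume "z \<in> normal_space (oct_graph D f) (f x, x)"
    then have z: "fst (fst z) = 0" "\<And>v. snd (fst z) \<bullet> ?J v + snd z \<bullet> v = 0"
      unfolding normal_space_def Int_iff T by (auto simp: Im_O_def Im_H_def)
    have "snd z = - adjoint ?J (snd (fst z))"
    proof -
      have "(snd z + adjoint ?J (snd (fst z))) \<bullet> v = 0" for v
        using z(2)[of v] by (simp add: inner_add_left adj)
      then have "snd z + adjoint ?J (snd (fst z)) = 0"
        by (metis inner_eq_zero_iff)
      then show ?thesis by (simp add: eq_neg_iff_add_eq_0)
    qed
    then show "z \<in> range (normal_graph (adjoint ?J))"
      using z(1) by (intro image_eqI[of _ _ "snd (fst z)"]) (auto simp: normal_graph_def prod_eq_iff)
  next
    assume "z \<in> range (normal_graph (adjoint ?J))"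
    then obtain a where z: "z = ((0, a), - adjoint ?J a)" by (auto simp: normal_graph_def)
    show "z \<in> normal_space (oct_graph D f) (f x, x)"
      unfolding normal_space_def Int_iff T by (simp add: z adj Im_O_def Im_H_def)
  qed
  then show ?thesis by blast
qed

section \<open>Affine planes, cones and the normal form of the differential\<close>

lemma affine_graph_open:
  assumes D: "open D" and L: "linear L" "range L \<subseteq> Im_H" and c: "c \<in> Im_H"
    and f: "\<forall>x\<in>D. f x = L x + c"
  shows "open_in_affine_4_plane (oct_graph D f)"
proof -
  let ?G = "\<lambda>x. (L x, x)"
  let ?E = "(+) (c, 0) ` range ?G"
  have lin: "linear ?G"
    by (intro linearI) (simp_all add: linear_add[OF L(1)] linear_cmul[OF L(1)])
  have sub: "subspace (range ?G)"
    using lin by (simp add: linear_subspace_image)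
  have "dim (range ?G) = dim (UNIV :: quat set)"
    using lin by (intro dim_image_eq) (auto intro: inj_onI)
  then have "aff_dim ?E = 4"
    by (simp add: aff_dim_translation_eq aff_dim_subspace[OF sub])
  moreover have "affine ?E"
    using subspace_imp_affine[OF sub] affine_translation by blast
  moreover have "?E \<subseteq> Im_O"
    using L(2) c by (auto simp: Im_O_def Im_H_def image_subset_iff)
  moreover have eq: "oct_graph D f = ?E \<inter> snd -` D"
  proof (intro equalityI subsetI)
    fix z assume "z \<in> oct_graph D f"
    then obtain x where "x \<in> D" "z = (L x + c, x)" unfolding oct_graph_def using f by force
    then have "z = (c, 0) + (L x, x)" "snd z \<in> D" by (simp_all add: add.commute)
    then show "z \<in> ?E \<inter> snd -` D" by blast
  next
    fix z assume "z \<in> ?E \<inter> snd -` D"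
    then obtain x where "x \<in> D" "z = (c + L x, x)" by auto
    then have "z = (f x, x)" using f by (simp add: add.commute)
    then show "z \<in> oct_graph D f" unfolding oct_graph_def using \<open>x \<in> D\<close> by blast
  qed
  have "openin (top_of_set ?E) (oct_graph D f)"
    unfolding eq by (rule openin_open_Int[OF open_vimage_snd[OF D]])
  ultimately show ?thesis
    unfolding open_in_affine_4_plane_def by blast
qed

text \<open>The cone is the graph of \<open>LO_map a\<close> over all nonzero quaternions: the
  parameters over \<open>x\<close> are \<open>r = norm x\<close> and, for \<open>q\<close>, the
  conjugate of \<open>x\<close> divided by \<open>r\<close>.\<close>

lemma LO_cone_iff: "z \<in> LO_cone a \<longleftrightarrow> snd z \<noteq> 0 \<and> fst z = LO_map a (snd z)"
proof
  assume "z \<in> LO_cone a"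
  then obtain q r where q: "norm q = 1" "r > 0"
    and z: "z = r *\<^sub>R ((sqrt 5 / 2) *\<^sub>R (q *\<^sub>H a *\<^sub>H qcnj q), qcnj q)"
    unfolding LO_cone_def by blast
  have r: "norm (snd z) = r" using q z by simp
  then have "snd z \<noteq> 0" using q(2) by auto
  moreover have "qcnj (snd z) = r *\<^sub>R q"
    by (simp add: z linear_cmul[OF bounded_linear.linear[OF bounded_linear_qcnj]])
  ultimately show "snd z \<noteq> 0 \<and> fst z = LO_map a (snd z)"
    using q(2) r unfolding LO_map_def r
    by (simp add: z qmul.scaleR_left qmul.scaleR_right qmul_assoc del: fst_qmul snd_qmul)
next
  assume z: "snd z \<noteq> 0 \<and> fst z = LO_map a (snd z)"
  define r q where "r = norm (snd z)" and "q = inverse r *\<^sub>R qcnj (snd z)"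
  have r: "r > 0" using z by (simp add: r_def)
  have *: "r * (c * (inverse r * inverse r)) = c / r" for c
    using r by (simp add: divide_inverse)
  have "norm q = 1" using r by (simp add: q_def r_def)
  moreover have "qcnj q = inverse r *\<^sub>R snd z"
    by (simp add: q_def linear_cmul[OF bounded_linear.linear[OF bounded_linear_qcnj]])
  then have "z = r *\<^sub>R ((sqrt 5 / 2) *\<^sub>R (q *\<^sub>H a *\<^sub>H qcnj q), qcnj q)"
    using z r * unfolding LO_map_def r_def[symmetric]
    by (simp add: prod_eq_iff[of z] q_def qmul.scaleR_left qmul.scaleR_right qmul_assoc del: fst_qmul snd_qmul)
  ultimately show "z \<in> LO_cone a"
    unfolding LO_cone_def using r by blast
qed

text \<open>The translation by \<open>(y0, x0)\<close> carries the cone to the graph; since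
  \<open>x0\<close> is outside \<open>D\<close>, the vertex is never met.\<close>

lemma LO_graph_open:
  assumes D: "open D" and x0: "x0 \<notin> D" and y0: "y0 \<in> Im_H" and \<epsilon>: "\<epsilon> \<in> Im_H" "norm \<epsilon> = 1"
    and f: "\<forall>x\<in>D. f x = LO_map \<epsilon> (x - x0) + y0"
  shows "open_in_translated_LO_cone (oct_graph D f)"
proof -
  let ?U = "LO_cone \<epsilon> \<inter> (\<lambda>z. snd z + x0) -` D"
  have "open ((\<lambda>z::oct. snd z + x0) -` D)"
    by (intro open_vimage D continuous_intros)
  then have "openin (top_of_set (LO_cone \<epsilon>)) ?U"
    by (rule openin_open_Int)
  moreover have "oct_graph D f = (\<lambda>z. (y0, x0) + z) ` ?U"
  proof (intro equalityI subsetI)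
    fix z assume "z \<in> oct_graph D f"
    then obtain x where x: "x \<in> D" "z = (LO_map \<epsilon> (x - x0) + y0, x)" unfolding oct_graph_def using f by force
    then have "(LO_map \<epsilon> (x - x0), x - x0) \<in> ?U"
      using x0 by (auto simp: LO_cone_iff)
    moreover have "z = (y0, x0) + (LO_map \<epsilon> (x - x0), x - x0)" using x(2) by simp
    ultimately show "z \<in> (\<lambda>z. (y0, x0) + z) ` ?U" by (rule rev_image_eqI)
  next
    fix z assume "z \<in> (\<lambda>z. (y0, x0) + z) ` ?U"
    then obtain u where u: "u \<in> LO_cone \<epsilon>" "snd u + x0 \<in> D" "z = (y0, x0) + u" by auto
    then have "z = (f (snd u + x0), snd u + x0)"
      using f by (simp add: LO_cone_iff prod_eq_iff[of z])
    then show "z \<in> oct_graph D f" unfolding oct_graph_def using u(2) by blast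
  qed
  moreover have "(y0, x0) \<in> Im_O" using y0 by (simp add: Im_O_def)
  ultimately show ?thesis
    unfolding open_in_translated_LO_cone_def using \<epsilon> by blast
qed

section \<open>The differential in normal form\<close>

lemma fueter_rank_one: "(\<Sum>b\<in>Basis. (n \<bullet> snd (qcnj w *\<^sub>H b)) *\<^sub>R (b *\<^sub>H (0, n))) = - (n \<bullet> n) *\<^sub>R w"
proof -
  \<comment> \<open>The coefficients are the coordinates of \<open>w *\<^sub>H (0, n)\<close>, so
    the sum is this quaternion times \<open>(0, n)\<close>, and an imaginary square is minus the
    squared norm.\<close>
  have "(\<Sum>b\<in>Basis. (n \<bullet> snd (qcnj w *\<^sub>H b)) *\<^sub>R (b *\<^sub>H (0, n)))
      = (\<Sum>b\<in>Basis. ((w *\<^sub>H (0, n)) \<bullet> b) *\<^sub>R b) *\<^sub>H (0, n)"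
  proof -
    have "(w *\<^sub>H (0, n)) \<bullet> b = n \<bullet> snd (qcnj w *\<^sub>H b)" for b
      unfolding inner_qmul_cnj_left by (simp add: inner_prod_def del: snd_qmul)
    then show ?thesis
      by (simp only: qmul.sum_left qmul.scaleR_left)
  qed
  also have "\<dots> = w *\<^sub>H ((0, n) *\<^sub>H (0, n))"
    by (simp only: euclidean_representation qmul_assoc)
  also have "(0, n) *\<^sub>H (0, n) = (- (n \<bullet> n)) *\<^sub>R one_H"
    by (simp add: prod_eq_iff)
  finally show ?thesis by (simp only: qmul.scaleR_right qmul_one)
qed

lemma sum_Basis_inner_imaginary:
  assumes "norm w = 1"
  shows "(\<Sum>b\<in>Basis. (n \<bullet> snd (qcnj w *\<^sub>H b)) * (n' \<bullet> snd (qcnj w *\<^sub>H b))) = n \<bullet> n'"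
proof -
  have "(w *\<^sub>H (0, n)) \<bullet> b = n \<bullet> snd (qcnj w *\<^sub>H b)" for b n
    unfolding inner_qmul_cnj_left by (simp add: inner_prod_def del: snd_qmul)
  note * = this
  have "(\<Sum>b\<in>Basis. (n \<bullet> snd (qcnj w *\<^sub>H b)) * (n' \<bullet> snd (qcnj w *\<^sub>H b)))
      = (w *\<^sub>H (0, n)) \<bullet> (w *\<^sub>H (0, n'))"
    by (subst euclidean_inner) (simp only: *)
  also have "\<dots> = n \<bullet> n'"
    unfolding inner_qmul_left using assms by (simp add: norm_eq_1 inner_prod_def)
  finally show ?thesis .
qed

text \<open>This collects what is known at a single point; the frame, \<open>w\<close> and the
  signed eigenvalues may jump from point to point.\<close>

locale coassociative_normal_form = diagonal_normal_graph A e1 e2 e3 s1 s2 s3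
  for A e1 e2 e3 s1 s2 s3 +
  fixes J :: "quat \<Rightarrow> real^3" and w :: quat
  assumes linear_J: "linear J" and A_adjoint: "A = adjoint J" and w: "norm w = 1"
    and A_eq: "\<And>a. A a = w *\<^sub>H (0, (s1 * (a \<bullet> e1)) *\<^sub>R e1 + (s2 * (a \<bullet> e2)) *\<^sub>R e2 + (s3 * (a \<bullet> e3)) *\<^sub>R e3)"
    and s12: "\<bar>s1\<bar> = \<bar>s2\<bar>" and trace_det: "s1 + s2 + s3 = s1 * s2 * s3"
begin

lemma J_eq: "J v = (s1 * (e1 \<bullet> snd (qcnj w *\<^sub>H v))) *\<^sub>R e1 + (s2 * (e2 \<bullet> snd (qcnj w *\<^sub>H v))) *\<^sub>R e2
    + (s3 * (e3 \<bullet> snd (qcnj w *\<^sub>H v))) *\<^sub>R e3"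
proof -
  let ?q = "snd (qcnj w *\<^sub>H v)"
  have "J v \<bullet> a = ((s1 * (e1 \<bullet> ?q)) *\<^sub>R e1 + (s2 * (e2 \<bullet> ?q)) *\<^sub>R e2 + (s3 * (e3 \<bullet> ?q)) *\<^sub>R e3) \<bullet> a" for a
  proof -
    have "J v \<bullet> a = A a \<bullet> v"
      unfolding A_adjoint using adjoint_works[OF linear_J, of v a] by (simp add: inner_commute)
    also have "\<dots> = ((s1 * (a \<bullet> e1)) *\<^sub>R e1 + (s2 * (a \<bullet> e2)) *\<^sub>R e2 + (s3 * (a \<bullet> e3)) *\<^sub>R e3) \<bullet> ?q"
      unfolding A_eq inner_qmul_cnj_left by (simp add: inner_prod_def del: snd_qmul)
    finally show ?thesis
      by (simp add: inner_add_left inner_add_right inner_commute algebra_simps del: snd_qmul)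
  qed
  then show ?thesis by (metis vector_eq_rdot)
qed

lemma fueter: "(\<Sum>b\<in>Basis. b *\<^sub>H (0, J b)) = - (s1 + s2 + s3) *\<^sub>R w"
proof -
  let ?F = "\<lambda>n. \<Sum>b\<in>Basis. (n \<bullet> snd (qcnj w *\<^sub>H b)) *\<^sub>R (b *\<^sub>H (0, n))"
  have "b *\<^sub>H (0, J b) = s1 *\<^sub>R ((e1 \<bullet> snd (qcnj w *\<^sub>H b)) *\<^sub>R (b *\<^sub>H (0, e1)))
      + s2 *\<^sub>R ((e2 \<bullet> snd (qcnj w *\<^sub>H b)) *\<^sub>R (b *\<^sub>H (0, e2)))
      + s3 *\<^sub>R ((e3 \<bullet> snd (qcnj w *\<^sub>H b)) *\<^sub>R (b *\<^sub>H (0, e3)))" for b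
  proof -
    have "(0, r *\<^sub>R x + s *\<^sub>R y + t *\<^sub>R z) = r *\<^sub>R (0, x) + s *\<^sub>R (0, y) + t *\<^sub>R ((0, z) :: quat)"
      for r s t and x y z :: "real^3" by simp
    then show ?thesis
      unfolding J_eq by (simp only: qmul.add_right qmul.scaleR_right scaleR_scaleR)
  qed
  then have "(\<Sum>b\<in>Basis. b *\<^sub>H (0, J b)) = s1 *\<^sub>R ?F e1 + s2 *\<^sub>R ?F e2 + s3 *\<^sub>R ?F e3"
    by (simp only: sum.distrib scaleR_sum_right)
  then show ?thesis
    unfolding fueter_rank_one orthonormal3D(1-3)[OF frame] by (simp add: algebra_simps)
qed

lemma energy: "(\<Sum>b\<in>Basis. J b \<bullet> J b) = s1\<^sup>2 + s2\<^sup>2 + s3\<^sup>2"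
proof -
  let ?E = "\<lambda>n. \<Sum>b\<in>Basis. (n \<bullet> snd (qcnj w *\<^sub>H b)) * (n \<bullet> snd (qcnj w *\<^sub>H b))"
  have "J b \<bullet> J b = s1\<^sup>2 * ((e1 \<bullet> snd (qcnj w *\<^sub>H b)) * (e1 \<bullet> snd (qcnj w *\<^sub>H b)))
      + s2\<^sup>2 * ((e2 \<bullet> snd (qcnj w *\<^sub>H b)) * (e2 \<bullet> snd (qcnj w *\<^sub>H b)))
      + s3\<^sup>2 * ((e3 \<bullet> snd (qcnj w *\<^sub>H b)) * (e3 \<bullet> snd (qcnj w *\<^sub>H b)))" for b
    unfolding J_eq using orthonormal3D[OF frame]
    by (simp add: inner_add_left inner_add_right power2_eq_square del: snd_qmul)
  then have "(\<Sum>b\<in>Basis. J b \<bullet> J b) = s1\<^sup>2 * ?E e1 + s2\<^sup>2 * ?E e2 + s3\<^sup>2 * ?E e3"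
    by (simp only: sum.distrib sum_distrib_left)
  then show ?thesis
    unfolding sum_Basis_inner_imaginary[OF w] orthonormal3D(1-3)[OF frame] by simp
qed

text \<open>An angle 0 means a zero among the eigenvalues. If it is \<open>s1\<close> or
  \<open>s2\<close>, both vanish and \<open>trace_det\<close> gives \<open>s3 = 0\<close>; if it is
  \<open>s3\<close>, the same relation gives \<open>s2 = - s1\<close>.\<close>

lemma singular_case:
  assumes "0 \<in> jordan_angles (range (normal_graph A)) Im_H_in_O"
  shows "s1 + s2 + s3 = 0" "s3 = 0"
    "jordan_angles (range (normal_graph A)) Im_H_in_O = {0, arctan \<bar>s1\<bar>}"
proof -
  have "s1 = 0 \<or> s2 = 0 \<or> s3 = 0"
    using assms unfolding angles by auto
  then have *: "s1 + s2 + s3 = 0" "s3 = 0"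
    using s12 trace_det by auto
  then show "s1 + s2 + s3 = 0" "s3 = 0" by blast+
  show "jordan_angles (range (normal_graph A)) Im_H_in_O = {0, arctan \<bar>s1\<bar>}"
    unfolding angles using s12 * by auto
qed

lemma regular_case:
  assumes "0 \<notin> jordan_angles (range (normal_graph A)) Im_H_in_O"
  shows "s1 = s2" "s1 \<noteq> 0" "s3 \<noteq> 0" "2 * s1 + s3 = s1\<^sup>2 * s3"
    "J v = s1 *\<^sub>R snd (qcnj w *\<^sub>H v) + ((s3 - s1) * (e3 \<bullet> snd (qcnj w *\<^sub>H v))) *\<^sub>R e3"
proof -
  have nz: "s1 \<noteq> 0" "s2 \<noteq> 0" "s3 \<noteq> 0"
    using assms unfolding angles by auto
  show eq: "s1 = s2"
  proof (rule ccontr)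
    assume "s1 \<noteq> s2"
    \<comment> \<open>Opposite signs turn \<open>trace_det\<close> into
      \<open>s3 * (1 + s1 * s1) = 0\<close>, impossible for nonzero \<open>s3\<close>.\<close>
    then have "s2 = - s1" using s12 by (auto simp: abs_if split: if_splits)
    then have "s3 * (1 + s1 * s1) = 0" using trace_det by (simp add: algebra_simps)
    moreover have "1 + s1 * s1 > 0" by (rule add_pos_nonneg) auto
    ultimately show False using nz(3) by simp
  qed
  show "s1 \<noteq> 0" "s3 \<noteq> 0" by fact+
  show "2 * s1 + s3 = s1\<^sup>2 * s3"
    using trace_det eq by (simp add: power2_eq_square)
  let ?q = "snd (qcnj w *\<^sub>H v)"
  have q: "?q = (e1 \<bullet> ?q) *\<^sub>R e1 + (e2 \<bullet> ?q) *\<^sub>R e2 + (e3 \<bullet> ?q) *\<^sub>R e3"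
    using orthonormal3_expand[OF frame, of ?q] by (simp only: inner_commute)
  have "s1 *\<^sub>R ?q = (s1 * (e1 \<bullet> ?q)) *\<^sub>R e1 + (s1 * (e2 \<bullet> ?q)) *\<^sub>R e2 + (s1 * (e3 \<bullet> ?q)) *\<^sub>R e3"
    using arg_cong[OF q, of "\<lambda>x. s1 *\<^sub>R x"] by (simp only: scaleR_add_right scaleR_scaleR)
  then show "J v = s1 *\<^sub>R ?q + ((s3 - s1) * (e3 \<bullet> ?q)) *\<^sub>R e3"
    unfolding J_eq eq[symmetric] by (simp add: algebra_simps del: snd_qmul)
qed

end

text \<open>Changing the signs of \<open>w\<close> and of all eigenvalues leaves \<open>J\<close>
  unchanged, so multiplying by the sign of \<open>s1\<close> makes the double eigenvalue positive.
  Parameters then become comparable between points, and the last identity determines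
  \<open>w'\<close>.\<close>

lemma (in coassociative_normal_form) regular_normal_form:
  assumes "0 \<notin> jordan_angles (range (normal_graph A)) Im_H_in_O"
  obtains w' n \<mu> where "norm w' = 1" "norm n = 1" "2 * \<bar>s1\<bar> + \<mu> = \<bar>s1\<bar>\<^sup>2 * \<mu>" "\<mu> \<noteq> 0"
    "\<And>v. J v = \<bar>s1\<bar> *\<^sub>R snd (qcnj w' *\<^sub>H v) + ((\<mu> - \<bar>s1\<bar>) * (n \<bullet> snd (qcnj w' *\<^sub>H v))) *\<^sub>R n"
    "(\<Sum>b\<in>Basis. b *\<^sub>H (0, J b)) = - (2 * \<bar>s1\<bar> + \<mu>) *\<^sub>R w'"
proof -
  note r = regular_case[OF assms]
  define \<sigma> where "\<sigma> = sgn s1"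
  have \<sigma>: "\<sigma> * \<sigma> = 1" "\<sigma> * s1 = \<bar>s1\<bar>" "\<bar>\<sigma>\<bar> = 1" "\<sigma> * \<bar>s1\<bar> = s1"
    using r(2) by (auto simp: \<sigma>_def sgn_if abs_if)
  have cnj: "qcnj (\<sigma> *\<^sub>R w) *\<^sub>H v = \<sigma> *\<^sub>R (qcnj w *\<^sub>H v)" for v
    by (simp add: linear_cmul[OF bounded_linear.linear[OF bounded_linear_qcnj]] qmul.scaleR_left)
  show ?thesis
  proof (rule that[of "\<sigma> *\<^sub>R w" e3 "\<sigma> * s3"])
    show "norm (\<sigma> *\<^sub>R w) = 1" using w \<sigma> by simp
    show "norm e3 = 1" using orthonormal3D(3)[OF frame] by (simp add: norm_eq_1)
    show "\<sigma> * s3 \<noteq> 0" using r(3) \<sigma> by auto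
    have "\<sigma> * (2 * s1 + s3) = \<sigma> * (s1\<^sup>2 * s3)" by (simp only: r(4))
    then show "2 * \<bar>s1\<bar> + \<sigma> * s3 = \<bar>s1\<bar>\<^sup>2 * (\<sigma> * s3)"
      using \<sigma>(2) by (simp add: algebra_simps)
    show "(\<Sum>b\<in>Basis. b *\<^sub>H (0, J b)) = - (2 * \<bar>s1\<bar> + \<sigma> * s3) *\<^sub>R (\<sigma> *\<^sub>R w)"
    proof -
      have "(2 * \<bar>s1\<bar> + \<sigma> * s3) * \<sigma> = 2 * (\<sigma> * \<bar>s1\<bar>) + (\<sigma> * \<sigma>) * s3"
        by (simp add: algebra_simps)
      then have "(2 * \<bar>s1\<bar> + \<sigma> * s3) * \<sigma> = s1 + s2 + s3"
        unfolding \<sigma> r(1)[symmetric] by simp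
      then show ?thesis
        unfolding fueter by (simp only: scaleR_scaleR mult_minus_left)
    qed
    show "J v = \<bar>s1\<bar> *\<^sub>R snd (qcnj (\<sigma> *\<^sub>R w) *\<^sub>H v)
        + ((\<sigma> * s3 - \<bar>s1\<bar>) * (e3 \<bullet> snd (qcnj (\<sigma> *\<^sub>R w) *\<^sub>H v))) *\<^sub>R e3" for v
    proof -
      have "(\<sigma> * s3 - \<bar>s1\<bar>) * (\<sigma> * q) = (s3 - s1) * q" for q
      proof -
        have "(\<sigma> * s3 - \<bar>s1\<bar>) * (\<sigma> * q) = ((\<sigma> * \<sigma>) * s3 - \<sigma> * \<bar>s1\<bar>) * q"
          by (simp add: algebra_simps)
        then show ?thesis by (simp only: \<sigma> mult_1_left)
      qed
      moreover have "\<bar>s1\<bar> * \<sigma> = s1" using \<sigma>(4) by (simp add: mult.commute)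
      ultimately show ?thesis
        unfolding r(5) cnj snd_scaleR inner_scaleR_right scaleR_scaleR by (simp only:)
    qed
  qed
qed

text \<open>If the values differed, the angle of the double eigenvalue at one point would be that of
  the simple one at the other; a multiplicity of at least two cannot equal one of at most
  one.\<close>

lemma regular_parameter_unique:
  assumes N: "coassociative_normal_form A e1 e2 e3 s1 s2 s3 J w"
    and N': "coassociative_normal_form A' e1' e2' e3' s1' s2' s3' J' w'"
    and reg: "0 \<notin> jordan_angles (range (normal_graph A)) Im_H_in_O"
    and ang: "jordan_angles (range (normal_graph A)) Im_H_in_O = jordan_angles (range (normal_graph A')) Im_H_in_O"
    and mult: "\<forall>\<theta>\<in>jordan_angles (range (normal_graph A)) Im_H_in_O.
      jordan_mult (range (normal_graph A)) Im_H_in_O \<theta> = jordan_mult (range (normal_graph A')) Im_H_in_O \<theta>"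
  shows "\<bar>s1\<bar> = \<bar>s1'\<bar>"
proof (rule ccontr)
  interpret N: coassociative_normal_form A e1 e2 e3 s1 s2 s3 J w by (rule N)
  interpret N': coassociative_normal_form A' e1' e2' e3' s1' s2' s3' J' w' by (rule N')
  assume neq: "\<bar>s1\<bar> \<noteq> \<bar>s1'\<bar>"
  have "arctan \<bar>s1\<bar> \<in> {arctan \<bar>s1'\<bar>, arctan \<bar>s2'\<bar>, arctan \<bar>s3'\<bar>}"
    using ang unfolding N.angles N'.angles by auto
  then have s: "\<bar>s1\<bar> = \<bar>s3'\<bar>"
    using neq N'.s12 by (auto simp: arctan_eq_iff)
  have "2 \<le> jordan_mult (range (normal_graph A)) Im_H_in_O (arctan \<bar>s1\<bar>)"
    by (rule N.mult_ge_2[OF N.s12])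
  also have "\<dots> = jordan_mult (range (normal_graph A')) Im_H_in_O (arctan \<bar>s1\<bar>)"
    using mult unfolding N.angles by simp
  also have "\<dots> \<le> 1"
    unfolding s using N'.mult_le_1[OF N'.s12] neq s by simp
  finally show False by simp
qed

text \<open>The hypotheses supply \<open>w\<close> and \<open>n\<close> point by point; before the
  frame equations can be used, \<open>w\<close> is made smooth on \<open>D\<close> and
  \<open>n\<close> smooth near each point.\<close>

lemma regular_rigidity:
  fixes g :: "quat \<Rightarrow> real^3"
  assumes D: "open D" "connected D" and g: "smooth_on D g"
    and l: "l > 0" and \<mu>: "2 * l + \<mu> = l\<^sup>2 * \<mu>" "\<mu> \<noteq> 0"
    and form: "\<And>x. x \<in> D \<Longrightarrow> \<exists>w n. norm w = 1 \<and> norm n = 1 \<and>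
      (\<forall>v. frechet_derivative g (at x) v = l *\<^sub>R snd (qcnj w *\<^sub>H v)
         + ((\<mu> - l) * (n \<bullet> snd (qcnj w *\<^sub>H v))) *\<^sub>R n) \<and>
      (\<Sum>b\<in>Basis. b *\<^sub>H (0, frechet_derivative g (at x) b)) = - (2 * l + \<mu>) *\<^sub>R w"
  shows "(\<exists>L c. linear L \<and> (\<forall>x\<in>D. g x = L x + c)) \<or>
    (l = - 2 * (\<mu> - l) \<and> (\<exists>x0 y0 \<epsilon>. fst \<epsilon> = 0 \<and> norm \<epsilon> = 1 \<and> x0 \<notin> D \<and>
       (\<forall>x\<in>D. g x = y0 + ((\<mu> - l) / norm (x - x0)) *\<^sub>R snd (qcnj (x - x0) *\<^sub>H \<epsilon> *\<^sub>H (x - x0)))))"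
proof -
  let ?J = "\<lambda>x. frechet_derivative g (at x)"
  \<comment> \<open>Solves the sum in \<open>form\<close> for the unit quaternion; the divisor
    equals \<open>l\<^sup>2 * \<mu>\<close> and is nonzero.\<close>
  define w where "w x = (- inverse (2 * l + \<mu>)) *\<^sub>R (\<Sum>b\<in>Basis. b *\<^sub>H (0, ?J x b))" for x
  define N where "N x n \<longleftrightarrow> norm n = 1 \<and>
    (\<forall>v. ?J x v = l *\<^sub>R snd (qcnj (w x) *\<^sub>H v) + ((\<mu> - l) * (n \<bullet> snd (qcnj (w x) *\<^sub>H v))) *\<^sub>R n)" for x n
  have nz: "2 * l + \<mu> \<noteq> 0"
    using \<mu> l by simp
  have w1: "norm (w x) = 1" and exN: "\<exists>n. N x n" if x: "x \<in> D" for x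
  proof -
    obtain w' n where n: "norm w' = 1" "norm n = 1"
      "\<And>v. ?J x v = l *\<^sub>R snd (qcnj w' *\<^sub>H v) + ((\<mu> - l) * (n \<bullet> snd (qcnj w' *\<^sub>H v))) *\<^sub>R n"
      "(\<Sum>b\<in>Basis. b *\<^sub>H (0, ?J x b)) = - (2 * l + \<mu>) *\<^sub>R w'"
      using form[OF x] by blast
    have w': "w x = w'"
      unfolding w_def n(4)
      by (simp only: scaleR_scaleR mult_minus_left mult_minus_right minus_minus left_inverse[OF nz] scaleR_one)
    show "norm (w x) = 1" using n(1) w' by simp
    show "\<exists>n. N x n" unfolding N_def w' using n(2,3) by blast
  qed
  have smooth_w: "smooth_on D w"
  proof -
    have "smooth_on D (\<lambda>x. (0, ?J x b))" for b
      using g by (intro smooth_on_Pair smooth_on_const smooth_on_frechet_derivative D(1))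
    then show ?thesis
      unfolding w_def[abs_def]
      by (intro smooth_on_bounded_linear[OF D(1) bounded_linear_scaleR_right] smooth_on_sum D(1)
          smooth_on_bounded_linear[OF D(1) qmul.bounded_linear_right])
  qed
  show ?thesis
  proof (cases "\<mu> = l")
    case True
    have "\<forall>x\<in>D. \<forall>u v. frechet_derivative (\<lambda>y. ?J y v) (at x) u = 0"
    proof (intro ballI allI)
      fix x u v assume x: "x \<in> D"
      have "?J y v = l *\<^sub>R snd (qcnj (w y) *\<^sub>H v)" if "y \<in> D" for y v
      proof -
        obtain n where "N y n" using exN[OF \<open>y \<in> D\<close>] by blast
        then have "?J y v = l *\<^sub>R snd (qcnj (w y) *\<^sub>H v) + ((\<mu> - l) * (n \<bullet> snd (qcnj (w y) *\<^sub>H v))) *\<^sub>R n"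
          unfolding N_def by blast
        then show ?thesis by (simp add: True del: snd_qmul)
      qed
      from conformal_second_derivative_eq_0[OF D(1) g smooth_w w1 this _ x]
      show "frechet_derivative (\<lambda>y. ?J y v) (at x) u = 0"
        using l by simp
    qed
    then obtain L c where "linear L" "\<forall>x\<in>D. g x = L x + c"
      by (rule affine_if_second_derivative_zero[OF D g])
    then show ?thesis by blast
  next
    case False
    have "\<exists>B \<nu>. x0 \<in> B \<and> rank_one_perturbation B g w \<nu> l (\<mu> - l)" if x0: "x0 \<in> D" for x0
    proof -
      obtain n0 where n0: "N x0 n0" using exN[OF x0] by blast
      \<comment> \<open>Evaluated at \<open>w x *\<^sub>H (0, n0)\<close>, the normal form yields
        the projection of \<open>n0\<close> to the eigenline. It is blind to the sign of the
        eigenvector and smooth in \<open>x\<close>.\<close>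
      define y where "y x = inverse (\<mu> - l) *\<^sub>R (?J x (w x *\<^sub>H (0, n0)) + (- l) *\<^sub>R n0)" for x
      have y: "y x = (n \<bullet> n0) *\<^sub>R n" if x: "x \<in> D" and n: "N x n" for x n
      proof -
        have "w x \<bullet> w x = 1" using w1[OF x] by (simp add: norm_eq_1)
        then have cw: "qcnj (w x) *\<^sub>H (w x *\<^sub>H (0, n0)) = (0, n0)"
          by (simp only: qmul_assoc[symmetric] qcnj_mult_self) simp
        have "?J x v = l *\<^sub>R snd (qcnj (w x) *\<^sub>H v) + ((\<mu> - l) * (n \<bullet> snd (qcnj (w x) *\<^sub>H v))) *\<^sub>R n" for v
          using n unfolding N_def by blast
        from this[of "w x *\<^sub>H (0, n0)"]
        have "?J x (w x *\<^sub>H (0, n0)) = l *\<^sub>R n0 + ((\<mu> - l) * (n \<bullet> n0)) *\<^sub>R n"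
          unfolding cw snd_conv .
        then show ?thesis
          unfolding y_def using False by simp
      qed
      have smooth_y: "smooth_on D y"
        unfolding y_def[abs_def]
        by (intro smooth_on_bounded_linear[OF D(1) bounded_linear_scaleR_right] smooth_on_add D(1)
            smooth_on_frechet_derivative_apply g smooth_on_const
            smooth_on_bounded_linear[OF D(1) qmul.bounded_linear_left] smooth_w)
      define q where "q x = y x \<bullet> n0" for x
      have smooth_q: "smooth_on D q"
        unfolding q_def[abs_def]
        by (intro smooth_on_bounded_linear[OF D(1) bounded_linear_inner_left] smooth_y)
      have q: "q x = (n \<bullet> n0)\<^sup>2" if "x \<in> D" "N x n" for x n
        unfolding q_def y[OF that] by (simp add: power2_eq_square)
      \<comment> \<open>\<open>q\<close> is the square of \<open>n \<bullet> n0\<close>, so on this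
        open set the projection is nonzero and can be normalised.\<close>
      define B where "B = {x \<in> D. q x > 0}"
      have BD: "B \<subseteq> D" by (auto simp: B_def)
      have openB: "open B"
        using continuous_open_preimage[OF smooth_on_imp_continuous_on[OF smooth_q] D(1), of "{0<..}"]
        by (simp add: B_def vimage_def Int_def)
      have "n0 \<bullet> n0 = 1" using n0 by (simp add: N_def norm_eq_1)
      then have x0B: "x0 \<in> B"
        using q[OF x0 n0] x0 by (simp add: B_def)
      define n where "n x = inverse (sqrt (q x)) *\<^sub>R y x" for x
      have N: "N x (n x)" if x: "x \<in> B" for x
      proof -
        have xD: "x \<in> D" using x BD by blast
        obtain n' where n': "N x n'" using exN[OF xD] by blast
        define c where "c = n' \<bullet> n0"
        have "c \<noteq> 0" using q[OF xD n'] x by (auto simp: B_def c_def)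
        then have "n x = sgn c *\<^sub>R n'"
          unfolding n_def q[OF xD n'] y[OF xD n'] c_def[symmetric]
          by (simp add: real_sgn_eq divide_inverse mult.commute)
        then consider "n x = n'" | "n x = - n'"
          using \<open>c \<noteq> 0\<close> by (auto simp: sgn_if split: if_splits)
        then show ?thesis
          by cases (use n' in \<open>simp_all add: N_def\<close>)
      qed
      have smooth_n: "smooth_on B n"
        unfolding n_def[abs_def]
        by (intro smooth_on_bounded_bilinear[OF openB bounded_bilinear_scaleR] smooth_on_inverse_sqrt openB
            smooth_on_subset[OF smooth_q BD] smooth_on_subset[OF smooth_y BD]) (simp add: B_def)
      define \<nu> where "\<nu> x = w x *\<^sub>H (0, n x)" for x
      have "rank_one_perturbation B g w \<nu> l (\<mu> - l)"
      proof
        show "open B" by fact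
        show "smooth_on B g" "smooth_on B w"
          using g smooth_w BD by (auto intro: smooth_on_subset)
        have "smooth_on B (\<lambda>x. (0, n x))"
          by (intro smooth_on_Pair openB smooth_on_const smooth_n)
        then show "smooth_on B \<nu>"
          unfolding \<nu>_def[abs_def] using \<open>smooth_on B w\<close>
          by (intro smooth_on_bounded_bilinear[OF openB qmul.bounded_bilinear_axioms])
        show "l \<noteq> 0" "\<mu> - l \<noteq> 0" using l False by auto
        \<comment> \<open>Otherwise \<open>\<mu> = - l\<close>, and the relation for
          \<open>\<mu>\<close> becomes \<open>l * (1 + l\<^sup>2) = 0\<close>.\<close>
        show "2 * l + (\<mu> - l) \<noteq> 0"
        proof
          assume "2 * l + (\<mu> - l) = 0"
          then have m: "\<mu> = - l" by simp
          have "l * (1 + l\<^sup>2) = 0" using \<mu>(1) unfolding m by (simp add: algebra_simps)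
          moreover have "1 + l\<^sup>2 > 0" by (rule add_pos_nonneg) auto
          ultimately show False using l by simp
        qed
        fix x assume x: "x \<in> B"
        then have xD: "x \<in> D" using BD by blast
        show "norm (w x) = 1" by (rule w1[OF xD])
        then have ww: "w x \<bullet> w x = 1" by (simp add: norm_eq_1)
        note Nx = N[OF x, unfolded N_def]
        show "norm (\<nu> x) = 1"
          unfolding \<nu>_def norm_qmul using Nx w1[OF xD] by (simp add: norm_Pair)
        have cw: "qcnj (w x) *\<^sub>H \<nu> x = (0, n x)"
          unfolding \<nu>_def by (simp only: qmul_assoc[symmetric] qcnj_mult_self ww) simp
        show "w x \<bullet> \<nu> x = 0"
          unfolding fst_qcnj_qmul[symmetric] cw by simp
        fix v
        have "\<nu> x \<bullet> v = n x \<bullet> snd (qcnj (w x) *\<^sub>H v)"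
          unfolding \<nu>_def inner_qmul_cnj_left by (simp add: inner_prod_def del: snd_qmul)
        then show "?J x v = l *\<^sub>R snd (qcnj (w x) *\<^sub>H v) + (\<mu> - l) *\<^sub>R (\<nu> x \<bullet> v) *\<^sub>R snd (qcnj (w x) *\<^sub>H \<nu> x)"
          unfolding cw using spec[OF conjunct2[OF Nx], of v] by (simp del: snd_qmul)
      qed
      then show ?thesis using x0B by blast
    qed
    note local = this
    show ?thesis
      by (rule rank_one_perturbation_rigidity[OF D g smooth_w local])
  qed
qed

theorem theorem1p2:
  fixes D :: "quat set" and f :: "quat \<Rightarrow> quat" and M :: "oct set"
  assumes "open D" and "connected D"
    and "f ` D \<subseteq> Im_H" and "smooth_on D f"
    and "M = oct_graph D f"
    and "coassociative M" and "CJA M"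
    and "\<forall>p\<in>M. g_N M p \<le> 2" and "\<forall>p\<in>M. g_T M p \<le> 3"
  shows "((\<exists>L c. linear L \<and> range L \<subseteq> Im_H \<and> c \<in> Im_H \<and> (\<forall>x\<in>D. f x = L x + c))
            \<and> open_in_affine_4_plane M)
       \<or> ((\<exists>x\<^sub>0 y\<^sub>0 \<epsilon>. y\<^sub>0 \<in> Im_H \<and> \<epsilon> \<in> Im_H \<and> norm \<epsilon> = 1 \<and> x\<^sub>0 \<notin> D \<and>
              (\<forall>x\<in>D. f x = LO_map \<epsilon> (x - x\<^sub>0) + y\<^sub>0))
            \<and> open_in_translated_LO_cone M)"
    (is "?affine \<or> ?cone")
proof -
  note D = assms(1,2) and Im = assms(3) and f = assms(4) and M = assms(5)
  define g where "g x = snd (f x)" for x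
  have g: "smooth_on D g"
    unfolding g_def[abs_def] using D(1) bounded_linear_snd f by (rule smooth_on_bounded_linear)
  have fg: "f x = (0, g x)" if "x \<in> D" for x
    using Im that by (auto simp: g_def Im_H_def prod_eq_iff)
  let ?J = "\<lambda>x. frechet_derivative g (at x)"
  define N where "N x = range (normal_graph (adjoint (?J x)))" for x
  have inM: "(f x, x) \<in> M" if "x \<in> D" for x
    using that unfolding M oct_graph_def by blast
  have normal: "normal_space M (f x, x) = N x" if "x \<in> D" for x
    unfolding M N_def g_def[abs_def] by (rule normal_space_graph[OF D(1) f that Im])
  have linJ: "linear (?J x)" if "x \<in> D" for x
    using smooth_on_has_derivative[OF g that] by (rule has_derivative_linear)
  have form: "\<exists>w e1 e2 e3 s1 s2 s3. coassociative_normal_form (adjoint (?J x)) e1 e2 e3 s1 s2 s3 (?J x) w"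
    if x: "x \<in> D" for x
  proof -
    have "associative (N x)"
      using assms(6) inM[OF x] unfolding coassociative_def normal[OF x, symmetric] by blast
    moreover have "card (jordan_angles (N x) Im_H_in_O) \<le> 2"
      using assms(8) inM[OF x] unfolding g_N_def normal[OF x, symmetric] by blast
    ultimately obtain w e1 e2 e3 s1 s2 s3 where "norm w = 1"
      "diagonal_normal_graph (adjoint (?J x)) e1 e2 e3 s1 s2 s3"
      "\<And>a. adjoint (?J x) a = w *\<^sub>H (0, (s1 * (a \<bullet> e1)) *\<^sub>R e1 + (s2 * (a \<bullet> e2)) *\<^sub>R e2 + (s3 * (a \<bullet> e3)) *\<^sub>R e3)"
      "\<bar>s1\<bar> = \<bar>s2\<bar>" "s1 + s2 + s3 = s1 * s2 * s3"
      unfolding N_def using associative_normal_form[OF adjoint_linear[OF linJ[OF x]]] by blast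
    then have "coassociative_normal_form (adjoint (?J x)) e1 e2 e3 s1 s2 s3 (?J x) w"
      using linJ[OF x] by (auto intro!: coassociative_normal_form.intro coassociative_normal_form_axioms.intro)
    then show ?thesis by blast
  qed
  have cja: "jordan_angles (N x) Im_H_in_O = jordan_angles (N x') Im_H_in_O \<and>
      (\<forall>\<theta>\<in>jordan_angles (N x) Im_H_in_O. jordan_mult (N x) Im_H_in_O \<theta> = jordan_mult (N x') Im_H_in_O \<theta>)"
    if "x \<in> D" "x' \<in> D" for x x'
    using assms(7) inM[OF that(1)] inM[OF that(2)]
    unfolding CJA_def normal[OF that(1), symmetric] normal[OF that(2), symmetric] by blast
  have affine: ?affine if "linear L" "\<forall>x\<in>D. g x = L x + c" for L c
  proof -
    have L: "linear (\<lambda>x. (0 :: real, L x))"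
      using that(1) by (intro linearI) (simp_all add: linear_add linear_cmul)
    have "range (\<lambda>x. (0 :: real, L x)) \<subseteq> Im_H" "(0, c) \<in> Im_H"
      by (auto simp: Im_H_def)
    moreover have "\<forall>x\<in>D. f x = (0, L x) + (0, c)"
      using fg that(2) by simp
    ultimately show ?thesis
      using affine_graph_open[OF D(1) L] L unfolding M by blast
  qed
  show ?thesis
  proof (cases "D = {}")
    case True
    then show ?thesis using affine[of "\<lambda>_. 0" 0] by (simp add: linear_zero)
  next
    case False
    then obtain x0 where x0: "x0 \<in> D" by blast
    obtain w0 e10 e20 e30 s1 s2 s3
      where N0: "coassociative_normal_form (adjoint (?J x0)) e10 e20 e30 s1 s2 s3 (?J x0) w0"
      using form[OF x0] by blast
    show ?thesis
    proof (cases "0 \<in> jordan_angles (N x0) Im_H_in_O")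
      case True
      have *: "(\<Sum>b\<in>Basis. b *\<^sub>H (0, ?J x b)) = 0 \<and> (\<Sum>b\<in>Basis. ?J x b \<bullet> ?J x b) = 2 * s1\<^sup>2" if x: "x \<in> D" for x
      proof -
        obtain w e1 e2 e3 t1 t2 t3
          where F: "coassociative_normal_form (adjoint (?J x)) e1 e2 e3 t1 t2 t3 (?J x) w"
          using form[OF x] by blast
        have x_angles: "jordan_angles (N x) Im_H_in_O = jordan_angles (N x0) Im_H_in_O"
          using cja[OF x x0] by blast
        note s0 = coassociative_normal_form.singular_case[OF N0, folded N_def, OF True]
        note s = coassociative_normal_form.singular_case[OF F, folded N_def, unfolded x_angles, OF True]
        \<comment> \<open>Constancy of the angles fixes the energy; the comparison also covers
          \<open>s1 = 0\<close>, where the sets collapse to a point.\<close>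
        have "{0, arctan \<bar>t1\<bar>} = {0, arctan \<bar>s1\<bar>}"
          using s(3) s0(3) by simp
        then have "\<bar>t1\<bar> = \<bar>s1\<bar>"
          by (auto simp: doubleton_eq_iff arctan_eq_iff)
        then have t1: "t1\<^sup>2 = s1\<^sup>2" by (metis power2_abs)
        have "t2 = - t1" using s(1,2) by simp
        then have "t2\<^sup>2 = s1\<^sup>2" using t1 by simp
        then show ?thesis
          using coassociative_normal_form.fueter[OF F] coassociative_normal_form.energy[OF F] s(1,2) t1 by simp
      qed
      have "\<forall>x\<in>D. \<forall>u v. frechet_derivative (\<lambda>y. ?J y v) (at x) u = 0"
        using fueter_regular_constant_energy[OF D(1) g _ _ , of "2 * s1\<^sup>2"] * by blast
      then obtain L c where "linear L" "\<forall>x\<in>D. g x = L x + c"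
        by (rule affine_if_second_derivative_zero[OF D g])
      then show ?thesis using affine by blast
    next
      case False
      define l where "l = \<bar>s1\<bar>"
      \<comment> \<open>The solution of \<open>2 * l + \<mu> = l\<^sup>2 * \<mu>\<close> for given
        \<open>l\<close>. The equation excludes \<open>l = 1\<close> because \<open>l > 0\<close>,
        so the simple eigenvalue is the same at all points.\<close>
      define \<mu> where "\<mu> = 2 * l / (l\<^sup>2 - 1)"
      have l: "l > 0"
        using coassociative_normal_form.regular_case(2)[OF N0, folded N_def, OF False] by (simp add: l_def)
      have mu: "\<mu>' = \<mu>" if "2 * l + \<mu>' = l\<^sup>2 * \<mu>'" for \<mu>'
      proof -
        have e: "\<mu>' * (l\<^sup>2 - 1) = 2 * l" using that by (simp add: algebra_simps)
        then have "l\<^sup>2 - 1 \<noteq> 0" using l by auto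
        then show ?thesis using e unfolding \<mu>_def by (simp add: eq_divide_eq)
      qed
      have reg: "\<exists>w n. norm w = 1 \<and> norm n = 1 \<and>
          (\<forall>v. ?J x v = l *\<^sub>R snd (qcnj w *\<^sub>H v) + ((\<mu> - l) * (n \<bullet> snd (qcnj w *\<^sub>H v))) *\<^sub>R n) \<and>
          (\<Sum>b\<in>Basis. b *\<^sub>H (0, ?J x b)) = - (2 * l + \<mu>) *\<^sub>R w"
        and mu': "2 * l + \<mu> = l\<^sup>2 * \<mu>" "\<mu> \<noteq> 0" if x: "x \<in> D" for x
      proof -
        obtain w e1 e2 e3 t1 t2 t3
          where F: "coassociative_normal_form (adjoint (?J x)) e1 e2 e3 t1 t2 t3 (?J x) w"
          using form[OF x] by blast
        have t1: "\<bar>t1\<bar> = l"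
          unfolding l_def
          using regular_parameter_unique[OF N0 F, folded N_def] False cja[OF x0 x] by simp
        have "0 \<notin> jordan_angles (N x) Im_H_in_O"
          using False cja[OF x0 x] by simp
        then obtain w' n \<mu>' where n: "norm w' = 1" "norm n = 1" "2 * l + \<mu>' = l\<^sup>2 * \<mu>'" "\<mu>' \<noteq> 0"
          "\<And>v. ?J x v = l *\<^sub>R snd (qcnj w' *\<^sub>H v) + ((\<mu>' - l) * (n \<bullet> snd (qcnj w' *\<^sub>H v))) *\<^sub>R n"
          "(\<Sum>b\<in>Basis. b *\<^sub>H (0, ?J x b)) = - (2 * l + \<mu>') *\<^sub>R w'"
          unfolding N_def using coassociative_normal_form.regular_normal_form[OF F, unfolded t1] by blast
        note \<mu>' = mu[OF n(3)]
        show "2 * l + \<mu> = l\<^sup>2 * \<mu>" "\<mu> \<noteq> 0" using n(3,4) unfolding \<mu>' by blast+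
        show "\<exists>w n. norm w = 1 \<and> norm n = 1 \<and>
          (\<forall>v. ?J x v = l *\<^sub>R snd (qcnj w *\<^sub>H v) + ((\<mu> - l) * (n \<bullet> snd (qcnj w *\<^sub>H v))) *\<^sub>R n) \<and>
          (\<Sum>b\<in>Basis. b *\<^sub>H (0, ?J x b)) = - (2 * l + \<mu>) *\<^sub>R w"
          using n(1,2,5,6) unfolding \<mu>' by blast
      qed
      note mu0 = mu'[OF x0]
      have "(\<exists>L c. linear L \<and> (\<forall>x\<in>D. g x = L x + c)) \<or>
        (l = - 2 * (\<mu> - l) \<and> (\<exists>x0 y0 \<epsilon>. fst \<epsilon> = 0 \<and> norm \<epsilon> = 1 \<and> x0 \<notin> D \<and>
          (\<forall>x\<in>D. g x = y0 + ((\<mu> - l) / norm (x - x0)) *\<^sub>R snd (qcnj (x - x0) *\<^sub>H \<epsilon> *\<^sub>H (x - x0)))))"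
        by (rule regular_rigidity[OF D g l mu0 reg])
      then show ?thesis
      proof (elim disjE conjE exE)
        fix L c assume "linear L" "\<forall>x\<in>D. g x = L x + c"
        then show ?thesis using affine by blast
      next
        fix x0 y0 \<epsilon>
        assume lm: "l = - 2 * (\<mu> - l)" and \<epsilon>: "fst \<epsilon> = 0" "norm \<epsilon> = 1" and x0': "x0 \<notin> D"
          and g_eq: "\<forall>x\<in>D. g x = y0 + ((\<mu> - l) / norm (x - x0)) *\<^sub>R snd (qcnj (x - x0) *\<^sub>H \<epsilon> *\<^sub>H (x - x0))"
        have \<mu>: "l = 2 * \<mu>" "\<mu> - l = - \<mu>" "\<mu> > 0" using lm l by simp_all
        \<comment> \<open>Inserting \<open>l = 2 * \<mu>\<close> in the relation between trace and
          determinant produces the constant of \<open>LO_map\<close>.\<close>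
        have "\<mu> * (\<mu>\<^sup>2 * 4) = \<mu> * 5"
          using mu0(1) unfolding \<mu>(1) by (simp add: power2_eq_square algebra_simps)
        then have "\<mu>\<^sup>2 * 4 = 5" using \<mu>(3) by simp
        then have "(2 * \<mu>)\<^sup>2 = 5" by (simp add: power_mult_distrib)
        then have \<mu>5: "\<mu> = sqrt 5 / 2" using \<mu>(3) by (metis real_sqrt_unique nonzero_mult_div_cancel_left zero_neq_numeral less_imp_le mult_nonneg_nonneg zero_le_numeral)
        \<comment> \<open>The coefficient \<open>\<mu> - l\<close> is negative, and its sign is
          absorbed into \<open>\<epsilon>\<close>.\<close>
        have f_eq: "\<forall>x\<in>D. f x = LO_map (- \<epsilon>) (x - x0) + (0, y0)"
        proof
          fix x assume x: "x \<in> D"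
          have im: "fst (qcnj y *\<^sub>H (- \<epsilon>) *\<^sub>H y) = 0" for y
            using \<epsilon>(1) by (simp add: quat_coords algebra_simps)
          have neg: "qcnj y *\<^sub>H (- \<epsilon>) *\<^sub>H y = - (qcnj y *\<^sub>H \<epsilon> *\<^sub>H y)" for y
            by (simp only: qmul.minus_left qmul.minus_right)
          have "snd (LO_map (- \<epsilon>) (x - x0)) = g x - y0"
            using g_eq[rule_format, OF x, unfolded \<mu>(2), unfolded \<mu>5]
            unfolding LO_map_def neg by (simp add: divide_divide_eq_left' mult.commute del: snd_qmul)
          moreover have "fst (LO_map (- \<epsilon>) (x - x0)) = 0"
            unfolding LO_map_def fst_scaleR im by simp
          ultimately show "f x = LO_map (- \<epsilon>) (x - x0) + (0, y0)"
            using fg[OF x] by (simp add: prod_eq_iff)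
        qed
        have "(0, y0) \<in> Im_H" "- \<epsilon> \<in> Im_H" "norm (- \<epsilon>) = 1"
          using \<epsilon> by (simp_all add: Im_H_def)
        then show ?thesis
          using LO_graph_open[OF D(1) x0' _ _ _ f_eq] f_eq x0' unfolding M by blast
      qed
    qed
  qed
qed

end
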